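(* Let $s:\mathbb{R}_+\to\mathbb{R}$ be a non-decreasing function of class $C^2(\mathbb{R}_+)$, let $\Omega_s$ be the rotating half-plane with rotation function $s$, and put $h(x)=s(e^x)$. Suppose that $h'(x)\to 0$ as $x\to+\infty$ and $$\int_0^\infty h'(x)^2\,dx<\infty.$$ Then there exists a nonconstant entire function of finite exponential type which is bounded in $\Omega_s$.
   Context: For a non-decreasing continuous function $s:\mathbb{R}_+\to\mathbb{R}$, the rotating half-plane with rotation function $s$ is $$\Omega_s=\{re^{i\alpha}\mid r>0,\ s(r)<\alpha<s(r)+\pi\}.$$ An entire function $F$ is of finite exponential type if there are constants $A,B>0$ with $|F(z)|\le A e^{B|z|}$ for all $z\in\mathbb{C}$. *)

theory Defs
  imports "HOL-Analysis.Analysis"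
begin

(* The half-line \<real>\<^sub>+ is rendered as {0<..}: the rotating half-plane only involves s r for r > 0. *)

definition rotating_half_plane :: "(real \<Rightarrow> real) \<Rightarrow> complex set" where
  "rotating_half_plane s =
     {of_real r * cis \<alpha> | r \<alpha>. r > 0 \<and> s r < \<alpha> \<and> \<alpha> < s r + pi}"

definition finite_exponential_type :: "(complex \<Rightarrow> complex) \<Rightarrow> bool" where
  "finite_exponential_type F \<longleftrightarrow>
     (\<exists>A>0. \<exists>B>0. \<forall>z. norm (F z) \<le> A * exp (B * norm z))"

(* Intended for open S only: the library's C1_differentiable_on uses two-sided derivatives. *)
definition C2_differentiable_on :: "(real \<Rightarrow> real) \<Rightarrow> real set \<Rightarrow> bool"
    (infix "C2'_differentiable'_on" 50) where
  "f C2_differentiable_on S \<longleftrightarrow>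
     f C1_differentiable_on S \<and> deriv f C1_differentiable_on S"

end

theory Submission
  imports Defs "HOL-Complex_Analysis.Complex_Analysis"
begin

text \<open>
  Suppose that \<open>\<Phi>\<close> is holomorphic on the right half-plane, that \<open>\<bar>\<Phi>(p)\<bar>\<close> is comparable to \<open>\<bar>p\<bar>\<close>, and that \<open>\<Phi>\<close>
  keeps a positive distance from a set \<open>S\<close>. Then \<open>F(z) = \<integral> W(p) / (\<Phi>(p) - z) dp\<close> over a line \<open>Re p = \<sigma>\<close>, with a
  weight \<open>W\<close> of size \<open>exp (Re p) / (1 + \<bar>p\<bar>\<^sup>2)\<close>, has Taylor coefficients that do not depend on \<open>\<sigma>\<close>. The choice
  \<open>\<sigma> = n + 1\<close> bounds the \<open>n\<close>-th coefficient by \<open>C B^n / n!\<close>, so \<open>F\<close> is of finite exponential type, and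
  \<open>\<sigma> = 1\<close> shows that \<open>F\<close> is bounded on \<open>S\<close>. The weight is chosen as \<open>\<Phi>\<^sup>2\<close> times a function that is
  nonnegative on \<open>Re p = 1\<close>, so that the first Taylor coefficient is positive.

  In logarithmic coordinates the complement of the rotating half-plane is the curved strip of all \<open>x + i y\<close>
  with \<open>\<bar>y - h(x)\<bar> < \<pi>/2\<close>. Writing \<open>\<Phi>(p) = - i exp (f (log p))\<close>, one needs a holomorphic map \<open>f\<close> of the straight strip
  \<open>\<bar>Im z\<bar> < \<pi>/2\<close> into this curved strip with \<open>Re f(z) - Re z\<close> bounded. It is obtained as
  \<open>f(z) = z + i H(z) - N(z)\<close>, where \<open>Re H\<close> is the Poisson integral of a reparametrised
  \<open>h\<close> on both edges and \<open>N\<close> moves both edges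
  inwards by a margin. The edges are displaced horizontally by at most \<open>C m\<close>, where \<open>m\<close> is a local \<open>L\<^sup>2\<close> norm of \<open>h'\<close>.
  As \<open>h\<close> is monotone, the margin \<open>h(a + C m) - h(a - C m) + C' m\<^sup>2\<close> absorbs all errors, and it is integrable
  because \<open>h'\<close> is square integrable; this makes the cumulative effect of \<open>N\<close> on \<open>Re f\<close> bounded.
\<close>

section \<open>Integrals along vertical lines\<close>

text \<open>The obstacle is a circularity: the edges must land inside a strip described by
  \<open>h\<close> at the point \<open>Re f\<close>, which is unknown before \<open>f\<close> is
  built. The inward push \<open>N\<close> makes \<open>Re f\<close> drift by the accumulated margin,
  so the data are taken along the solution \<open>A\<close> of
  \<open>A' = 1 - 2 / pi * margin A\<close>; then \<open>Re f\<close> stays near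
  \<open>A (Re z)\<close>, and the data \<open>h (A x)\<close> sit at the right place up to a
  displacement of order \<open>m\<close>. Near an edge, the Poisson integral of data with a
  square-root modulus of size \<open>m\<close> errs by a multiple of \<open>m * sqrt c\<close>,
  where \<open>c\<close> is the cosine of the height. Since
  \<open>2 K m sqrt c <= c + K^2 m^2\<close>, the distance to the edge pays for one part and a
  margin quadratic in \<open>m\<close> for the other. The oscillation of \<open>h\<close> over
  windows of width \<open>m\<close> is integrable because Fubini reduces it to
  \<open>h' * m\<close>, which is at most \<open>h'^2 + m^2\<close>. Finally \<open>m^2\<close> is
  kept above a multiple of \<open>exp (- |x| / 2)\<close>: at radius \<open>exp x\<close> an angular
  gap of order \<open>m^2\<close> then has a length bounded below, and this is the positive distance
  of \<open>\<Phi>\<close> from the set.\<close>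

lemma one_plus_square [simp]:
  fixes x :: real
  shows "0 < 1 + x\<^sup>2" "0 \<le> 1 + x\<^sup>2" "1 + x\<^sup>2 \<noteq> 0" "\<not> 1 + x\<^sup>2 \<le> 0"
  using zero_le_power2[of x] by linarith+

lemma integrable_inverse_one_plus_square:
  "integrable lborel (\<lambda>y::real. 1 / (1 + y\<^sup>2))"
proof -
  have nz: "1 + y\<^sup>2 \<noteq> 0" for y :: real
    using zero_le_power2[of y] by linarith
  have "set_integrable lborel (einterval (-\<infinity>) \<infinity>) (\<lambda>y::real. 1 / (1 + y\<^sup>2))"
  proof (rule interval_integral_FTC_nonneg(1)[where F = arctan])
    show "DERIV arctan x :> 1 / (1 + x\<^sup>2)" for x
      by (auto intro!: derivative_eq_intros simp: divide_inverse)
    show "isCont (\<lambda>y. 1 / (1 + y\<^sup>2)) x" for x :: real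
      using nz by (intro continuous_intros) auto
    show "AE x in lborel. - \<infinity> < ereal x \<longrightarrow> ereal x < \<infinity> \<longrightarrow> 0 \<le> 1 / (1 + x\<^sup>2)"
      by (simp add: add_nonneg_nonneg)
    show "((arctan \<circ> real_of_ereal) \<longlongrightarrow> - (pi/2)) (at_right (-\<infinity>))"
      unfolding ereal_tendsto_simps1 by (rule tendsto_arctan_at_bot)
    show "((arctan \<circ> real_of_ereal) \<longlongrightarrow> pi/2) (at_left \<infinity>)"
      unfolding ereal_tendsto_simps1 by (rule tendsto_arctan_at_top)
  qed simp
  then show ?thesis
    by (simp add: einterval_def set_integrable_def)
qed

lemma vertical_line_integrable:
  fixes g :: "complex \<Rightarrow> complex"
  assumes g: "continuous_on {p. Re p > 0} g" and a: "a > 0"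
    and bd: "\<And>y. norm (g (Complex a y)) \<le> M / (1 + y\<^sup>2)"
  shows "integrable lborel (\<lambda>y. g (Complex a y))"
proof (rule Bochner_Integration.integrable_bound)
  show "integrable lborel (\<lambda>y::real. M * (1 / (1 + y\<^sup>2)))"
    by (intro integrable_mult_right integrable_inverse_one_plus_square)
  have "continuous_on UNIV (\<lambda>y. g (Complex a y))"
    unfolding Complex_eq
    by (rule continuous_on_compose2[OF g]) (use a in \<open>auto intro!: continuous_intros\<close>)
  then show "(\<lambda>y. g (Complex a y)) \<in> borel_measurable lborel"
    by (simp add: borel_measurable_continuous_onI)
  show "AE y in lborel. norm (g (Complex a y)) \<le> norm (M * (1 / (1 + y\<^sup>2)))"
  proof (rule AE_I2)
    fix y
    have "M / (1 + y\<^sup>2) \<le> norm (M * (1 / (1 + y\<^sup>2)))"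
      using abs_ge_self[of "M / (1 + y\<^sup>2)"] by simp
    then show "norm (g (Complex a y)) \<le> norm (M * (1 / (1 + y\<^sup>2)))"
      using bd[of y] by linarith
  qed
qed

text \<open>Cauchy's theorem without contours: a primitive \<open>G\<close> on the half-plane turns
  the integral over a truncated line into a difference of two values of \<open>G\<close>, and along
  the horizontal edges at heights \<open>n\<close> and \<open>- n\<close> the primitive changes by
  O(1/n^2).\<close>

lemma vertical_line_shift:
  fixes g :: "complex \<Rightarrow> complex"
  assumes g: "g holomorphic_on {p. Re p > 0}" and a: "0 < a" and b: "0 < b"
    and bd: "\<And>p. Re p \<in> closed_segment a b \<Longrightarrow> norm (g p) \<le> M / (1 + (Im p)\<^sup>2)"
  shows "(LINT y|lborel. g (Complex a y)) = (LINT y|lborel. g (Complex b y))"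
proof -
  have opn: "open {p. Re p > 0}" by (simp add: open_halfspace_Re_gt)
  have cvx: "convex {p. Re p > 0}" by (simp add: convex_halfspace_Re_gt)
  have cont: "continuous_on {p. Re p > 0} g"
    using g by (rule holomorphic_on_imp_continuous_on)
  obtain G where G: "\<And>p. Re p > 0 \<Longrightarrow> (G has_field_derivative g p) (at p)"
    using holomorphic_convex_primitive'[OF cvx opn g] opn
    by (metis (no_types, lifting) at_within_open mem_Collect_eq)
  have line: "(\<lambda>n::nat. \<i> * (LINT y|lborel. indicator {- real n..real n} y *\<^sub>R g (Complex c y)))
                 = (\<lambda>n. G (Complex c n) - G (Complex c (- real n)))" if c: "c > 0" for c
  proof
    fix n :: nat
    have "(LINT y|lborel. indicator {- real n..real n} y *\<^sub>R (\<i> * g (Complex c y)))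
            = G (Complex c n) - G (Complex c (- real n))"
    proof (rule integral_FTC_atLeastAtMost)
      fix y :: real
      have "((\<lambda>y. G (of_real c + \<i> * of_real y)) has_vector_derivative \<i> * g (of_real c + \<i> * of_real y)) (at y)"
      proof -
        have "(G has_field_derivative g (of_real c + \<i> * of_real y)) (at (of_real c + \<i> * of_real y))"
          by (rule G) (use c in simp)
        moreover have "((\<lambda>y. of_real c + \<i> * of_real y) has_vector_derivative \<i>) (at y)"
          by (auto intro!: derivative_eq_intros)
        ultimately show ?thesis
          using field_vector_diff_chain_at by (fastforce simp: o_def)
      qed
      then show "((\<lambda>y. G (Complex c y)) has_vector_derivative \<i> * g (Complex c y)) (at y within {- real n..real n})"
        by (simp add: Complex_eq has_vector_derivative_at_within)
    next
      show "continuous_on {- real n..real n} (\<lambda>y. \<i> * g (Complex c y))"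
        unfolding Complex_eq
        by (intro continuous_intros continuous_on_compose2[OF cont]) (use c in auto)
    qed simp
    moreover have "(LINT y|lborel. indicator {- real n..real n} y *\<^sub>R (\<i> * g (Complex c y)))
      = \<i> * (LINT y|lborel. indicator {- real n..real n} y *\<^sub>R g (Complex c y))"
      by (subst integral_mult_right_zero[symmetric]) (simp add: scaleR_conv_of_real mult.left_commute)
    ultimately show "\<i> * (LINT y|lborel. indicator {- real n..real n} y *\<^sub>R g (Complex c y))
        = G (Complex c n) - G (Complex c (- real n))" by simp
  qed
  have lim: "(\<lambda>n::nat. G (Complex c n) - G (Complex c (- real n))) \<longlonglongrightarrow> \<i> * (LINT y|lborel. g (Complex c y))"
    if c: "c > 0" and cseg: "c \<in> closed_segment a b" for c
  proof -
    have int: "integrable lborel (\<lambda>y. g (Complex c y))"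
      by (rule vertical_line_integrable[OF cont c, where M = M]) (use bd[of "Complex c y" for y] cseg in simp)
    have "(\<lambda>n::nat. LINT y|lborel. indicator {- real n..real n} y *\<^sub>R g (Complex c y))
            \<longlonglongrightarrow> (LINT y|lborel. g (Complex c y))"
    proof (rule integral_dominated_convergence[where w = "\<lambda>y. norm (g (Complex c y))"])
      show "AE y in lborel. (\<lambda>n. indicat_real {- real n..real n} y *\<^sub>R g (Complex c y)) \<longlonglongrightarrow> g (Complex c y)"
      proof (rule AE_I2)
        fix y :: real
        have "eventually (\<lambda>n. indicat_real {- real n..real n} y *\<^sub>R g (Complex c y) = g (Complex c y)) sequentially"
          using eventually_ge_at_top[of "nat \<lceil>\<bar>y\<bar>\<rceil>"]
        proof eventually_elim
          case (elim n)
          then have "\<bar>y\<bar> \<le> real n" by linarith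
          then show ?case by (auto simp: indicator_def abs_le_iff)
        qed
        then show "(\<lambda>n. indicat_real {- real n..real n} y *\<^sub>R g (Complex c y)) \<longlonglongrightarrow> g (Complex c y)"
          by (rule tendsto_eventually)
      qed
    qed (use int in \<open>auto simp: indicator_def intro!: borel_measurable_scaleR\<close>)
    then have "(\<lambda>n::nat. \<i> * (LINT y|lborel. indicator {- real n..real n} y *\<^sub>R g (Complex c y)))
            \<longlonglongrightarrow> \<i> * (LINT y|lborel. g (Complex c y))"
      by (intro tendsto_intros)
    then show ?thesis by (subst (asm) line[OF c])
  qed
  \<comment> \<open>The sign \<open>e\<close> selects the upper or the lower horizontal
    edge.\<close>
  have edge: "(\<lambda>n. G (Complex b (e * real n)) - G (Complex a (e * real n))) \<longlonglongrightarrow> 0"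
    if e: "e \<in> {1, -1}" for e
  proof (rule Lim_null_comparison)
    show "\<forall>\<^sub>F n in sequentially. norm (G (Complex b (e * real n)) - G (Complex a (e * real n)))
            \<le> \<bar>M\<bar> / (1 + (real n)\<^sup>2) * \<bar>b - a\<bar>"
    proof (rule always_eventually, rule allI)
      fix n :: nat
      let ?S = "closed_segment (Complex a (e * n)) (Complex b (e * n))"
      have S: "Re p \<in> closed_segment a b \<and> Im p = e * n" if "p \<in> ?S" for p
      proof -
        from that obtain t where t: "0 \<le> t" "t \<le> 1"
          and p: "p = (1 - t) *\<^sub>R Complex a (e * n) + t *\<^sub>R Complex b (e * n)"
          by (auto simp: closed_segment_def)
        have "Re p = (1 - t) *\<^sub>R a + t *\<^sub>R b" unfolding p by simp
        then have "Re p \<in> closed_segment a b" using t unfolding closed_segment_def by blast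
        moreover have "Im p = e * n" unfolding p by (simp add: left_diff_distrib)
        ultimately show ?thesis by simp
      qed
      have "norm (G (Complex b (e * n)) - G (Complex a (e * n)))
              \<le> \<bar>M\<bar> / (1 + (real n)\<^sup>2) * norm (Complex b (e * n) - Complex a (e * n))"
      proof (rule field_differentiable_bound[where S = ?S and f' = g])
        fix p assume p: "p \<in> ?S"
        have "closed_segment a b \<subseteq> {0<..}"
          using a b by (auto simp: closed_segment_eq_real_ivl)
        then have "Re p > 0" using S[OF p] by auto
        then show "(G has_field_derivative g p) (at p within ?S)"
          using G has_field_derivative_at_within by blast
        have "(Im p)\<^sup>2 = (real n)\<^sup>2" using S[OF p] e by auto
        then show "norm (g p) \<le> \<bar>M\<bar> / (1 + (real n)\<^sup>2)"
          using bd[of p] S[OF p] divide_right_mono[OF abs_ge_self[of M], of "1 + (real n)\<^sup>2"]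
          by (simp add: add_nonneg_nonneg)
      qed auto
      also have "norm (Complex b (e * n) - Complex a (e * n)) = \<bar>b - a\<bar>"
        by (simp add: cmod_def)
      finally show "norm (G (Complex b (e * real n)) - G (Complex a (e * real n)))
            \<le> \<bar>M\<bar> / (1 + (real n)\<^sup>2) * \<bar>b - a\<bar>" .
    qed
    have "(\<lambda>n. 1 / (1 + (real n)\<^sup>2)) \<longlonglongrightarrow> 0"
    proof (rule Lim_null_comparison[OF _ lim_inverse_n])
      show "\<forall>\<^sub>F n in sequentially. norm (1 / (1 + (real n)\<^sup>2)) \<le> inverse (of_nat n)"
        using eventually_gt_at_top[of 0]
      proof eventually_elim
        case (elim n)
        then have "real n \<le> 1 + (real n)\<^sup>2"
          by (smt (verit) of_nat_0_less_iff self_le_power pos2 One_nat_def Suc_leI of_nat_1 of_nat_le_iff)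
        then show ?case using elim by (auto simp: field_simps abs_if add_pos_nonneg)
      qed
    qed
    from tendsto_mult[OF this tendsto_const[of "\<bar>M\<bar> * \<bar>b - a\<bar>"]]
    show "(\<lambda>n. \<bar>M\<bar> / (1 + (real n)\<^sup>2) * \<bar>b - a\<bar>) \<longlonglongrightarrow> 0" by (simp add: mult_ac)
  qed
  have "(\<lambda>n. (G (Complex b n) - G (Complex b (- real n))) - (G (Complex a n) - G (Complex a (- real n)))) \<longlonglongrightarrow> 0"
    using tendsto_diff[OF edge[of 1] edge[of "-1"]] by (simp add: algebra_simps)
  moreover have "(\<lambda>n. (G (Complex b n) - G (Complex b (- real n))) - (G (Complex a n) - G (Complex a (- real n))))
      \<longlonglongrightarrow> \<i> * (LINT y|lborel. g (Complex b y)) - \<i> * (LINT y|lborel. g (Complex a y))"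
    by (intro tendsto_diff lim a b) auto
  ultimately have "\<i> * (LINT y|lborel. g (Complex b y)) - \<i> * (LINT y|lborel. g (Complex a y)) = 0"
    using LIMSEQ_unique by blast
  then show ?thesis by simp
qed

section \<open>The weight of the line integral\<close>

definition sinhc :: "complex \<Rightarrow> complex" where
  "sinhc w = (if w = 0 then 1 else sinh w / w)"

lemma sinhc_holomorphic: "sinhc holomorphic_on UNIV"
proof -
  have "(\<lambda>z. if z = 0 then deriv sinh 0 else (sinh z - sinh 0) / (z - 0)) holomorphic_on (UNIV :: complex set)"
    by (rule pole_lemma) (auto simp: sinh_field_def[abs_def] intro!: holomorphic_intros)
  moreover have "deriv sinh (0::complex) = 1"
    by (rule DERIV_imp_deriv) (auto intro!: derivative_eq_intros)
  ultimately show ?thesis by (simp add: sinhc_def[abs_def] cong: if_cong)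
qed

lemma norm_sinh_le: "norm (sinh w) \<le> exp \<bar>Re w\<bar>" for w :: complex
proof -
  have "norm (sinh w) \<le> (norm (exp w) + norm (exp (-w))) / 2"
    unfolding sinh_field_def norm_divide
    by (intro divide_mono norm_triangle_ineq4) auto
  also have "\<dots> \<le> exp \<bar>Re w\<bar>"
    by (auto simp: abs_if) 
  finally show ?thesis .
qed

lemma sinhc_bound: "\<exists>K>0. \<forall>w. norm (sinhc w) \<le> K * exp \<bar>Re w\<bar> / (1 + norm w)"
proof -
  have "continuous_on (cball 0 1) sinhc"
    by (meson continuous_on_subset holomorphic_on_imp_continuous_on sinhc_holomorphic top_greatest)
  then have "bounded (sinhc ` cball 0 1)"
    by (intro compact_imp_bounded compact_continuous_image) auto
  then obtain K where K: "K > 0" "\<And>w. norm w \<le> 1 \<Longrightarrow> norm (sinhc w) \<le> K"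
    unfolding bounded_pos by auto
  have "norm (sinhc w) \<le> (2 * K + 2) * exp \<bar>Re w\<bar> / (1 + norm w)" for w
  proof (cases "norm w \<le> 1")
    case True
    have "norm (sinhc w) * (1 + norm w) \<le> K * 2"
      using K True by (intro mult_mono) auto
    also have "\<dots> \<le> (2 * K + 2) * exp \<bar>Re w\<bar>"
      using K by (smt (verit) mult_le_cancel_left1 one_le_exp_iff)
    finally show ?thesis by (simp add: field_simps add_pos_nonneg)
  next
    case False
    then have "w \<noteq> 0" by auto
    then have "norm (sinhc w) * (1 + norm w) = norm (sinh w) * ((1 + norm w) / norm w)"
      by (simp add: sinhc_def norm_divide)
    also have "\<dots> \<le> exp \<bar>Re w\<bar> * 2"
      using False \<open>w \<noteq> 0\<close> by (intro mult_mono norm_sinh_le) (simp_all add: divide_le_eq)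
    also have "\<dots> \<le> (2 * K + 2) * exp \<bar>Re w\<bar>"
      using K by (simp add: algebra_simps)
    finally show ?thesis by (simp add: field_simps add_pos_nonneg)
  qed
  then show ?thesis using K by (intro exI[of _ "2*K+2"]) auto
qed


lemma entire_of_factorial_bound:
  fixes a :: "nat \<Rightarrow> complex"
  assumes a: "\<And>n. norm (a n) \<le> K * B ^ n / fact n" and K: "K > 0" and B: "B > 0"
  defines "F \<equiv> \<lambda>z. \<Sum>n. a n * z ^ n"
  shows "summable (\<lambda>n. a n * z ^ n)" "(F has_field_derivative (\<Sum>n. diffs a n * z ^ n)) (at z)"
    "norm (F z) \<le> K * exp (B * norm z)"
proof -
  have bd: "norm (a n * z ^ n) \<le> K * ((B * norm z) ^ n /\<^sub>R fact n)" for n z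
  proof -
    have "norm (a n * z ^ n) \<le> (K * B ^ n / fact n) * norm z ^ n"
      unfolding norm_mult norm_power by (intro mult_right_mono a) auto
    then show ?thesis by (simp add: power_mult_distrib field_simps)
  qed
  have sm: "summable (\<lambda>n. K * ((B * norm z) ^ n /\<^sub>R fact n))" for z :: complex
    by (intro summable_mult summable_exp_generic)
  show summ: "summable (\<lambda>n. a n * z ^ n)" for z
    by (rule summable_comparison_test'[OF sm bd])
  show "(F has_field_derivative (\<Sum>n. diffs a n * z ^ n)) (at z)"
    unfolding F_def by (rule termdiffs_strong_converges_everywhere) (rule summ)
  have "norm (F z) \<le> (\<Sum>n. K * ((B * norm z) ^ n /\<^sub>R fact n))"
    unfolding F_def by (rule norm_suminf_le[OF bd sm])
  also have "\<dots> = K * exp (B * norm z)"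
    unfolding exp_def by (rule suminf_mult) (rule summable_exp_generic)
  finally show "norm (F z) \<le> K * exp (B * norm z)" .
qed

text \<open>The function \<open>u\<close> below is a fourth power, so it decays like |p|^-4 and
  leaves |p|^-2 after multiplication by \<open>\<Phi>^2\<close>; the factor 1/4 in its argument then
  limits the growth to \<open>exp |Re p - 1|\<close>. On \<open>Re p = 1\<close> it equals
  \<open>(sin t / t)^4\<close> with \<open>t = y / 4\<close>, which is nonnegative because the power
  is even.\<close>

lemma laplace_weight_exists:
  fixes \<Phi> :: "complex \<Rightarrow> complex"
  assumes hol: "\<Phi> holomorphic_on {p. Re p > 0}" and nz: "\<And>p. Re p > 0 \<Longrightarrow> \<Phi> p \<noteq> 0"
    and up: "\<And>p. Re p > 0 \<Longrightarrow> norm (\<Phi> p) \<le> C * norm p"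
  obtains W K where "W holomorphic_on {p. Re p > 0}" "K > 0"
    "\<And>p. Re p > 0 \<Longrightarrow> norm (W p) \<le> K * exp (Re p) / (1 + (norm p)\<^sup>2)"
    "(LINT y|lborel. W (Complex 1 y) / \<Phi> (Complex 1 y) ^ 2) \<noteq> 0"
proof -
  obtain K where K: "K > 0" "\<And>w. norm (sinhc w) \<le> K * exp \<bar>Re w\<bar> / (1 + norm w)"
    using sinhc_bound by blast
  define u where "u = (\<lambda>p. sinhc ((p - 1) / 4) ^ 4)"
  define W where "W = (\<lambda>p. u p * \<Phi> p ^ 2)"
  have "(sinhc \<circ> (\<lambda>p. (p - 1) / 4)) holomorphic_on UNIV"
    by (rule holomorphic_on_compose[OF _ holomorphic_on_subset[OF sinhc_holomorphic]])
       (auto intro!: holomorphic_intros)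
  then have u_hol: "u holomorphic_on UNIV"
    unfolding u_def o_def by (intro holomorphic_intros)
  then have u_hol': "u holomorphic_on {p. Re p > 0}" by (rule holomorphic_on_subset) auto
  have u_bd: "norm (u p) \<le> 289 * K ^ 4 * exp 1 * exp (Re p) / (1 + (norm p)\<^sup>2)\<^sup>2" if "Re p > 0" for p
  proof -
    define w where "w = (p - 1) / 4"
    have p: "p = 1 + 4 * w" by (simp add: w_def field_simps)
    have "norm p \<le> 1 + 4 * norm w"
      unfolding p by (rule order_trans[OF norm_triangle_ineq]) (simp add: norm_mult)
    then have "1 + (norm p)\<^sup>2 \<le> 1 + (1 + 4 * norm w)\<^sup>2"
      by (intro add_left_mono power_mono) auto
    \<comment> \<open>For \<open>t >= 0\<close> one has
      \<open>2 + 8 t + 16 t^2 <= 17 (1 + t)^2\<close>; squaring produces the constant 289.\<close>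
    also have "\<dots> \<le> 17 * (1 + norm w)\<^sup>2"
      by (simp add: power2_eq_square algebra_simps)
    finally have "(1 + (norm p)\<^sup>2)\<^sup>2 \<le> (17 * (1 + norm w)\<^sup>2)\<^sup>2"
      by (intro power_mono) auto
    then have q: "(1 + (norm p)\<^sup>2)\<^sup>2 \<le> 289 * (1 + norm w) ^ 4"
      by (simp add: power_mult_distrib flip: power_mult)
    have e: "4 * \<bar>Re w\<bar> \<le> 1 + Re p" using that by (simp add: w_def)
    have "norm (u p) \<le> (K * exp \<bar>Re w\<bar> / (1 + norm w)) ^ 4"
      unfolding u_def norm_power w_def[symmetric] by (intro power_mono K) auto
    also have "\<dots> = K ^ 4 * exp (4 * \<bar>Re w\<bar>) / (1 + norm w) ^ 4"
      by (simp add: power_divide power_mult_distrib flip: exp_of_nat_mult)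
    also have "\<dots> \<le> K ^ 4 * exp (1 + Re p) / (1 + norm w) ^ 4"
      using e K by (intro divide_right_mono mult_left_mono) auto
    also have "\<dots> \<le> K ^ 4 * exp (1 + Re p) * (289 / (1 + (norm p)\<^sup>2)\<^sup>2)"
    proof -
      have "1 / (1 + norm w) ^ 4 \<le> 289 / (1 + (norm p)\<^sup>2)\<^sup>2"
        using q by (subst frac_le_eq) (auto simp: divide_le_0_iff add_nonneg_eq_0_iff add_pos_nonneg mult_less_0_iff
            intro!: divide_nonpos_pos mult_pos_pos zero_less_power add_pos_nonneg)
      from mult_left_mono[OF this, of "K ^ 4 * exp (1 + Re p)"] show ?thesis using K by simp
    qed
    finally show ?thesis by (simp add: exp_add mult_ac)
  qed
  have W_bd: "norm (W p) \<le> (289 * K ^ 4 * exp 1 * (1 + C\<^sup>2)) * exp (Re p) / (1 + (norm p)\<^sup>2)" if p: "Re p > 0" for p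
  proof -
    have "(norm (\<Phi> p))\<^sup>2 \<le> (C * norm p)\<^sup>2"
      by (intro power_mono up p) auto
    also have "\<dots> \<le> (1 + C\<^sup>2) * (1 + (norm p)\<^sup>2)"
      by (simp add: power_mult_distrib algebra_simps)
    finally have f: "(norm (\<Phi> p))\<^sup>2 \<le> (1 + C\<^sup>2) * (1 + (norm p)\<^sup>2)" .
    have "norm (W p) \<le> 289 * K ^ 4 * exp 1 * exp (Re p) / (1 + (norm p)\<^sup>2)\<^sup>2 * ((1 + C\<^sup>2) * (1 + (norm p)\<^sup>2))"
      unfolding W_def norm_mult norm_power
      by (intro mult_mono u_bd p f) (use K in auto)
    also have "\<dots> = (289 * K ^ 4 * exp 1 * (1 + C\<^sup>2)) * exp (Re p) / (1 + (norm p)\<^sup>2)"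
    proof -
      have "1 + (norm p)\<^sup>2 > 0" by (simp add: add_pos_nonneg)
      then show ?thesis by (simp add: power2_eq_square[of "1 + (norm p)\<^sup>2"])
    qed
    finally show ?thesis .
  qed
  define U where "U = (\<lambda>y. (sin (y / 4) / (y / 4)) ^ 4 :: real)"
  have u_line: "u (Complex 1 y) = of_real (if y = 0 then 1 else U y)" for y
  proof -
    have w: "(Complex 1 y - 1) / 4 = \<i> * of_real (y / 4)"
      by (simp add: complex_eq_iff)
    have s: "sinh (\<i> * of_real t) = \<i> * of_real (sin t)" for t
      by (simp add: sinh_field_def sin_exp_eq field_simps flip: sin_of_real)
    show ?thesis
    proof (cases "y = 0")
      case True
      then show ?thesis unfolding u_def w by (simp add: sinhc_def)
    next
      case False
      then have "sinhc (\<i> * of_real (y / 4)) = of_real (sin (y/4) / (y/4))"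
        unfolding sinhc_def s by simp
      then show ?thesis unfolding u_def w U_def using False by simp
    qed
  qed
  have W_line: "W p / \<Phi> p ^ 2 = u p" if "Re p > 0" for p
    using nz[OF that] by (simp add: W_def)
  have int: "integrable lborel (\<lambda>y. u (Complex 1 y))"
  proof (rule vertical_line_integrable)
    show "continuous_on {p. 0 < Re p} u"
      using u_hol' by (rule holomorphic_on_imp_continuous_on)
    fix y :: real
    have "1 + y\<^sup>2 \<le> (1 + (norm (Complex 1 y))\<^sup>2)\<^sup>2"
    proof -
      have "(norm (Complex 1 y))\<^sup>2 = 1 + y\<^sup>2" by (simp add: cmod_power2)
      then have "1 + y\<^sup>2 \<le> 1 + (norm (Complex 1 y))\<^sup>2" by simp
      also have "\<dots> \<le> (1 + (norm (Complex 1 y))\<^sup>2)\<^sup>2" by (rule self_le_power) auto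
      finally show ?thesis .
    qed
    then have "289 * K ^ 4 * exp 1 * exp 1 / (1 + (norm (Complex 1 y))\<^sup>2)\<^sup>2 \<le> 289 * K ^ 4 * exp 1 * exp 1 / (1 + y\<^sup>2)"
      using K by (intro divide_left_mono mult_pos_pos) (auto intro!: mult_nonneg_nonneg zero_less_power add_pos_nonneg)
    then show "norm (u (Complex 1 y)) \<le> 289 * K ^ 4 * exp 1 * exp 1 / (1 + y\<^sup>2)"
      using u_bd[of "Complex 1 y"] by simp
  qed simp
  have pos: "(LINT y|lborel. (if y = 0 then 1 else U y)) > 0"
  proof -
    have intr: "integrable lborel (\<lambda>y. if y = 0 then 1 else U y)"
      using integrable_Re[OF int] unfolding u_line Re_complex_of_real .
    have nn: "(if y = 0 then 1 else U y) \<ge> 0" for y by (simp add: U_def)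
    \<comment> \<open>Nonnegativity gives a strictly positive integral once the integrand is nonzero
      on a set of positive measure, here the interval from 0 to 1.\<close>
    have "\<not> (AE y in lborel. (if y = 0 then 1 else U y) = 0)"
    proof
      assume "AE y in lborel. (if y = 0 then 1 else U y) = 0"
      moreover have "\<not> ((if y = 0 then 1 else U y) = 0)" if "y \<in> {0<..<1}" for y
        using that sin_gt_zero[of "y / 4"] pi_gt3 by (auto simp: U_def)
      ultimately have "AE y in lborel. y \<notin> {0<..<1::real}"
        by (auto elim!: eventually_mono)
      then have "emeasure lborel {0<..<1::real} = 0"
        by (subst (asm) AE_iff_measurable[where N = "{0<..<1}"]) auto
      then show False by simp
    qed
    then have "(LINT y|lborel. (if y = 0 then 1 else U y)) \<noteq> 0"
      by (subst integral_nonneg_eq_0_iff_AE[OF intr]) (use nn in auto)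
    moreover have "(LINT y|lborel. (if y = 0 then 1 else U y)) \<ge> 0"
      by (intro Bochner_Integration.integral_nonneg nn)
    ultimately show ?thesis by linarith
  qed
  show ?thesis
  proof (rule that[of W])
    show "W holomorphic_on {p. 0 < Re p}"
      unfolding W_def by (intro holomorphic_intros u_hol' hol)
    show "289 * K ^ 4 * exp 1 * (1 + C\<^sup>2) > 0" using K by (simp add: add_pos_nonneg)
    show "norm (W p) \<le> (289 * K ^ 4 * exp 1 * (1 + C\<^sup>2)) * exp (Re p) / (1 + (norm p)\<^sup>2)" if "Re p > 0" for p
      using W_bd[OF that] .
    have "(LINT y|lborel. W (Complex 1 y) / \<Phi> (Complex 1 y) ^ 2) = (LINT y|lborel. of_real (if y = 0 then 1 else U y))"
      by (rule Bochner_Integration.integral_cong) (simp_all only: W_line[of "Complex 1 _", simplified] u_line)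
    also have "\<dots> = of_real (LINT y|lborel. (if y = 0 then 1 else U y))"
      by (rule integral_complex_of_real)
    finally show "(LINT y|lborel. W (Complex 1 y) / \<Phi> (Complex 1 y) ^ 2) \<noteq> 0"
      using pos by simp
  qed
qed


text \<open>The function is introduced through its Taylor series, so that it is entire at once; the
  formula with \<open>1 / (\<Phi> - z)\<close> is claimed only for \<open>z\<close> in
  \<open>S\<close>. It is obtained on a line so far to the right that the geometric series
  converges, and is moved to \<open>Re p = 1\<close> because the denominator stays above
  \<open>\<delta>\<close> on the whole half-plane.\<close>

lemma exists_bounded_entire_of_half_plane_map:
  fixes \<Phi> :: "complex \<Rightarrow> complex"
  assumes hol: "\<Phi> holomorphic_on {p. Re p > 0}" and c: "c > 0"
    and lo: "\<And>p. Re p > 0 \<Longrightarrow> c * norm p \<le> norm (\<Phi> p)"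
    and up: "\<And>p. Re p > 0 \<Longrightarrow> norm (\<Phi> p) \<le> C * norm p"
    and \<delta>: "\<delta> > 0" and sep: "\<And>p z. Re p > 0 \<Longrightarrow> z \<in> S \<Longrightarrow> \<delta> \<le> norm (\<Phi> p - z)"
  shows "\<exists>F A B. F holomorphic_on UNIV \<and> \<not> F constant_on UNIV \<and> A > 0 \<and> B > 0 \<and>
           (\<forall>z. norm (F z) \<le> A * exp (B * norm z)) \<and> bounded (F ` S)"
proof -
  have \<Phi>0: "\<Phi> p \<noteq> 0" if "Re p > 0" for p
  proof -
    have "norm p > 0" using that by auto
    then show ?thesis using lo[OF that] c by (smt (verit) mult_pos_pos norm_zero)
  qed
  obtain W K where W: "W holomorphic_on {p. Re p > 0}" and K: "K > 0"
    and Wb: "\<And>p. Re p > 0 \<Longrightarrow> norm (W p) \<le> K * exp (Re p) / (1 + (norm p)\<^sup>2)"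
    and W1: "(LINT y|lborel. W (Complex 1 y) / \<Phi> (Complex 1 y) ^ 2) \<noteq> 0"
  proof (rule laplace_weight_exists[OF hol \<Phi>0 up])
    fix W K
    assume "W holomorphic_on {p. 0 < Re p}" "0 < K"
      "\<And>p. 0 < Re p \<Longrightarrow> norm (W p) \<le> K * exp (Re p) / (1 + (norm p)\<^sup>2)"
      "(LINT y|lborel. W (Complex 1 y) / \<Phi> (Complex 1 y) ^ 2) \<noteq> 0"
    then show thesis by (rule that)
  qed
  define L where "L = (LINT y|lborel. 1 / (1 + y\<^sup>2) :: real)"
  have L: "L \<ge> 0" unfolding L_def by (intro Bochner_Integration.integral_nonneg) simp
  have cont: "continuous_on {p. Re p > 0} \<Phi>" "continuous_on {p. Re p > 0} W"
    using hol W holomorphic_on_imp_continuous_on by blast+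
  have Wb': "norm (W p) \<le> K * exp (Re p) / (1 + (Im p)\<^sup>2)" if "Re p > 0" for p
  proof -
    have "K * exp (Re p) / (1 + (norm p)\<^sup>2) \<le> K * exp (Re p) / (1 + (Im p)\<^sup>2)"
      using K abs_Im_le_cmod[of p] by (intro divide_left_mono mult_pos_pos) (auto intro: power2_le_iff_abs_le[THEN iffD2])
    then show ?thesis using Wb[OF that] by linarith
  qed
  have div_bd: "norm (W p / X) \<le> K * exp b / d / (1 + (Im p)\<^sup>2)"
    if "Re p > 0" "Re p \<le> b" "0 < d" "d \<le> norm X" for p X b d
  proof -
    have "norm (W p / X) \<le> (K * exp (Re p) / (1 + (Im p)\<^sup>2)) / d"
      unfolding norm_divide using that K by (intro frac_le Wb') auto
    also have "\<dots> \<le> (K * exp b / (1 + (Im p)\<^sup>2)) / d"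
      using that K by (intro divide_right_mono mult_left_mono) auto
    finally show ?thesis by (simp add: mult_ac)
  qed
  have line_int: "integrable lborel (\<lambda>y. W (Complex b y) / X (Complex b y))"
    and line_bd: "norm (LINT y|lborel. W (Complex b y) / X (Complex b y)) \<le> K * exp b / d * L"
    if b: "b > 0" and d: "d > 0" and X: "\<And>y. d \<le> norm (X (Complex b y))"
      and cX: "continuous_on {p. Re p > 0} X" and X0: "\<And>p. Re p > 0 \<Longrightarrow> X p \<noteq> 0"
    for b d and X :: "complex \<Rightarrow> complex"
  proof -
    have bd: "norm (W (Complex b y) / X (Complex b y)) \<le> K * exp b / d / (1 + y\<^sup>2)" for y
      using div_bd[of "Complex b y" b d] b d X by simp
    have "continuous_on {p. 0 < Re p} (\<lambda>p. W p / X p)"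
      by (intro continuous_intros cont cX) (use X0 in auto)
    from vertical_line_integrable[OF this b bd]
    show i: "integrable lborel (\<lambda>y. W (Complex b y) / X (Complex b y))" .
    have "norm (LINT y|lborel. W (Complex b y) / X (Complex b y)) \<le> (LINT y|lborel. K * exp b / d * (1 / (1 + y\<^sup>2)))"
      by (rule Bochner_Integration.integral_norm_bound_integral[OF i],
          intro integrable_mult_right integrable_inverse_one_plus_square)
         (use bd in simp)
    also have "\<dots> = K * exp b / d * L" unfolding L_def by (rule integral_mult_right_zero)
    finally show "norm (LINT y|lborel. W (Complex b y) / X (Complex b y)) \<le> K * exp b / d * L" .
  qed
  have shift: "(LINT y|lborel. W (Complex a y) / X (Complex a y)) = (LINT y|lborel. W (Complex b y) / X (Complex b y))"
    if a: "a > 0" and b: "b > 0" and d: "d > 0" and X: "\<And>p. Re p \<in> closed_segment a b \<Longrightarrow> d \<le> norm (X p)"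
      and cX: "X holomorphic_on {p. Re p > 0}" and X0: "\<And>p. Re p > 0 \<Longrightarrow> X p \<noteq> 0"
    for a b d and X :: "complex \<Rightarrow> complex"
  proof (rule vertical_line_shift[OF _ a b])
    show "(\<lambda>p. W p / X p) holomorphic_on {p. 0 < Re p}"
      by (intro holomorphic_intros W cX) (use X0 in auto)
    fix p assume p: "Re p \<in> closed_segment a b"
    then have "Re p > 0" "Re p \<le> max a b"
      using a b by (auto simp: closed_segment_eq_real_ivl split: if_splits)
    then show "norm (W p / X p) \<le> K * exp (max a b) / d / (1 + (Im p)\<^sup>2)"
      by (intro div_bd d X p)
  qed
  define a where "a = (\<lambda>n. LINT y|lborel. W (Complex 1 y) / \<Phi> (Complex 1 y) ^ Suc n)"
  have pw: "(c * \<sigma>) ^ n \<le> norm (\<Phi> p ^ n)" if "0 < \<sigma>" "\<sigma> \<le> Re p" for \<sigma> p n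
  proof -
    have "c * \<sigma> \<le> c * norm p" using that c complex_Re_le_cmod[of p] by (intro mult_left_mono) auto
    also have "\<dots> \<le> norm (\<Phi> p)" using lo[of p] that by simp
    finally show ?thesis using that c unfolding norm_power by (intro power_mono) auto
  qed
  have a_eq: "a n = (LINT y|lborel. W (Complex \<sigma> y) / \<Phi> (Complex \<sigma> y) ^ Suc n)" if \<sigma>: "\<sigma> > 0" for n \<sigma>
    unfolding a_def
  proof (rule shift)
    show "(c * min 1 \<sigma>) ^ Suc n > 0" using c \<sigma> by simp
    show "(c * min 1 \<sigma>) ^ Suc n \<le> norm (\<Phi> p ^ Suc n)" if "Re p \<in> closed_segment 1 \<sigma>" for p
      using that \<sigma> by (intro pw) (auto simp: closed_segment_eq_real_ivl split: if_splits)
  qed (use \<sigma> \<Phi>0 in \<open>auto intro!: holomorphic_intros hol\<close>)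
  have a_bd: "norm (a n) \<le> (K * exp 1 / c * L + 1) * (exp 1 / c) ^ n / fact n" for n
  proof -
    \<comment> \<open>On the line \<open>Re p = n + 1\<close> the quotient
      \<open>exp (n + 1) / (c (n + 1)) ^ (n + 1)\<close> is at most
      \<open>(exp 1 / c) ^ (n + 1) / n!\<close>.\<close>
    have "norm (a n) \<le> K * exp (real (Suc n)) / (c * real (Suc n)) ^ Suc n * L"
      unfolding a_eq[OF of_nat_0_less_iff[THEN iffD2, OF zero_less_Suc], of n n]
    proof (rule line_bd[where X = "\<lambda>p. \<Phi> p ^ Suc n"])
      show "(c * real (Suc n)) ^ Suc n \<le> norm (\<Phi> (Complex (real (Suc n)) y) ^ Suc n)" for y
        by (rule pw) auto
    qed (use c \<Phi>0 in \<open>auto intro!: continuous_intros cont simp del: of_nat_Suc\<close>)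
    also have "\<dots> \<le> K * exp (real (Suc n)) / (c ^ Suc n * fact n) * L"
    proof -
      have "(fact n :: real) \<le> fact (Suc n)" by (rule fact_mono) simp
      also have "\<dots> \<le> real (Suc n) ^ Suc n" 
        using fact_le_power[of "Suc n", where 'a = real]
        by (simp del: fact_Suc power_Suc of_nat_Suc)
      finally have "c ^ Suc n * fact n \<le> (c * real (Suc n)) ^ Suc n"
        unfolding power_mult_distrib using c by (intro mult_left_mono) auto
      then show ?thesis
        using c K L by (intro mult_right_mono divide_left_mono) (auto intro!: mult_pos_pos zero_less_power simp del: of_nat_Suc)
    qed
    also have "\<dots> = (K * exp 1 / c * L) * (exp 1 / c) ^ n / fact n"
      by (simp add: exp_add power_divide mult_ac flip: exp_of_nat_mult)
    also have "\<dots> \<le> (K * exp 1 / c * L + 1) * (exp 1 / c) ^ n / fact n"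
      using c by (intro divide_right_mono mult_right_mono) auto
    finally show ?thesis .
  qed
  have K': "K * exp 1 / c * L + 1 > 0" and B: "exp 1 / c > 0" using K c L by (auto intro: add_nonneg_pos)
  define F where "F = (\<lambda>z. \<Sum>n. a n * z ^ n)"
  note E = entire_of_factorial_bound[OF a_bd K' B, folded F_def]
  have "F holomorphic_on UNIV"
    using E(2) by (auto simp: holomorphic_on_open)
  moreover have "\<not> F constant_on UNIV"
  proof
    assume "F constant_on UNIV"
    then obtain k where "F = (\<lambda>_. k)" unfolding constant_on_def by auto
    then have "(F has_field_derivative 0) (at 0)" by simp
    then have "(\<Sum>n. diffs a n * 0 ^ n) = 0"
      using E(2)[of 0] DERIV_unique by blast
    then have "a 1 = 0" unfolding powser_zero by (simp add: diffs_def)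
    then show False using W1 by (simp add: a_def numeral_2_eq_2)
  qed
  moreover have "bounded (F ` S)"
    unfolding bounded_iff
  proof (intro exI ballI)
    fix x assume "x \<in> F ` S"
    then obtain z where z: "z \<in> S" and x: "x = F z" by auto
    \<comment> \<open>With this abscissa \<open>|\<Phi>| >= 2 |z|\<close> on the line, which gives
      the ratio 1/2 in the geometric series below.\<close>
    define \<sigma> where "\<sigma> = 1 + 2 * norm z / c"
    have \<sigma>: "\<sigma> \<ge> 1" "c * \<sigma> \<ge> 2 * norm z" using c by (auto simp: \<sigma>_def field_simps)
    have \<Phi>z: "\<Phi> p - z \<noteq> 0" if "Re p > 0" for p using sep[OF that z] \<delta> by auto
    have \<Phi>d: "\<delta> \<le> norm (\<Phi> (Complex b y) - z)" if "b > 0" for b y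
      by (rule sep) (use z that in auto)
    have cz: "continuous_on {p. 0 < Re p} (\<lambda>p. \<Phi> p - z)" by (intro continuous_intros cont)
    define I where "I = (LINT y|lborel. W (Complex \<sigma> y) / (\<Phi> (Complex \<sigma> y) - z))"
    let ?T = "\<lambda>n y. W (Complex \<sigma> y) / \<Phi> (Complex \<sigma> y) ^ Suc n * z ^ n"
    have int: "integrable lborel (?T n)" for n
    proof (intro integrable_mult_left line_int[where X = "\<lambda>p. \<Phi> p ^ Suc n"])
      show "(c * \<sigma>) ^ Suc n \<le> norm (\<Phi> (Complex \<sigma> y) ^ Suc n)" for y
        by (rule pw) (use \<sigma> in auto)
    qed (use c \<sigma> \<Phi>0 in \<open>auto intro!: continuous_intros cont\<close>)
    have intI: "integrable lborel (\<lambda>y. W (Complex \<sigma> y) / (\<Phi> (Complex \<sigma> y) - z))"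
      by (rule line_int[OF _ \<delta> \<Phi>d cz \<Phi>z]) (use \<sigma> in auto)
    have part: "(\<Sum>n<N. a n * z ^ n) = (LINT y|lborel. (\<Sum>n<N. ?T n y))" for N
    proof -
      have "(LINT y|lborel. (\<Sum>n<N. ?T n y)) = (\<Sum>n<N. (LINT y|lborel. ?T n y))"
        by (intro Bochner_Integration.integral_sum int)
      also have "\<dots> = (\<Sum>n<N. a n * z ^ n)"
      proof (intro sum.cong refl)
        fix n
        show "(LINT y|lborel. ?T n y) = a n * z ^ n"
          using a_eq[of \<sigma> n] \<sigma> by (simp only: integral_mult_left_zero)
      qed
      finally show ?thesis by simp
    qed
    have diff: "norm ((\<Sum>n<N. a n * z ^ n) - I) \<le> K * exp \<sigma> / \<delta> * L * (1/2) ^ N" for N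
    proof -
      have geo: "(\<Sum>n<N. W p / \<Phi> p ^ Suc n * z ^ n) - W p / (\<Phi> p - z) = - (W p / (\<Phi> p - z) * (z / \<Phi> p) ^ N)"
        if p: "Re p > 0" for p
      proof -
        have "(\<Sum>n<N. W p / \<Phi> p ^ Suc n * z ^ n) = W p / \<Phi> p * (\<Sum>n<N. (z / \<Phi> p) ^ n)"
          by (simp add: sum_distrib_left power_divide mult_ac)
        also have "(\<Sum>n<N. (z / \<Phi> p) ^ n) = ((z / \<Phi> p) ^ N - 1) / (z / \<Phi> p - 1)"
          by (rule geometric_sum) (use \<Phi>0[OF p] \<Phi>z[OF p] in \<open>auto simp: divide_eq_1_iff\<close>)
        also have "W p / \<Phi> p * (((z / \<Phi> p) ^ N - 1) / (z / \<Phi> p - 1)) = W p / (\<Phi> p - z) * (1 - (z / \<Phi> p) ^ N)"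
        proof -
          have "z / \<Phi> p - 1 = (z - \<Phi> p) / \<Phi> p" using \<Phi>0[OF p] by (simp add: field_simps)
          moreover have "z - \<Phi> p \<noteq> 0" using \<Phi>z[OF p] by auto
          ultimately show ?thesis using \<Phi>0[OF p] \<Phi>z[OF p]
            by (simp add: divide_simps) (simp add: algebra_simps)
        qed
        finally show ?thesis by (simp add: right_diff_distrib)
      qed
      have "(\<Sum>n<N. a n * z ^ n) - I = (LINT y|lborel. (\<Sum>n<N. ?T n y) - W (Complex \<sigma> y) / (\<Phi> (Complex \<sigma> y) - z))"
        unfolding part I_def by (intro Bochner_Integration.integral_diff[symmetric] Bochner_Integration.integrable_sum int intI)
      also have "norm \<dots> \<le> (LINT y|lborel. K * exp \<sigma> / \<delta> * (1/2) ^ N * (1 / (1 + y\<^sup>2)))"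
      proof (rule Bochner_Integration.integral_norm_bound_integral)
        show "integrable lborel (\<lambda>y. (\<Sum>n<N. ?T n y) - W (Complex \<sigma> y) / (\<Phi> (Complex \<sigma> y) - z))"
          by (intro Bochner_Integration.integrable_diff Bochner_Integration.integrable_sum int intI)
        fix y :: real
        have pos: "\<sigma> > 0" using \<sigma> by simp
        have "2 * norm z \<le> norm (\<Phi> (Complex \<sigma> y))"
          using pw[of \<sigma> "Complex \<sigma> y" 1] pos \<sigma> by simp
        then have "norm (z / \<Phi> (Complex \<sigma> y)) \<le> 1/2"
          using \<Phi>0[of "Complex \<sigma> y"] pos by (simp add: norm_divide divide_simps)
        then have q: "norm ((z / \<Phi> (Complex \<sigma> y)) ^ N) \<le> (1/2) ^ N"
          unfolding norm_power by (intro power_mono) auto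
        have "norm ((\<Sum>n<N. ?T n y) - W (Complex \<sigma> y) / (\<Phi> (Complex \<sigma> y) - z))
            = norm (W (Complex \<sigma> y) / (\<Phi> (Complex \<sigma> y) - z)) * norm ((z / \<Phi> (Complex \<sigma> y)) ^ N)"
          using pos by (subst geo) (simp_all only: norm_mult norm_minus_cancel complex.sel)
        also have "\<dots> \<le> K * exp \<sigma> / \<delta> / (1 + y\<^sup>2) * (1/2) ^ N"
          using div_bd[of "Complex \<sigma> y" \<sigma> \<delta> "\<Phi> (Complex \<sigma> y) - z"] \<Phi>d pos \<delta> K
          by (intro mult_mono q) auto
        finally show "norm ((\<Sum>n<N. ?T n y) - W (Complex \<sigma> y) / (\<Phi> (Complex \<sigma> y) - z))
            \<le> K * exp \<sigma> / \<delta> * (1/2) ^ N * (1 / (1 + y\<^sup>2))" by (simp add: mult_ac)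
      qed (intro integrable_mult_right integrable_inverse_one_plus_square)
      also have "\<dots> = K * exp \<sigma> / \<delta> * L * (1/2) ^ N"
        unfolding L_def integral_mult_right_zero by simp
      finally show ?thesis .
    qed
    have "(\<lambda>N. (\<Sum>n<N. a n * z ^ n) - I) \<longlonglongrightarrow> 0"
    proof (rule Lim_null_comparison)
      show "\<forall>\<^sub>F N in sequentially. norm ((\<Sum>n<N. a n * z ^ n) - I) \<le> K * exp \<sigma> / \<delta> * L * (1/2) ^ N"
        using diff by (intro always_eventually allI)
      show "(\<lambda>N. K * exp \<sigma> / \<delta> * L * (1/2) ^ N) \<longlonglongrightarrow> 0"
        by (intro tendsto_mult_right_zero LIMSEQ_realpow_zero) auto
    qed
    then have "(\<lambda>N. \<Sum>n<N. a n * z ^ n) \<longlonglongrightarrow> I" by (rule LIM_zero_cancel)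
    then have "F z = I"
      using summable_LIMSEQ[OF E(1)[of z]] LIMSEQ_unique unfolding F_def by blast
    \<comment> \<open>Back on the line through 1 the bound involves only \<open>K\<close>,
      \<open>\<delta>\<close> and \<open>L\<close>, and no longer \<open>z\<close>.\<close>
    also have "I = (LINT y|lborel. W (Complex 1 y) / (\<Phi> (Complex 1 y) - z))"
      unfolding I_def
    proof (rule shift)
      show "\<delta> \<le> norm (\<Phi> p - z)" if "Re p \<in> closed_segment \<sigma> 1" for p
        using that \<sigma> z by (intro sep) (auto simp: closed_segment_eq_real_ivl split: if_splits)
    qed (use \<sigma> \<delta> \<Phi>z in \<open>auto intro!: holomorphic_intros hol\<close>)
    finally show "norm x \<le> K * exp 1 / \<delta> * L"
      unfolding x using line_bd[OF _ \<delta> \<Phi>d cz \<Phi>z, of 1] by simp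
  qed
  moreover have "\<forall>z. norm (F z) \<le> (K * exp 1 / c * L + 1) * exp (exp 1 / c * norm z)"
    unfolding F_def by (intro allI E(3))
  ultimately show ?thesis
    by (intro exI[of _ F] exI[of _ "K * exp 1 / c * L + 1"] exI[of _ "exp 1 / c"] conjI K' B)
qed

section \<open>Kernels of the strip\<close>

text \<open>Differentiation under the integral sign. Cauchy's inequality on discs of radius
  \<open>r/2\<close> turns the integrable majorant of \<open>F\<close> into one of the derivative,
  and hence of the difference quotients, so that dominated convergence applies along
  sequences.\<close>

lemma holomorphic_on_lebesgue_integral:
  fixes F :: "complex \<Rightarrow> real \<Rightarrow> complex"
  assumes U: "open U" and hol: "\<And>t. (\<lambda>z. F z t) holomorphic_on U"
    and meas: "\<And>z. z \<in> U \<Longrightarrow> F z \<in> borel_measurable lborel"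
    and dom: "\<And>z. z \<in> U \<Longrightarrow> \<exists>r>0. \<exists>g. ball z r \<subseteq> U \<and> integrable lborel g \<and> (\<forall>w\<in>ball z r. \<forall>t. norm (F w t) \<le> g t)"
  shows "(\<lambda>z. LINT t|lborel. F z t) holomorphic_on U"
proof -
  have "\<exists>D. ((\<lambda>z. LINT t|lborel. F z t) has_field_derivative D) (at z)" if z: "z \<in> U" for z
  proof -
    obtain r g where r: "r > 0" "ball z r \<subseteq> U" and g: "integrable lborel g"
      and bd: "\<And>w t. w \<in> ball z r \<Longrightarrow> norm (F w t) \<le> g t"
      using dom[OF z] by blast
    have int: "integrable lborel (F w)" if "w \<in> ball z r" for w
      by (rule Bochner_Integration.integrable_bound[OF g])
         (use meas bd that r in \<open>auto intro!: AE_I2 order_trans[OF bd]\<close>)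
    define d where "d = (\<lambda>t. deriv (\<lambda>z. F z t) z)"
    have D: "((\<lambda>z. F z t) has_field_derivative deriv (\<lambda>z. F z t) w) (at w)" if "w \<in> ball z r" for w t
      by (rule holomorphic_derivI[OF hol U]) (use r that in auto)
    have d_bd: "norm (deriv (\<lambda>z. F z t) w) \<le> g t / (r/2)" if w: "w \<in> ball z (r/4)" for w t
    proof -
      have sub: "cball w (r/2) \<subseteq> ball z r"
      proof
        fix x assume "x \<in> cball w (r/2)"
        then have "dist z x \<le> dist z w + r/2"
          using dist_triangle[of z x w] by (simp add: dist_commute)
        then show "x \<in> ball z r" using w r by simp
      qed
      have "norm ((deriv ^^ 1) (\<lambda>z. F z t) w) \<le> fact 1 * g t / (r/2) ^ 1"
      proof (rule Cauchy_inequality)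
        show "(\<lambda>z. F z t) holomorphic_on ball w (r/2)"
          using sub r by (intro holomorphic_on_subset[OF hol]) (use ball_subset_cball in blast)
        show "continuous_on (cball w (r/2)) (\<lambda>z. F z t)"
          by (rule holomorphic_on_imp_continuous_on, rule holomorphic_on_subset[OF hol]) (use sub r in blast)
        show "norm (F x t) \<le> g t" if "norm (w - x) = r/2" for x
          by (rule bd) (use sub that in \<open>auto simp: dist_norm\<close>)
      qed (use r in auto)
      then show ?thesis by simp
    qed
    have "((\<lambda>w. ((LINT t|lborel. F w t) - (LINT t|lborel. F z t)) / (w - z)) \<longlongrightarrow> (LINT t|lborel. d t)) (at z)"
      unfolding tendsto_at_iff_sequentially
    proof (intro allI impI)
      fix X :: "nat \<Rightarrow> complex" assume X: "\<forall>i. X i \<in> UNIV - {z}" and Xz: "X \<longlonglongrightarrow> z"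
      have "\<forall>\<^sub>F n in sequentially. X n \<in> ball z (r/4)"
        using Xz r by (intro topological_tendstoD) auto
      then obtain N where N: "\<And>n. n \<ge> N \<Longrightarrow> X n \<in> ball z (r/4)"
        unfolding eventually_sequentially by blast
      define Y where "Y = (\<lambda>n. X (n + N))"
      have Y: "Y n \<in> ball z (r/4)" "Y n \<in> ball z r" "Y n \<noteq> z" for n
        using N[of "n + N"] X r by (auto simp: Y_def)
      have Yz: "Y \<longlonglongrightarrow> z" unfolding Y_def by (rule LIMSEQ_ignore_initial_segment[OF Xz])
      have zr: "z \<in> ball z r" using r by simp
      have lim: "(\<lambda>n. (F (Y n) t - F z t) / (Y n - z)) \<longlonglongrightarrow> d t" for t
      proof -
        have "((\<lambda>w. (F w t - F z t) / (w - z)) \<longlongrightarrow> d t) (at z)"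
          using D[OF zr, of t] unfolding d_def has_field_derivative_iff by simp
        then show ?thesis
          using Y(3) Yz unfolding tendsto_at_iff_sequentially by (auto simp: o_def)
      qed
      have "(\<lambda>n. LINT t|lborel. (F (Y n) t - F z t) / (Y n - z)) \<longlonglongrightarrow> (LINT t|lborel. d t)"
      proof (rule integral_dominated_convergence)
        show qm: "(\<lambda>t. (F (Y n) t - F z t) / (Y n - z)) \<in> borel_measurable lborel" for n
          by (intro borel_measurable_divide borel_measurable_diff borel_measurable_const meas z subsetD[OF r(2) Y(2)])
        \<comment> \<open>The derivative inherits measurability in \<open>t\<close> as a pointwise
          limit of difference quotients.\<close>
        show "d \<in> borel_measurable lborel"
          using qm lim by (rule borel_measurable_LIMSEQ_metric)
        show "integrable lborel (\<lambda>t. g t / (r/2))" by (intro integrable_divide g)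
        show "AE t in lborel. (\<lambda>n. (F (Y n) t - F z t) / (Y n - z)) \<longlonglongrightarrow> d t"
          using lim by (intro AE_I2)
        show "AE t in lborel. norm ((F (Y n) t - F z t) / (Y n - z)) \<le> g t / (r/2)" for n
        proof (rule AE_I2)
          fix t
          have "norm (F (Y n) t - F z t) \<le> g t / (r/2) * norm (Y n - z)"
          proof (rule field_differentiable_bound[where S = "ball z (r/4)" and f' = "deriv (\<lambda>z. F z t)"])
            show "((\<lambda>z. F z t) has_field_derivative deriv (\<lambda>z. F z t) w) (at w within ball z (r/4))"
              if "w \<in> ball z (r/4)" for w
              by (rule has_field_derivative_at_within[OF D]) (use that r in auto)
          qed (use d_bd Y r in auto)
          then show "norm ((F (Y n) t - F z t) / (Y n - z)) \<le> g t / (r/2)"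
            using Y(3)[of n] by (simp add: norm_divide divide_le_eq)
        qed
      qed
      also have "(\<lambda>n. LINT t|lborel. (F (Y n) t - F z t) / (Y n - z))
          = (\<lambda>n. ((LINT t|lborel. F (Y n) t) - (LINT t|lborel. F z t)) / (Y n - z))"
        using int[OF Y(2)] int[OF zr] by simp
      finally have "(\<lambda>n. ((LINT t|lborel. F (X (n + N)) t) - (LINT t|lborel. F z t)) / (X (n + N) - z)) \<longlonglongrightarrow> (LINT t|lborel. d t)"
        unfolding Y_def .
      then have "(\<lambda>n. ((LINT t|lborel. F (X n) t) - (LINT t|lborel. F z t)) / (X n - z)) \<longlonglongrightarrow> (LINT t|lborel. d t)"
        by (rule LIMSEQ_offset)
      then show "((\<lambda>w. ((LINT t|lborel. F w t) - (LINT t|lborel. F z t)) / (w - z)) \<circ> X) \<longlonglongrightarrow> (LINT t|lborel. d t)"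
        by (simp add: o_def)
    qed
    then show ?thesis unfolding has_field_derivative_iff by auto
  qed
  then show ?thesis using U by (auto simp: holomorphic_on_open)
qed

text \<open>The exponent is \<open>3/4 = 1/2 + 1/4\<close>: one half for the growth of the modulus
  and one quarter for \<open>(1 + sqrt u)^2 <= 8 exp (u / 4)\<close>. Its square, with exponent
  \<open>3/2\<close>, serves for the Poisson kernel.\<close>

lemma exp_le_sinh:
  fixes u :: real
  assumes "u \<ge> 0"
  shows "u * exp (3 * u / 4) \<le> 8 * sinh u"
proof -
  have a: "1 + 2 * u \<le> 8 * exp (u / 4)"
    using exp_ge_add_one_self[of "u / 4"] assms by linarith
  have "u * 2 \<le> (1 + 2 * u) * (1 - exp (- (2 * u)))"
  proof -
    have "(1 + 2 * u) * exp (- (2 * u)) \<le> exp (2 * u) * exp (- (2 * u))"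
      using exp_ge_add_one_self[of "2 * u"] by (intro mult_right_mono) auto
    also have "\<dots> = 1" by (simp flip: exp_add)
    finally show ?thesis by (simp add: algebra_simps)
  qed
  also have "\<dots> \<le> (8 * exp (u / 4)) * (1 - exp (- (2 * u)))"
    using a assms by (intro mult_right_mono) auto
  finally have "u * 2 * exp (3 * u / 4) \<le> (8 * exp (u / 4)) * (1 - exp (- (2 * u))) * exp (3 * u / 4)"
    by (intro mult_right_mono) auto
  also have "\<dots> = 8 * (exp (u / 4 + 3 * u / 4) - exp (u / 4 + 3 * u / 4 + - (2 * u)))"
    by (simp only: exp_add) (simp add: algebra_simps)
  also have "\<dots> = 16 * sinh u"
    by (simp add: sinh_field_def)
  finally show ?thesis by simp
qed

text \<open>Up to a constant, this function bounds both the Poisson kernel and the conjugate kernels of the strip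
  multiplied by the modulus \<open>sqrt \<bar>u\<bar> * exp (\<bar>u\<bar> / 2)\<close>; the parameter \<open>c\<close> is the cosine of the height.\<close>

definition holder_kernel :: "real \<Rightarrow> real \<Rightarrow> real" where
  "holder_kernel c u = 1 / (sqrt \<bar>u\<bar> * (sqrt c + sqrt \<bar>u\<bar>)\<^sup>2)"

lemma holder_kernel_nonneg: "holder_kernel c u \<ge> 0"
  by (simp add: holder_kernel_def)

text \<open>The value \<open>4 / sqrt c\<close> is the source of the gain near the edge: the Poisson
  kernel brings a factor \<open>c\<close>, and \<open>c / sqrt c = sqrt c\<close>.\<close>

lemma has_bochner_integral_holder_kernel:
  assumes c: "c > 0"
  shows "has_bochner_integral lborel (holder_kernel c) (4 / sqrt c)"
proof -
  let ?F = "\<lambda>u. - 2 / (sqrt c + sqrt u)"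
  have nz: "sqrt c + sqrt x \<noteq> 0" if "x \<ge> 0" for x
    using real_sqrt_gt_zero[OF c] real_sqrt_ge_zero[OF that] by linarith
  have deriv: "DERIV ?F x :> holder_kernel c x" and cont: "isCont (holder_kernel c) x"
    if "0 < ereal x" "ereal x < \<infinity>" for x
  proof -
    have x: "x > 0" using that by (simp add: zero_ereal_def)
    show "DERIV ?F x :> holder_kernel c x"
      using x nz[of x] by (auto intro!: derivative_eq_intros simp: holder_kernel_def field_simps power2_eq_square)
    show "isCont (holder_kernel c) x"
      unfolding holder_kernel_def[abs_def] using x nz[of x] by (intro continuous_intros) auto
  qed
  have nn: "AE x in lborel. 0 < ereal x \<longrightarrow> ereal x < \<infinity> \<longrightarrow> 0 \<le> holder_kernel c x"
    by (simp add: holder_kernel_nonneg)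
  have lim0: "((?F \<circ> real_of_ereal) \<longlongrightarrow> - 2 / sqrt c) (at_right 0)"
  proof -
    have "isCont ?F 0" using c by (intro continuous_intros) auto
    then have "(?F \<longlongrightarrow> ?F 0) (at_right 0)"
      by (metis continuous_at_imp_continuous_at_within continuous_within)
    then show ?thesis by (simp add: zero_ereal_def ereal_tendsto_simps1)
  qed
  have lim1: "((?F \<circ> real_of_ereal) \<longlongrightarrow> 0) (at_left \<infinity>)"
  proof -
    have "(?F \<longlongrightarrow> 0) at_top"
      by (intro tendsto_divide_0[OF tendsto_const] filterlim_at_top_imp_at_infinity
          filterlim_tendsto_add_at_top[OF tendsto_const] sqrt_at_top)
    then show ?thesis by (simp add: ereal_tendsto_simps1)
  qed
  have z: "(0::ereal) < \<infinity>" by simp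
  note interval_integral_FTC_nonneg[OF z deriv cont nn lim0 lim1]
  moreover have "(LBINT u=0..\<infinity>. holder_kernel c u) = (LINT u|lborel. indicator {0<..} u * holder_kernel c u)"
    by (simp add: interval_lebesgue_integral_def set_lebesgue_integral_def einterval_def greaterThan_def zero_ereal_def)
  ultimately have h: "has_bochner_integral lborel (\<lambda>u. indicator {0<..} u * holder_kernel c u) (2 / sqrt c)"
    by (simp add: has_bochner_integral_iff set_integrable_def einterval_def zero_ereal_def greaterThan_def)
  then have "has_bochner_integral lborel (\<lambda>u. indicator {0<..} (0 + (-1) * u) * holder_kernel c (0 + (-1) * u)) ((2 / sqrt c) /\<^sub>R \<bar>-1\<bar>)"
    by (subst lborel_has_bochner_integral_real_affine_iff[symmetric]) auto
  then have "has_bochner_integral lborel (\<lambda>u. indicator {0<..} (- u) * holder_kernel c u) (2 / sqrt c)"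
    by (simp add: holder_kernel_def)
  from has_bochner_integral_add[OF h this]
  have "has_bochner_integral lborel (\<lambda>u. indicator {0<..} u * holder_kernel c u + indicator {0<..} (- u) * holder_kernel c u) (4 / sqrt c)"
    by simp
  moreover have "(\<lambda>u. indicator {0<..} u * holder_kernel c u + indicator {0<..} (- u) * holder_kernel c u) = holder_kernel c"
    by (auto simp: fun_eq_iff indicator_def holder_kernel_def)
  ultimately show ?thesis by (simp only:)
qed

lemma sqrt_sum_square_le:
  assumes "a \<ge> 0" "b \<ge> 0"
  shows "(sqrt a + sqrt b)\<^sup>2 \<le> 2 * (a + b)"
proof -
  have "0 \<le> (sqrt a - sqrt b)\<^sup>2" by simp
  then show ?thesis using assms by (simp add: power2_sum power2_diff)
qed

lemma conjugate_majorant: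
  "sqrt \<bar>u\<bar> * exp (\<bar>u\<bar> / 2) / \<bar>sinh u\<bar> \<le> 64 * holder_kernel 1 u"
proof (cases "u = 0")
  case False
  define v where "v = \<bar>u\<bar>"
  have v: "v > 0" using False by (simp add: v_def)
  have s: "\<bar>sinh u\<bar> = sinh v" by (simp add: v_def abs_if)
  have "(1 + sqrt v)\<^sup>2 \<le> 8 * exp (v / 4)"
  proof -
    have "(1 + sqrt v)\<^sup>2 \<le> 2 + 2 * v"
      using sqrt_sum_square_le[of 1 v] v by simp
    also have "\<dots> \<le> 8 * exp (v / 4)" using exp_ge_add_one_self[of "v / 4"] v by linarith
    finally show ?thesis .
  qed
  then have "(v * exp (v / 2)) * (1 + sqrt v)\<^sup>2 \<le> (v * exp (v / 2)) * (8 * exp (v / 4))"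
    using v by (intro mult_left_mono) auto
  also have "\<dots> = 8 * (v * exp (v / 2 + v / 4))" by (simp only: exp_add)
  also have "\<dots> \<le> 64 * sinh v" using exp_le_sinh[of v] v by simp
  finally have "(sqrt v * sqrt v) * exp (v / 2) * (1 + sqrt v)\<^sup>2 \<le> 64 * sinh v"
    using v by simp
  then have *: "sqrt v * exp (v / 2) * (sqrt v * (1 + sqrt v)\<^sup>2) \<le> 64 * sinh v"
    by (simp only: mult_ac)
  have "sqrt v * exp (v / 2) / sinh v \<le> 64 / (sqrt v * (1 + sqrt v)\<^sup>2)"
  proof -
    have "sqrt v * (1 + sqrt v)\<^sup>2 > 0" using v by (intro mult_pos_pos zero_less_power add_pos_pos) auto
    then show ?thesis using * v by (simp add: divide_le_eq le_divide_eq mult_ac)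
  qed
  then show ?thesis by (simp add: s holder_kernel_def v_def[symmetric])
qed (simp add: holder_kernel_def)

text \<open>With \<open>c\<close> the cosine of the height this is the real part of sech. Divided by
  \<open>pi\<close>, it is the Poisson kernel of the strip \<open>|Im z| < pi / 2\<close> for the
  same data on both edges.\<close>

definition strip_poisson :: "real \<Rightarrow> real \<Rightarrow> real" where
  "strip_poisson c u = c * cosh u / ((sinh u)\<^sup>2 + c\<^sup>2)"

text \<open>After clearing denominators, two products remain. The one with \<open>v^2\<close> is at
  most \<open>64 sinh^2 v\<close>. The one with \<open>v c\<close> is compared with it if
  \<open>v >= 1 >= c\<close>, and with \<open>v^2 + c^2\<close> if \<open>v < 1\<close>. The
  constants add up to \<open>2 (64 + 64 + 3) = 262\<close>.\<close>

lemma poisson_majorant: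
  assumes c: "0 < c" "c \<le> 1"
  shows "sqrt \<bar>u\<bar> * exp (\<bar>u\<bar> / 2) * strip_poisson c u \<le> 262 * c * holder_kernel c u"
proof (cases "u = 0")
  case False
  define v where "v = \<bar>u\<bar>"
  have v: "v > 0" using False by (simp add: v_def)
  have s: "(sinh u)\<^sup>2 = (sinh v)\<^sup>2" "cosh u = cosh v" by (simp_all add: v_def abs_if)
  define S where "S = (sinh v)\<^sup>2"
  have e: "exp (v / 2) * cosh v \<le> exp (3 * v / 2)"
  proof -
    have "cosh v \<le> exp v" using v by (simp add: cosh_field_def)
    then have "exp (v / 2) * cosh v \<le> exp (v / 2) * exp v" by (intro mult_left_mono) auto
    also have "\<dots> = exp (3 * v / 2)" by (simp flip: exp_add)
    finally show ?thesis .
  qed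
  have "(v * exp (3 * v / 4))\<^sup>2 \<le> (8 * sinh v)\<^sup>2"
    using v by (intro power_mono exp_le_sinh) auto
  then have A: "v\<^sup>2 * exp (3 * v / 2) \<le> 64 * S"
    by (simp add: power_mult_distrib S_def flip: exp_double)
  have B: "v * c * exp (3 * v / 2) \<le> 64 * S + 3 * (S + c\<^sup>2)"
  proof (cases "v \<ge> 1")
    case True
    have "c \<le> v" using True c by simp
    then have "v * c * exp (3 * v / 2) \<le> v * v * exp (3 * v / 2)"
      using v c by (intro mult_right_mono mult_left_mono) auto
    also have "\<dots> \<le> 64 * S" using A by (simp add: power2_eq_square)
    also have "\<dots> \<le> 64 * S + 3 * (S + c\<^sup>2)" by (simp add: S_def)
    finally show ?thesis .
  next
    case False
    have "exp (3 * v / 2) \<le> exp (3 / 2)" using False by simp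
    also have "\<dots> \<le> (6::real)"
    proof (rule power2_le_imp_le)
      have "(exp (3/2) :: real)\<^sup>2 = exp 1 ^ 3" by (simp flip: exp_of_nat_mult exp_double)
      also have "\<dots> \<le> 3 ^ 3" by (intro power_mono exp_le) auto
      finally show "(exp (3/2) :: real)\<^sup>2 \<le> 6\<^sup>2" by simp
    qed simp
    finally have "v * c * exp (3 * v / 2) \<le> v * c * 6"
      using v c by (intro mult_left_mono) auto
    also have "\<dots> \<le> 3 * (v\<^sup>2 + c\<^sup>2)"
      using zero_le_power2[of "v - c"] by (simp add: power2_diff)
    also have "\<dots> \<le> 3 * (S + c\<^sup>2)"
      unfolding S_def using v real_le_x_sinh[of v]
      by (intro mult_left_mono add_right_mono power_mono) (simp_all add: sinh_field_def exp_minus)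
    also have "\<dots> \<le> 64 * S + 3 * (S + c\<^sup>2)" by (simp add: S_def)
    finally show ?thesis .
  qed
  have "(v * (exp (v / 2) * cosh v)) * (sqrt c + sqrt v)\<^sup>2 \<le> (v * exp (3 * v / 2)) * (2 * (c + v))"
    using v c e sqrt_sum_square_le[of c v] by (intro mult_mono) auto
  also have "\<dots> = 2 * (v\<^sup>2 * exp (3 * v / 2)) + 2 * (v * c * exp (3 * v / 2))"
    by (simp add: algebra_simps power2_eq_square)
  also have "\<dots> \<le> 262 * (S + c\<^sup>2)" using A B zero_le_power2[of c] unfolding distrib_left by linarith
  finally have "c * ((sqrt v * sqrt v) * (exp (v / 2) * cosh v) * (sqrt c + sqrt v)\<^sup>2) \<le> c * (262 * (S + c\<^sup>2))"
    using v c by (intro mult_left_mono) auto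
  then have *: "sqrt v * exp (v / 2) * (c * cosh v) * (sqrt v * (sqrt c + sqrt v)\<^sup>2) \<le> 262 * c * (S + c\<^sup>2)"
    by (simp only: mult_ac)
  have "sqrt v * exp (v / 2) * (c * cosh v) / (S + c\<^sup>2) \<le> 262 * c / (sqrt v * (sqrt c + sqrt v)\<^sup>2)"
  proof -
    have "S + c\<^sup>2 > 0" using c by (simp add: S_def add_nonneg_pos)
    moreover have "sqrt v * (sqrt c + sqrt v)\<^sup>2 > 0" using v c by (intro mult_pos_pos zero_less_power add_pos_pos) auto
    ultimately show ?thesis using * by (simp add: divide_le_eq le_divide_eq mult_ac)
  qed
  then show ?thesis by (simp add: strip_poisson_def s holder_kernel_def v_def[symmetric] S_def)
qed (simp add: holder_kernel_def)

lemma strip_poisson_nonneg: "c \<ge> 0 \<Longrightarrow> strip_poisson c u \<ge> 0"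
  by (simp add: strip_poisson_def)

lemma kernel_denominator_pos:
  fixes c u :: real
  assumes "c > 0"
  shows "(sinh u)\<^sup>2 + c\<^sup>2 > 0"
  using assms by (simp add: add_nonneg_pos)

lemma has_bochner_integral_strip_poisson:
  assumes c: "c > 0"
  shows "has_bochner_integral lborel (strip_poisson c) pi"
proof -
  let ?F = "\<lambda>u. arctan (sinh u / c)"
  have nz: "(sinh x)\<^sup>2 + c\<^sup>2 \<noteq> 0" for x :: real
    by (rule less_imp_neq[OF kernel_denominator_pos[OF c], symmetric])
  have deriv: "DERIV ?F x :> strip_poisson c x" for x
  proof -
    have "DERIV ?F x :> inverse (1 + (sinh x / c)\<^sup>2) * (cosh x / c)"
      using c by (auto intro!: derivative_eq_intros)
    also have "inverse (1 + (sinh x / c)\<^sup>2) * (cosh x / c) = strip_poisson c x"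
    proof -
      have "1 + (sinh x / c)\<^sup>2 = ((sinh x)\<^sup>2 + c\<^sup>2) / c\<^sup>2"
        using c by (simp add: field_simps)
      then show ?thesis using c by (simp add: strip_poisson_def power2_eq_square)
    qed
    finally show ?thesis .
  qed
  have cont: "isCont (strip_poisson c) x" for x
    unfolding strip_poisson_def[abs_def] using nz by (intro continuous_intros) auto
  have nn: "AE x in lborel. - \<infinity> < ereal x \<longrightarrow> ereal x < \<infinity> \<longrightarrow> 0 \<le> strip_poisson c x"
    using c by (simp add: strip_poisson_nonneg)
  have "filterlim (\<lambda>u. sinh u / c) at_top at_top"
    using filterlim_tendsto_pos_mult_at_top[OF tendsto_const[of "1/c"] _ sinh_real_at_top] c by simp
  then have l1: "((?F \<circ> real_of_ereal) \<longlongrightarrow> pi / 2) (at_left \<infinity>)"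
    unfolding ereal_tendsto_simps1 by (rule filterlim_compose[OF tendsto_arctan_at_top])
  have "filterlim (\<lambda>u. sinh u / c) at_bot at_bot"
    using filterlim_tendsto_pos_mult_at_bot[OF tendsto_const[of "1/c"] _ sinh_real_at_bot] c by simp
  then have l0: "((?F \<circ> real_of_ereal) \<longlongrightarrow> - (pi / 2)) (at_right (-\<infinity>))"
    unfolding ereal_tendsto_simps1 by (rule filterlim_compose[OF tendsto_arctan_at_bot])
  have z: "(-\<infinity>::ereal) < \<infinity>" by simp
  note interval_integral_FTC_nonneg[OF z deriv cont nn l0 l1]
  moreover have "(LBINT u=-\<infinity>..\<infinity>. strip_poisson c u) = (LINT u|lborel. strip_poisson c u)"
    by (simp add: interval_lebesgue_integral_def set_lebesgue_integral_def einterval_def)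
  ultimately show ?thesis
    by (simp add: has_bochner_integral_iff set_integrable_def einterval_def)
qed

lemma integral_odd_eq_0:
  fixes f :: "real \<Rightarrow> real"
  assumes "\<And>u. f (- u) = - f u"
  shows "(LINT u|lborel. f u) = 0"
proof -
  have "(LINT u|lborel. f u) = (LINT u|lborel. f (- u))"
    using lborel_integral_real_affine[of "-1" f 0] by simp
  also have "\<dots> = - (LINT u|lborel. f u)" by (simp add: assms)
  finally show ?thesis by simp
qed

lemma holder_modulus_const_nonneg:
  assumes "\<And>u. \<bar>k (x - u) - k x\<bar> \<le> M * (sqrt \<bar>u\<bar> * exp (\<bar>u\<bar> / 2))"
  shows "(M::real) \<ge> 0"
proof -
  have "0 \<le> M * exp (1/2)" using assms[of 1] by simp
  then show ?thesis by (simp add: zero_le_mult_iff)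
qed

text \<open>An odd kernel has integral 0, so \<open>k x\<close> may be subtracted from
  \<open>k (x - u)\<close>; the modulus then tames the singularity that the bound
  \<open>1 / |sinh u|\<close> leaves at 0. The constant \<open>256 = 64 * 4\<close> comes from
  \<open>holder_kernel 1\<close> alone and is therefore uniform up to the edges of the
  strip.\<close>

lemma conjugate_kernel_bound:
  fixes k \<kappa> :: "real \<Rightarrow> real"
  assumes k: "k \<in> borel_measurable borel"
    and mod: "\<And>u. \<bar>k (x - u) - k x\<bar> \<le> M * (sqrt \<bar>u\<bar> * exp (\<bar>u\<bar> / 2))"
    and int: "integrable lborel \<kappa>" and odd: "\<And>u. \<kappa> (- u) = - \<kappa> u"
    and le: "\<And>u. \<bar>\<kappa> u\<bar> * \<bar>sinh u\<bar> \<le> 1"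
  shows "integrable lborel (\<lambda>u. k (x - u) * \<kappa> u)"
    and "\<bar>LINT u|lborel. k (x - u) * \<kappa> u\<bar> \<le> 256 * M"
proof -
  note M = holder_modulus_const_nonneg[OF mod]
  note hk = has_bochner_integral_holder_kernel[of 1, simplified, unfolded has_bochner_integral_iff]
  let ?D = "\<lambda>u. (k (x - u) - k x) * \<kappa> u"
  have bd: "\<bar>?D u\<bar> \<le> M * (64 * holder_kernel 1 u)" for u
  proof (cases "u = 0")
    case False
    then have "\<bar>\<kappa> u\<bar> \<le> 1 / \<bar>sinh u\<bar>" using le[of u] by (simp add: field_simps)
    then have "\<bar>?D u\<bar> \<le> M * (sqrt \<bar>u\<bar> * exp (\<bar>u\<bar> / 2)) * (1 / \<bar>sinh u\<bar>)"
      unfolding abs_mult using M by (intro mult_mono mod) auto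
    also have "\<dots> = M * (sqrt \<bar>u\<bar> * exp (\<bar>u\<bar> / 2) / \<bar>sinh u\<bar>)" by simp
    also have "\<dots> \<le> M * (64 * holder_kernel 1 u)"
      by (intro mult_left_mono conjugate_majorant M)
    finally show ?thesis .
  qed (use M in \<open>simp add: holder_kernel_nonneg\<close>)
  have maj: "integrable lborel (\<lambda>u. M * (64 * holder_kernel 1 u))"
    using hk by (intro integrable_mult_right) simp
  have D: "integrable lborel ?D"
  proof (rule Bochner_Integration.integrable_bound[OF maj])
    show "?D \<in> borel_measurable lborel"
      using borel_measurable_integrable[OF int]
      by (intro borel_measurable_times borel_measurable_diff borel_measurable_const measurable_compose[OF _ k]) auto
    show "AE u in lborel. norm (?D u) \<le> norm (M * (64 * holder_kernel 1 u))"
      using order_trans[OF bd abs_ge_self] by (intro AE_I2) simp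
  qed
  have eq: "(\<lambda>u. k (x - u) * \<kappa> u) = (\<lambda>u. ?D u + k x * \<kappa> u)"
    by (simp add: algebra_simps)
  show "integrable lborel (\<lambda>u. k (x - u) * \<kappa> u)"
    unfolding eq by (intro Bochner_Integration.integrable_add D integrable_mult_right int)
  have "(LINT u|lborel. k (x - u) * \<kappa> u) = (LINT u|lborel. ?D u) + k x * (LINT u|lborel. \<kappa> u)"
    unfolding eq by (subst Bochner_Integration.integral_add) (auto intro: D int)
  also have "(LINT u|lborel. \<kappa> u) = 0" by (rule integral_odd_eq_0) (rule odd)
  finally have "\<bar>LINT u|lborel. k (x - u) * \<kappa> u\<bar> = norm (LINT u|lborel. ?D u)" by simp
  also have "\<dots> \<le> (LINT u|lborel. M * (64 * holder_kernel 1 u))"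
    by (rule Bochner_Integration.integral_norm_bound_integral[OF D maj]) (use bd in simp)
  also have "\<dots> = 256 * M" using hk by simp
  finally show "\<bar>LINT u|lborel. k (x - u) * \<kappa> u\<bar> \<le> 256 * M" .
qed

text \<open>The total mass \<open>pi\<close> allows the subtraction of \<open>k x\<close>. The
  constant is \<open>262 * 4 / pi\<close>, estimated with \<open>pi > 3\<close>.\<close>

lemma poisson_kernel_bound:
  fixes k :: "real \<Rightarrow> real"
  assumes k: "k \<in> borel_measurable borel"
    and mod: "\<And>u. \<bar>k (x - u) - k x\<bar> \<le> M * (sqrt \<bar>u\<bar> * exp (\<bar>u\<bar> / 2))"
    and c: "0 < c" "c \<le> 1"
  shows "integrable lborel (\<lambda>u. k (x - u) * strip_poisson c u)"
    and "\<bar>(LINT u|lborel. k (x - u) * strip_poisson c u) / pi - k x\<bar> \<le> 350 * M * sqrt c"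
proof -
  note M = holder_modulus_const_nonneg[OF mod]
  note hk = has_bochner_integral_holder_kernel[OF c(1), unfolded has_bochner_integral_iff]
  note pk = has_bochner_integral_strip_poisson[OF c(1), unfolded has_bochner_integral_iff]
  let ?D = "\<lambda>u. (k (x - u) - k x) * strip_poisson c u"
  have bd: "\<bar>?D u\<bar> \<le> M * (262 * c * holder_kernel c u)" for u
  proof -
    have "\<bar>?D u\<bar> \<le> M * (sqrt \<bar>u\<bar> * exp (\<bar>u\<bar> / 2)) * strip_poisson c u"
      unfolding abs_mult using M c by (intro mult_mono mod) (auto simp: strip_poisson_nonneg)
    also have "\<dots> = M * (sqrt \<bar>u\<bar> * exp (\<bar>u\<bar> / 2) * strip_poisson c u)" by simp
    also have "\<dots> \<le> M * (262 * c * holder_kernel c u)"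
      by (intro mult_left_mono poisson_majorant M c)
    finally show ?thesis .
  qed
  have maj: "integrable lborel (\<lambda>u. M * (262 * c * holder_kernel c u))"
    using hk by (intro integrable_mult_right) simp
  have D: "integrable lborel ?D"
  proof (rule Bochner_Integration.integrable_bound[OF maj])
    show "?D \<in> borel_measurable lborel"
      using borel_measurable_integrable[OF conjunct1[OF pk]]
      by (intro borel_measurable_times borel_measurable_diff borel_measurable_const measurable_compose[OF _ k]) auto
    show "AE u in lborel. norm (?D u) \<le> norm (M * (262 * c * holder_kernel c u))"
      using order_trans[OF bd abs_ge_self] by (intro AE_I2) simp
  qed
  have eq: "(\<lambda>u. k (x - u) * strip_poisson c u) = (\<lambda>u. ?D u + k x * strip_poisson c u)"
    by (simp add: algebra_simps)
  show "integrable lborel (\<lambda>u. k (x - u) * strip_poisson c u)"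
    unfolding eq using pk by (intro Bochner_Integration.integrable_add D integrable_mult_right) auto
  have "(LINT u|lborel. k (x - u) * strip_poisson c u) = (LINT u|lborel. ?D u) + k x * (LINT u|lborel. strip_poisson c u)"
    unfolding eq using pk by (subst Bochner_Integration.integral_add) (auto intro: D)
  then have "\<bar>(LINT u|lborel. k (x - u) * strip_poisson c u) / pi - k x\<bar> = norm (LINT u|lborel. ?D u) / pi"
    using pk by (simp add: add_divide_distrib)
  also have "\<dots> \<le> (LINT u|lborel. M * (262 * c * holder_kernel c u)) / pi"
    by (intro divide_right_mono Bochner_Integration.integral_norm_bound_integral[OF D maj]) (use bd in simp_all)
  also have "\<dots> = M * (262 * c) * (4 / sqrt c) / pi" using hk by (simp add: mult_ac)
  also have "\<dots> = 1048 / pi * (M * sqrt c)"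
  proof -
    have q: "c / sqrt c = sqrt c" using c by (simp add: real_div_sqrt)
    have "M * (262 * c) * (4 / sqrt c) / pi = M * 1048 * (c / sqrt c) / pi" by simp
    then show ?thesis unfolding q by simp
  qed
  also have "\<dots> \<le> 350 * (M * sqrt c)"
    using pi_gt3 M c by (intro mult_right_mono) (auto simp: divide_le_eq)
  finally show "\<bar>(LINT u|lborel. k (x - u) * strip_poisson c u) / pi - k x\<bar> \<le> 350 * M * sqrt c" by simp
qed

section \<open>Real and imaginary parts of sech and tanh\<close>

lemma Re_cosh: "Re (cosh z) = cosh (Re z) * cos (Im z)"
  and Im_cosh: "Im (cosh z) = sinh (Re z) * sin (Im z)"
  and Re_sinh: "Re (sinh z) = sinh (Re z) * cos (Im z)"
  and Im_sinh: "Im (sinh z) = cosh (Re z) * sin (Im z)"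
  by (simp_all add: cosh_field_def sinh_field_def Re_exp Im_exp field_simps)

lemma norm_cosh_square: "(norm (cosh z))\<^sup>2 = (sinh (Re z))\<^sup>2 + (cos (Im z))\<^sup>2" for z :: complex
proof -
  have "(norm (cosh z))\<^sup>2 = (cosh (Re z))\<^sup>2 * (cos (Im z))\<^sup>2 + (sinh (Re z))\<^sup>2 * (sin (Im z))\<^sup>2"
    by (simp add: cmod_power2 Re_cosh Im_cosh power_mult_distrib)
  then show ?thesis by (simp add: cosh_square_eq sin_squared_eq algebra_simps)
qed

lemma norm_sinh_square: "(norm (sinh z))\<^sup>2 = (sinh (Re z))\<^sup>2 + (sin (Im z))\<^sup>2" for z :: complex
proof -
  have "(norm (sinh z))\<^sup>2 = (sinh (Re z))\<^sup>2 * (cos (Im z))\<^sup>2 + (cosh (Re z))\<^sup>2 * (sin (Im z))\<^sup>2"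
    by (simp add: cmod_power2 Re_sinh Im_sinh power_mult_distrib)
  then show ?thesis by (simp add: cosh_square_eq cos_squared_eq algebra_simps)
qed

lemma
  fixes z :: complex
  shows Re_sech: "Re (1 / cosh z) = strip_poisson (cos (Im z)) (Re z)"
    and Im_sech: "Im (1 / cosh z) = - (sinh (Re z) * sin (Im z) / ((sinh (Re z))\<^sup>2 + (cos (Im z))\<^sup>2))"
    and Re_tanh: "Re (sinh z / cosh z) = sinh (Re z) * cosh (Re z) / ((sinh (Re z))\<^sup>2 + (cos (Im z))\<^sup>2)"
    and Im_tanh: "Im (sinh z / cosh z) = sin (Im z) * cos (Im z) / ((sinh (Re z))\<^sup>2 + (cos (Im z))\<^sup>2)"
proof -
  have n: "(Re (cosh z))\<^sup>2 + (Im (cosh z))\<^sup>2 = (sinh (Re z))\<^sup>2 + (cos (Im z))\<^sup>2"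
    using norm_cosh_square[of z] by (simp add: cmod_power2)
  show "Re (1 / cosh z) = strip_poisson (cos (Im z)) (Re z)"
    by (simp add: Re_divide n strip_poisson_def) (simp add: Re_cosh mult.commute)
  show "Im (1 / cosh z) = - (sinh (Re z) * sin (Im z) / ((sinh (Re z))\<^sup>2 + (cos (Im z))\<^sup>2))"
    by (simp add: Im_divide n) (simp add: Im_cosh)
  have "sinh (Re z) * cos (Im z) * (cosh (Re z) * cos (Im z)) + cosh (Re z) * sin (Im z) * (sinh (Re z) * sin (Im z))
      = sinh (Re z) * cosh (Re z) * ((sin (Im z))\<^sup>2 + (cos (Im z))\<^sup>2)"
    by algebra
  then show "Re (sinh z / cosh z) = sinh (Re z) * cosh (Re z) / ((sinh (Re z))\<^sup>2 + (cos (Im z))\<^sup>2)"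
    by (simp add: Re_divide n) (simp add: Re_cosh Im_cosh Re_sinh Im_sinh)
  have "cosh (Re z) * sin (Im z) * (cosh (Re z) * cos (Im z)) - sinh (Re z) * cos (Im z) * (sinh (Re z) * sin (Im z))
      = sin (Im z) * cos (Im z) * ((cosh (Re z))\<^sup>2 - (sinh (Re z))\<^sup>2)"
    by algebra
  then show "Im (sinh z / cosh z) = sin (Im z) * cos (Im z) / ((sinh (Re z))\<^sup>2 + (cos (Im z))\<^sup>2)"
    by (simp add: Im_divide n) (simp add: Re_cosh Im_cosh Re_sinh Im_sinh cosh_square_eq)
qed

text \<open>On a substrip where the cosine of the height stays above \<open>c\<close>, these bounds
  dominate the integrands of the two transforms.\<close>

lemma
  fixes z :: complex
  assumes c: "0 < c" "c \<le> cos (Im z)"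
  shows cosh_lower_bound: "c * cosh (Re z) \<le> norm (cosh z)"
    and norm_tanh_le: "norm (sinh z / cosh z) \<le> 1 / c"
    and cosh_nonzero_strip: "cosh z \<noteq> 0"
proof -
  have c1: "c \<le> 1" using c cos_le_one[of "Im z"] by linarith
  show A: "c * cosh (Re z) \<le> norm (cosh z)"
  proof (rule power2_le_imp_le)
    have "(c * cosh (Re z))\<^sup>2 = c\<^sup>2 * (sinh (Re z))\<^sup>2 + c\<^sup>2"
      by (simp add: power_mult_distrib cosh_square_eq algebra_simps)
    also have "\<dots> \<le> 1 * (sinh (Re z))\<^sup>2 + (cos (Im z))\<^sup>2"
      using c c1 by (intro add_mono mult_right_mono power_mono) (auto simp: power_le_one)
    finally show "(c * cosh (Re z))\<^sup>2 \<le> (norm (cosh z))\<^sup>2" by (simp add: norm_cosh_square)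
  qed simp
  have B: "norm (sinh z) \<le> cosh (Re z)"
  proof (rule power2_le_imp_le)
    show "(norm (sinh z))\<^sup>2 \<le> (cosh (Re z))\<^sup>2"
      by (simp add: norm_sinh_square cosh_square_eq abs_square_le_1)
  qed simp
  have p: "norm (cosh z) > 0" using A c cosh_real_pos[of "Re z"] by (smt (verit) mult_pos_pos)
  then show "cosh z \<noteq> 0" by auto
  show "norm (sinh z / cosh z) \<le> 1 / c"
  proof -
    have "c * norm (sinh z) \<le> c * cosh (Re z)" using B c by (intro mult_left_mono) auto
    then have "c * norm (sinh z) \<le> norm (cosh z)" using A by linarith
    then show ?thesis using p c by (simp add: norm_divide field_simps)
  qed
qed

section \<open>The map into the curved strip\<close>

lemma integral_indicator_deriv:
  fixes G g :: "real \<Rightarrow> real"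
  assumes G: "\<And>x. (G has_real_derivative g x) (at x)" and g: "continuous_on UNIV g" and xy: "x \<le> y"
  shows "(LINT t|lborel. indicator {x..y} t * g t) = G y - G x"
proof -
  have "(LINT t|lborel. indicator {x..y} t *\<^sub>R g t) = G y - G x"
    by (rule integral_FTC_atLeastAtMost[OF xy])
       (use G g in \<open>auto intro: has_field_derivative_at_within continuous_on_subset
          simp: has_real_derivative_iff_has_vector_derivative[symmetric]\<close>)
  then show ?thesis by simp
qed

lemma antiderivative_increment_le:
  fixes G g w :: "real \<Rightarrow> real"
  assumes G: "\<And>x. (G has_real_derivative g x) (at x)" and g: "continuous_on UNIV g"
    and le: "\<And>x. 0 \<le> g x" "\<And>x. g x \<le> w x" and w: "integrable lborel w" and xy: "x \<le> y"
  shows "G y - G x \<le> (LINT t|lborel. w t)"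
proof -
  have "integrable lborel (\<lambda>t. indicator {x..y} t *\<^sub>R g t)"
    using borel_integrable_atLeastAtMost'[OF continuous_on_subset[OF g], of x y]
    by (simp add: set_integrable_def)
  then have "(LINT t|lborel. indicator {x..y} t * g t) \<le> (LINT t|lborel. w t)"
    by (intro integral_mono w) (auto simp: indicator_def intro: le order_trans[OF le])
  then show ?thesis by (simp only: integral_indicator_deriv[OF G g xy])
qed

text \<open>The equation is autonomous and is solved by separation of variables: \<open>A\<close> is
  the inverse of an antiderivative \<open>F\<close> of \<open>1 / (1 - 2 / pi * w)\<close>. This
  integrand exceeds 1 by at most \<open>2 * w\<close>, which is integrable, so \<open>F\<close> and
  hence \<open>A\<close> stay at bounded distance from the identity.\<close>

lemma exists_reparametrisation:
  fixes w :: "real \<Rightarrow> real"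
  assumes cont: "continuous_on UNIV w" and w: "\<And>x. 0 \<le> w x" "\<And>x. w x \<le> 1/8"
    and int: "integrable lborel w"
  obtains A B where "\<And>x. (A has_real_derivative 1 - 2 / pi * w (A x)) (at x)"
    "\<And>x. \<bar>A x - x\<bar> \<le> B"
proof -
  define b where "b = (\<lambda>x. 1 / (1 - 2 / pi * w x))"
  have d: "1/2 \<le> 1 - 2 / pi * w x" "1 - 2 / pi * w x \<le> 1" for x
  proof -
    have "2 / pi * w x \<le> 1 * (1/8)"
      using pi_gt3 w by (intro mult_mono) auto
    then show "1/2 \<le> 1 - 2 / pi * w x" "1 - 2 / pi * w x \<le> 1" using w[of x] by auto
  qed
  have dpos: "1 - 2 / pi * w x > 0" for x using d(1)[of x] by linarith
  have b1: "b x \<ge> 1" for x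
    unfolding b_def using d(2)[of x] dpos[of x] by simp
  have bw: "b x - 1 \<le> 2 * w x" for x
  proof -
    have "b x - 1 = (2 / pi * w x) / (1 - 2 / pi * w x)"
      using dpos[of x] by (simp add: b_def field_simps)
    also have "\<dots> \<le> (1 * w x) / (1/2)"
      using d(1)[of x] pi_gt3 w by (intro frac_le mult_right_mono) auto
    finally show ?thesis by simp
  qed
  have bc: "continuous_on UNIV b"
    unfolding b_def using dpos by (intro continuous_intros cont) (metis less_irrefl)
  have "\<exists>F. \<forall>x::real. - \<infinity> < ereal x \<longrightarrow> ereal x < \<infinity> \<longrightarrow> (F has_vector_derivative b x) (at x)"
    by (rule einterval_antiderivative) (use bc in \<open>auto simp: continuous_on_eq_continuous_at\<close>)
  then obtain F where F: "\<And>x. (F has_real_derivative b x) (at x)"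
    by (auto simp: has_real_derivative_iff_has_vector_derivative)
  have G: "((\<lambda>x. F x - x) has_real_derivative b x - 1) (at x)" for x
    by (auto intro!: derivative_eq_intros F)
  define L where "L = (LINT t|lborel. 2 * w t)"
  have inc: "F x - x \<le> F y - y" "(F y - y) - (F x - x) \<le> L" if "x \<le> y" for x y
  proof -
    show "F x - x \<le> F y - y"
      using G b1 by (intro DERIV_nonneg_imp_nondecreasing[OF that]) (metis diff_ge_0_iff_ge)
    show "(F y - y) - (F x - x) \<le> L"
      unfolding L_def
      by (rule antiderivative_increment_le[OF G]) (use that b1 bw int bc in \<open>auto intro!: continuous_intros\<close>)
  qed
  have bd: "\<bar>F x - x\<bar> \<le> \<bar>F 0\<bar> + L" for x
    using inc[of 0 x] inc[of x 0] by (cases "x \<ge> 0") auto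
  have expand: "\<bar>x - y\<bar> \<le> \<bar>F x - F y\<bar>" for x y
    using inc(1)[of x y] inc(1)[of y x] by (cases "x \<le> y") auto
  have Fc: "isCont F x" for x using F DERIV_isCont by blast
  have "\<exists>x. F x = y" for y
  proof -
    have "F (y - (\<bar>F 0\<bar> + L)) \<le> y" "y \<le> F (y + (\<bar>F 0\<bar> + L))"
      using bd[of "y - (\<bar>F 0\<bar> + L)"] bd[of "y + (\<bar>F 0\<bar> + L)"] unfolding abs_le_iff by linarith+
    moreover have "0 \<le> \<bar>F 0\<bar> + L" using bd[of 0] by linarith
    ultimately show ?thesis using IVT[of F "y - (\<bar>F 0\<bar> + L)" y "y + (\<bar>F 0\<bar> + L)"] Fc by auto
  qed
  then obtain A where A: "\<And>y. F (A y) = y" by metis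
  \<comment> \<open>As \<open>F\<close> expands distances, its inverse is 1-Lipschitz; this supplies
    the continuity that the inverse function rule asks for.\<close>
  have lip: "\<bar>A x - A y\<bar> \<le> \<bar>x - y\<bar>" for x y using expand[of "A x" "A y"] A by simp
  have Ac: "isCont A x" for x
    unfolding continuous_at_eps_delta by (metis dist_real_def le_less_trans lip)
  show ?thesis
  proof (rule that)
    show "\<bar>A x - x\<bar> \<le> \<bar>F 0\<bar> + L" for x using bd[of "A x"] A[of x] by (simp add: abs_minus_commute)
    show "(A has_real_derivative 1 - 2 / pi * w (A x)) (at x)" for x
    proof -
      have "(A has_real_derivative inverse (b (A x))) (at x)"
        by (rule DERIV_inverse_function[OF F, where a = "x - 1" and b = "x + 1"])
           (use b1[of "A x"] A Ac in auto)
      then show ?thesis by (simp add: b_def)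
    qed
  qed
qed

text \<open>In the application, \<open>w\<close> is the margin along \<open>A\<close>, a function of
  the original variable. The function \<open>pi / 2 * (x - A x)\<close> is a bounded antiderivative
  of \<open>w\<close>, whence the integrability. For the second claim, moving \<open>x\<close> to
  \<open>y\<close> changes the integrand by \<open>2 * w t\<close> between the two points and by 0
  elsewhere, so both sides have equal increments.\<close>

lemma
  fixes w A :: "real \<Rightarrow> real"
  assumes cont: "continuous_on UNIV w" and w: "\<And>x. 0 \<le> w x"
    and A: "\<And>x. (A has_real_derivative 1 - 2 / pi * w x) (at x)"
    and B: "\<And>x. \<bar>A x - x\<bar> \<le> B"
  shows integrable_reparametrisation_defect: "integrable lborel w"
    and sgn_integral_reparametrisation: "\<exists>\<kappa>. \<forall>x. (LINT t|lborel. w t * sgn (x - t)) / pi = x - A x + \<kappa>"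
proof -
  define G where "G = (\<lambda>x. pi / 2 * (x - A x))"
  have G: "(G has_real_derivative w x) (at x)" for x
    unfolding G_def by (rule derivative_eq_intros A refl)+ (simp add: field_simps)
  have mono: "G x \<le> G y" if "x \<le> y" for x y
    using G w by (intro DERIV_nonneg_imp_nondecreasing[OF that]) blast
  have Gb: "\<bar>G x\<bar> \<le> pi / 2 * B" for x
    using B[of x] by (simp add: G_def abs_mult abs_minus_commute)
  have Gu: "G x \<le> pi / 2 * B" and Gl: "- (pi / 2 * B) \<le> G x" for x
    using Gb[of x] by linarith+
  have bdd: "bdd_above (range G)" "bdd_below (range G)"
    by (rule bdd_aboveI2[OF Gu], rule bdd_belowI2[OF Gl])
  have l1: "(G \<longlongrightarrow> (SUP x. G x)) at_top"
  proof (rule order_tendstoI)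
    show "eventually (\<lambda>x. a < G x) at_top" if a: "a < (SUP x. G x)" for a
    proof -
      obtain x0 where x0: "a < G x0" using a less_cSUP_iff[OF _ bdd(1), of a] by auto
      show ?thesis
        by (rule eventually_mono[OF eventually_ge_at_top[of x0]]) (rule less_le_trans[OF x0 mono])
    qed
    show "eventually (\<lambda>x. G x < a) at_top" if "(SUP x. G x) < a" for a
      using cSUP_upper[OF _ bdd(1)] that by (intro always_eventually) (metis UNIV_I le_less_trans)
  qed
  have l0: "(G \<longlongrightarrow> (INF x. G x)) at_bot"
  proof (rule order_tendstoI)
    show "eventually (\<lambda>x. G x < a) at_bot" if a: "(INF x. G x) < a" for a
    proof -
      obtain x0 where x0: "G x0 < a" using a cINF_less_iff[OF _ bdd(2), of a] by auto
      show ?thesis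
        by (rule eventually_mono[OF eventually_le_at_bot[of x0]]) (rule le_less_trans[OF mono x0])
    qed
    show "eventually (\<lambda>x. a < G x) at_bot" if "a < (INF x. G x)" for a
      using cINF_lower[OF bdd(2)] that by (intro always_eventually) (metis UNIV_I less_le_trans)
  qed
  have z: "(-\<infinity>::ereal) < \<infinity>" by simp
  have nn: "AE x in lborel. - \<infinity> < ereal x \<longrightarrow> ereal x < \<infinity> \<longrightarrow> 0 \<le> w x" by (simp add: w)
  have wc: "isCont w x" for x using cont by (simp add: continuous_on_eq_continuous_at)
  show int: "integrable lborel w"
    using interval_integral_FTC_nonneg(1)[OF z G wc nn, of "INF x. G x" "SUP x. G x"] l0 l1
    by (simp add: set_integrable_def einterval_def ereal_tendsto_simps1)
  have sint: "integrable lborel (\<lambda>t. w t * sgn (x - t))" for x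
    by (rule Bochner_Integration.integrable_bound[OF int])
       (use w in \<open>auto simp: abs_mult abs_sgn_eq intro!: AE_I2 borel_measurable_times borel_measurable_integrable[OF int, simplified]\<close>)
  have diff: "(LINT t|lborel. w t * sgn (y - t)) - (LINT t|lborel. w t * sgn (x - t)) = 2 * (G y - G x)"
    if "x \<le> y" for x y
  proof (cases "x = y")
    case False
    then have xy: "x < y" using that by simp
    have "(LINT t|lborel. w t * sgn (y - t)) - (LINT t|lborel. w t * sgn (x - t))
        = (LINT t|lborel. w t * sgn (y - t) - w t * sgn (x - t))"
      by (rule Bochner_Integration.integral_diff[symmetric]) (rule sint)+
    also have "\<dots> = (LINT t|lborel. 2 * (indicator {x..y} t * w t))"
    proof (rule integral_cong_AE)
      show "AE t in lborel. w t * sgn (y - t) - w t * sgn (x - t) = 2 * (indicator {x..y} t * w t)"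
        using AE_lborel_singleton[of x] AE_lborel_singleton[of y]
        by eventually_elim (use xy in \<open>auto simp: sgn_if indicator_def\<close>)
    qed (use borel_measurable_integrable[OF int] in \<open>auto intro!: borel_measurable_times\<close>)
    also have "\<dots> = 2 * (G y - G x)"
      by (simp add: integral_indicator_deriv[OF G cont that])
    finally show ?thesis .
  qed simp
  define I where "I = (\<lambda>x. LINT t|lborel. w t * sgn (x - t))"
  have "\<exists>\<kappa>. \<forall>x. I x / pi = x - A x + \<kappa>"
  proof (intro exI allI)
    fix x
    have "I x - I 0 = 2 * (G x - G 0)"
      using diff[of 0 x] diff[of x 0] unfolding I_def by (cases "0 \<le> x") auto
    moreover have "2 * G x = pi * (x - A x)" by (simp add: G_def)
    ultimately have "I x = pi * (x - A x) + (I 0 - 2 * G 0)"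
      by (simp only: right_diff_distrib)
    then show "I x / pi = x - A x + (I 0 - 2 * G 0) / pi"
      by (simp add: add_divide_distrib)
  qed
  then show "\<exists>\<kappa>. \<forall>x. (LINT t|lborel. w t * sgn (x - t)) / pi = x - A x + \<kappa>"
    unfolding I_def .
qed

section \<open>Holomorphy of the sech and tanh transforms\<close>

definition strip :: "complex set" where
  "strip = {z. \<bar>Im z\<bar> < pi / 2}"

lemma open_strip: "open strip"
  unfolding strip_def by (intro open_Collect_less continuous_intros)

lemma strip_cos_pos: "z \<in> strip \<Longrightarrow> cos (Im z) > 0"
  by (rule cos_gt_zero_pi) (auto simp: strip_def)

lemma strip_ball:
  assumes "z \<in> strip"
  obtains r c where "r > 0" "ball z r \<subseteq> strip" "0 < c" "\<And>w. w \<in> ball z r \<Longrightarrow> c \<le> cos (Im w)"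
proof -
  define r where "r = (pi / 2 - \<bar>Im z\<bar>) / 2"
  have r: "r > 0" using assms by (simp add: r_def strip_def)
  have lt: "\<bar>Im z\<bar> + r < pi / 2" using r by (simp add: r_def field_simps)
  have le: "\<bar>Im w\<bar> \<le> \<bar>Im z\<bar> + r" if "w \<in> ball z r" for w
    using that abs_Im_le_cmod[of "z - w"] by (simp add: dist_norm)
  show ?thesis
  proof (rule that[OF r])
    show "ball z r \<subseteq> strip" using le lt by (force simp: strip_def)
    show "cos (\<bar>Im z\<bar> + r) > 0" using r lt by (intro cos_gt_zero_pi) auto
    show "cos (\<bar>Im z\<bar> + r) \<le> cos (Im w)" if "w \<in> ball z r" for w
    proof -
      have "cos (\<bar>Im z\<bar> + r) \<le> cos \<bar>Im w\<bar>"
        using le[OF that] lt r by (intro cos_monotone_0_pi_le) auto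
      then show ?thesis by simp
    qed
  qed
qed

lemma strip_poisson_1: "strip_poisson 1 u = 1 / cosh u"
proof -
  have "(sinh u)\<^sup>2 + 1\<^sup>2 = cosh u * cosh u"
    using cosh_square_eq[of u] by (simp add: power2_eq_square)
  then show ?thesis by (simp add: strip_poisson_def)
qed

lemma cosh_shift_le: "cosh u \<le> exp \<bar>v\<bar> * cosh (u + v)" for u v :: real
proof -
  have "exp u \<le> exp \<bar>v\<bar> * exp (u + v)" "exp (- u) \<le> exp \<bar>v\<bar> * exp (- (u + v))"
    unfolding exp_add[symmetric] exp_le_cancel_iff by linarith+
  then show ?thesis unfolding cosh_field_def by (simp add: distrib_left)
qed

text \<open>Moving \<open>z\<close> inside a small disc changes \<open>cosh (Re z - t)\<close> by a
  factor of at most \<open>exp r\<close> and costs \<open>1 / c\<close> for the height, so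
  integrability at the real point \<open>Re z\<close> already provides the local majorant.\<close>

lemma sech_transform_holomorphic:
  fixes k :: "real \<Rightarrow> real"
  assumes k: "k \<in> borel_measurable borel" and int: "\<And>x. integrable lborel (\<lambda>t. k t * strip_poisson 1 (x - t))"
  shows "(\<lambda>z. LINT t|lborel. of_real (k t) * (1 / cosh (z - of_real t))) holomorphic_on strip"
proof (rule holomorphic_on_lebesgue_integral[OF open_strip])
  have nz: "cosh (z - of_real t) \<noteq> 0" if "z \<in> strip" for z t
    using cosh_nonzero_strip[OF strip_cos_pos[OF that], of "z - of_real t"] by simp
  show "(\<lambda>z. of_real (k t) * (1 / cosh (z - of_real t))) holomorphic_on strip" for t
    using nz unfolding cosh_field_def by (intro holomorphic_intros) auto
  show "(\<lambda>t. of_real (k t) * (1 / cosh (z - of_real t))) \<in> borel_measurable lborel" if "z \<in> strip" for z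
  proof -
    have "continuous_on UNIV (\<lambda>t. 1 / cosh (z - of_real t))"
      using nz[OF that] by (intro continuous_intros) auto
    from borel_measurable_continuous_onI[OF this] show ?thesis
      using k by (intro borel_measurable_times borel_measurable_of_real) simp_all
  qed
  fix z assume z: "z \<in> strip"
  obtain r c where r: "r > 0" "ball z r \<subseteq> strip" "0 < c" and c: "\<And>w. w \<in> ball z r \<Longrightarrow> c \<le> cos (Im w)"
    using strip_ball[OF z] by blast
  define g where "g = (\<lambda>t. exp r / c * \<bar>k t * strip_poisson 1 (Re z - t)\<bar>)"
  have "norm (of_real (k t) * (1 / cosh (w - of_real t))) \<le> g t" if w: "w \<in> ball z r" for w t
  proof -
    have "\<bar>Re w - Re z\<bar> \<le> r" using w abs_Re_le_cmod[of "z - w"] by (simp add: dist_norm)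
    then have "exp \<bar>Re w - Re z\<bar> * cosh (Re z - t + (Re w - Re z)) \<le> exp r * cosh (Re z - t + (Re w - Re z))"
      by (intro mult_right_mono) auto
    then have "cosh (Re z - t) \<le> exp r * cosh (Re z - t + (Re w - Re z))"
      using cosh_shift_le order_trans by blast
    then have "c * cosh (Re z - t) \<le> exp r * (c * cosh (Re w - t))"
      using r by (simp add: mult_left_mono mult.left_commute)
    also have "\<dots> \<le> exp r * norm (cosh (w - of_real t))"
      using cosh_lower_bound[OF r(3), of "w - of_real t"] c[OF w] by (intro mult_left_mono) auto
    finally have "1 / norm (cosh (w - of_real t)) \<le> exp r / c * (1 / cosh (Re z - t))"
      using nz[of w t] w r by (auto simp: field_simps)
    from mult_left_mono[OF this, of "\<bar>k t\<bar>"] show ?thesis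
      by (simp add: g_def norm_mult norm_divide strip_poisson_1 abs_mult mult_ac)
  qed
  moreover have "integrable lborel g"
    unfolding g_def by (intro integrable_mult_right integrable_abs int)
  ultimately show "\<exists>r>0. \<exists>g. ball z r \<subseteq> strip \<and> integrable lborel g \<and>
      (\<forall>w\<in>ball z r. \<forall>t. norm (of_real (k t) * (1 / cosh (w - of_real t))) \<le> g t)"
    using r by blast
qed

text \<open>Unlike sech, tanh does not decay, so the data themselves have to be integrable; for
  \<open>N\<close> this is the integrability of the margin.\<close>

lemma tanh_transform_holomorphic:
  fixes k :: "real \<Rightarrow> real"
  assumes int: "integrable lborel k"
  shows "(\<lambda>z. LINT t|lborel. of_real (k t) * (sinh (z - of_real t) / cosh (z - of_real t))) holomorphic_on strip"
proof (rule holomorphic_on_lebesgue_integral[OF open_strip])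
  have nz: "cosh (z - of_real t) \<noteq> 0" if "z \<in> strip" for z t
    using cosh_nonzero_strip[OF strip_cos_pos[OF that], of "z - of_real t"] by simp
  show "(\<lambda>z. of_real (k t) * (sinh (z - of_real t) / cosh (z - of_real t))) holomorphic_on strip" for t
    using nz unfolding cosh_field_def sinh_field_def by (intro holomorphic_intros) auto
  show "(\<lambda>t. of_real (k t) * (sinh (z - of_real t) / cosh (z - of_real t))) \<in> borel_measurable lborel" if "z \<in> strip" for z
  proof -
    have "continuous_on UNIV (\<lambda>t. sinh (z - of_real t) / cosh (z - of_real t))"
      using nz[OF that] by (intro continuous_intros) auto
    from borel_measurable_continuous_onI[OF this] show ?thesis
      using borel_measurable_integrable[OF int] by (intro borel_measurable_times borel_measurable_of_real) simp_all
  qed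
  fix z assume z: "z \<in> strip"
  obtain r c where r: "r > 0" "ball z r \<subseteq> strip" "0 < c" and c: "\<And>w. w \<in> ball z r \<Longrightarrow> c \<le> cos (Im w)"
    using strip_ball[OF z] by blast
  have "norm (of_real (k t) * (sinh (w - of_real t) / cosh (w - of_real t))) \<le> \<bar>k t\<bar> * (1 / c)" if w: "w \<in> ball z r" for w t
    unfolding norm_mult using norm_tanh_le[OF r(3), of "w - of_real t"] c[OF w] by (intro mult_mono) auto
  moreover have "integrable lborel (\<lambda>t. \<bar>k t\<bar> * (1 / c))"
    by (intro integrable_mult_left integrable_abs int)
  ultimately show "\<exists>r>0. \<exists>g. ball z r \<subseteq> strip \<and> integrable lborel g \<and>
      (\<forall>w\<in>ball z r. \<forall>t. norm (of_real (k t) * (sinh (w - of_real t) / cosh (w - of_real t))) \<le> g t)"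
    using r by blast
qed

text \<open>The substitution \<open>t = Re z - u\<close> puts the kernel at the fixed height
  \<open>Im z\<close>. Integrability is asked for separately because the two parts of the kernel are
  controlled by different bounds.\<close>

lemma
  fixes k :: "real \<Rightarrow> real" and K :: "complex \<Rightarrow> complex"
  assumes r: "integrable lborel (\<lambda>u. k (Re z - u) * Re (K (Complex u (Im z))))"
    and i: "integrable lborel (\<lambda>u. k (Re z - u) * Im (K (Complex u (Im z))))"
  shows Re_convolution: "Re (LINT t|lborel. of_real (k t) * K (z - of_real t)) = (LINT u|lborel. k (Re z - u) * Re (K (Complex u (Im z))))"
    and Im_convolution: "Im (LINT t|lborel. of_real (k t) * K (z - of_real t)) = (LINT u|lborel. k (Re z - u) * Im (K (Complex u (Im z))))"
proof -
  let ?f = "\<lambda>u. of_real (k (Re z - u)) * K (Complex u (Im z))"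
  have eq: "z - of_real (Re z + - 1 * u) = Complex u (Im z)" for u
    by (simp add: complex_eq_iff)
  have "(LINT t|lborel. of_real (k t) * K (z - of_real t)) = (LINT u|lborel. ?f u)"
    using lborel_integral_real_affine[of "-1" "\<lambda>t. of_real (k t) * K (z - of_real t)" "Re z"]
    unfolding eq by simp
  moreover have "integrable lborel ?f"
  proof -
    have eq: "?f = (\<lambda>u. of_real (k (Re z - u) * Re (K (Complex u (Im z)))) + \<i> * of_real (k (Re z - u) * Im (K (Complex u (Im z)))))"
      by (auto simp: fun_eq_iff complex_eq_iff)
    show ?thesis
      unfolding eq by (intro Bochner_Integration.integrable_add integrable_mult_right integrable_of_real r i)
  qed
  ultimately show "Re (LINT t|lborel. of_real (k t) * K (z - of_real t)) = (LINT u|lborel. k (Re z - u) * Re (K (Complex u (Im z))))"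
    "Im (LINT t|lborel. of_real (k t) * K (z - of_real t)) = (LINT u|lborel. k (Re z - u) * Im (K (Complex u (Im z))))"
    by (simp_all flip: integral_Re integral_Im)
qed

text \<open>Uniformly in the height, the conjugate kernels are bounded by \<open>1 / \<bar>sinh u\<bar>\<close>; for the real part of
  \<open>tanh\<close> this needs the subtraction of its limits at infinity.\<close>

lemma
  fixes c s u :: real
  assumes c: "0 < c" "c \<le> 1" and s: "\<bar>s\<bar> \<le> 1"
  defines "D \<equiv> (sinh u)\<^sup>2 + c\<^sup>2"
  shows conjugate_sech_le: "\<bar>sinh u * s / D\<bar> * \<bar>sinh u\<bar> \<le> 1" "\<bar>sinh u * s / D\<bar> \<le> strip_poisson c u / c"
    and conjugate_tanh_le: "\<bar>sinh u * cosh u / D - sgn u\<bar> * \<bar>sinh u\<bar> \<le> 1"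
      "\<bar>sinh u * cosh u / D - sgn u\<bar> \<le> 2 * strip_poisson c u / c"
proof -
  have D: "D > 0" unfolding D_def by (rule kernel_denominator_pos[OF c(1)])
  have S: "\<bar>sinh u\<bar> \<le> cosh u"
    by (rule power2_le_imp_le) (auto simp: cosh_square_eq)
  have sp: "strip_poisson c u / c = cosh u / D" using c by (simp add: strip_poisson_def D_def)
  have sp2: "2 * strip_poisson c u / c = 2 * cosh u / D" using c by (simp add: strip_poisson_def D_def)
  have "\<bar>sinh u * s\<bar> * \<bar>sinh u\<bar> = (sinh u)\<^sup>2 * \<bar>s\<bar>" by (simp add: abs_mult power2_eq_square)
  also have "\<dots> \<le> (sinh u)\<^sup>2 * 1" using s by (intro mult_left_mono) auto
  also have "\<dots> \<le> D" by (simp add: D_def)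
  finally show "\<bar>sinh u * s / D\<bar> * \<bar>sinh u\<bar> \<le> 1" using D by (simp add: abs_mult)
  have "\<bar>sinh u * s\<bar> \<le> cosh u * 1" unfolding abs_mult using S s by (intro mult_mono) auto
  then show "\<bar>sinh u * s / D\<bar> \<le> strip_poisson c u / c"
    unfolding sp using D by (simp add: divide_right_mono)
  define v where "v = \<bar>u\<bar>"
  have v: "v \<ge> 0" "D = (sinh v)\<^sup>2 + c\<^sup>2" "\<bar>sinh u\<bar> = sinh v" "cosh u = cosh v"
    by (auto simp: v_def D_def abs_if)
  have ab: "\<bar>sinh u * cosh u / D - sgn u\<bar> = (if u = 0 then 0 else \<bar>sinh v * cosh v - D\<bar> / D)"
  proof -
    have "sinh u * cosh u / D - sgn u = sgn u * (sinh v * cosh v / D - 1)" if "u \<noteq> 0"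
      using that by (auto simp: v_def abs_if sgn_if)
    moreover have "sinh v * cosh v / D - 1 = (sinh v * cosh v - D) / D" using D by (simp add: field_simps)
    ultimately show ?thesis using D by (simp add: abs_mult abs_sgn_eq)
  qed
  \<comment> \<open>Because \<open>cosh v - sinh v = exp (- v)\<close>, subtracting the sign leaves
    a difference of two nonnegative terms that are at most 1; its absolute value is at most the
    larger of them.\<close>
  have e: "sinh v * cosh v - D = sinh v * exp (- v) - c\<^sup>2"
    unfolding v(2) using cosh_minus_sinh[of v] by (simp add: power2_eq_square algebra_simps flip: cosh_minus_sinh)
  have sv: "sinh v \<ge> 0" using v by simp
  have ev: "sinh v * exp (- v) \<le> 1"
  proof -
    have "sinh v * exp (- v) = (1 - exp (- (2 * v))) / 2"
      by (simp add: sinh_field_def left_diff_distrib flip: exp_add)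
    also have "\<dots> \<le> 1 / 2" by simp
    finally show ?thesis by simp
  qed
  have absle: "\<bar>sinh v * cosh v - D\<bar> \<le> max (sinh v * exp (- v)) (c\<^sup>2)"
  proof -
    have "\<bar>a - b\<bar> \<le> max a b" if "0 \<le> a" "0 \<le> b" for a b :: real
      using that by (simp add: abs_le_iff max_def)
    then show ?thesis unfolding e using sv by simp
  qed
  have c2: "c\<^sup>2 \<le> 1" using c by (simp add: power_le_one)
  have "\<bar>sinh v * cosh v - D\<bar> \<le> 1" using absle ev c2 by linarith
  also have "1 \<le> 2 * cosh u" using cosh_real_ge_1[of u] by linarith
  finally have "\<bar>sinh v * cosh v - D\<bar> / D \<le> 2 * cosh u / D"
    using D by (intro divide_right_mono) auto
  moreover have "0 \<le> 2 * cosh u / D" using D by simp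
  ultimately show "\<bar>sinh u * cosh u / D - sgn u\<bar> \<le> 2 * strip_poisson c u / c"
    unfolding ab sp2 by (cases "u = 0") simp_all
  have "sinh v * exp (- v) * sinh v = (sinh v)\<^sup>2 * exp (- v)" by (simp add: power2_eq_square)
  also have "\<dots> \<le> (sinh v)\<^sup>2 * 1" using v(1) by (intro mult_left_mono) auto
  finally have "sinh v * exp (- v) * sinh v \<le> (sinh v)\<^sup>2 * 1" .
  have "c\<^sup>2 * sinh v \<le> D"
  proof -
    have "c\<^sup>2 \<le> 2 * c" using mult_right_mono[OF c(2), of c] c(1) by (simp add: power2_eq_square)
    then have "c\<^sup>2 * sinh v \<le> 2 * c * sinh v" using sv by (rule mult_right_mono)
    also have "\<dots> \<le> (sinh v)\<^sup>2 + c\<^sup>2"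
      using zero_le_power2[of "sinh v - c"] by (simp add: power2_diff mult_ac)
    also have "\<dots> = D" using v(2) by simp
    finally show ?thesis .
  qed
  have "max (sinh v * exp (- v)) (c\<^sup>2) * sinh v \<le> D"
  proof -
    have "sinh v * exp (- v) * sinh v \<le> D" using \<open>sinh v * exp (- v) * sinh v \<le> (sinh v)\<^sup>2 * 1\<close> v(2) zero_le_power2[of c]
      by linarith
    with \<open>c\<^sup>2 * sinh v \<le> D\<close> show ?thesis by (simp only: max_def split: if_split) blast
  qed
  with mult_right_mono[OF absle sv] have "\<bar>sinh v * cosh v - D\<bar> * sinh v \<le> D" by (rule order_trans)
  then have "\<bar>sinh v * cosh v - D\<bar> / D * sinh v \<le> 1"
    using D by (simp add: divide_le_eq)
  then show "\<bar>sinh u * cosh u / D - sgn u\<bar> * \<bar>sinh u\<bar> \<le> 1"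
    unfolding ab v(3) by (cases "u = 0") simp_all
qed

text \<open>With \<open>s\<close> the modulus of the sine of the height, the quotient
  \<open>s * c / ((sinh u)\<^sup>2 + c\<^sup>2)\<close> is the imaginary part of tanh up to sign. It
  misses \<open>s * strip_poisson c u\<close> by at most \<open>c / cosh u\<close>, since
  \<open>(cosh u - 1) cosh u <= sinh^2 u\<close>. The factor \<open>c\<close> in this error lets the
  distance to the edge pay for it.\<close>

lemma
  fixes c s u :: real
  assumes c: "0 < c" "c \<le> 1" and s: "0 \<le> s" "s \<le> 1"
  shows tanh_kernel_le: "s * c / ((sinh u)\<^sup>2 + c\<^sup>2) \<le> strip_poisson c u"
    and tanh_kernel_ge: "s * strip_poisson c u - c * strip_poisson 1 u \<le> s * c / ((sinh u)\<^sup>2 + c\<^sup>2)"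
proof -
  define D where "D = (sinh u)\<^sup>2 + c\<^sup>2"
  have D: "D > 0" unfolding D_def by (rule kernel_denominator_pos[OF c(1)])
  have C: "cosh u \<ge> 1" by (rule cosh_real_ge_1)
  have "s * c \<le> 1 * c" using s c by (intro mult_right_mono) auto
  also have "\<dots> \<le> c * cosh u" using c C by simp
  finally show "s * c / ((sinh u)\<^sup>2 + c\<^sup>2) \<le> strip_poisson c u"
    unfolding strip_poisson_def D_def[symmetric] using D by (intro divide_right_mono) auto
  have "(s * (cosh u - 1)) * cosh u \<le> (1 * (cosh u - 1)) * cosh u"
    using s C by (intro mult_right_mono) auto
  also have "\<dots> = (cosh u)\<^sup>2 - cosh u" by (simp add: left_diff_distrib power2_eq_square)
  also have "\<dots> \<le> (sinh u)\<^sup>2" using cosh_square_eq[of u] C by linarith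
  also have "\<dots> \<le> D" by (simp add: D_def)
  finally have "s * (cosh u - 1) / D \<le> 1 / cosh u"
    using D C by (simp add: divide_le_eq le_divide_eq mult_ac)
  then have "c * (s * (cosh u - 1) / D) \<le> c * (1 / cosh u)" using c by (intro mult_left_mono) auto
  then show "s * strip_poisson c u - c * strip_poisson 1 u \<le> s * c / ((sinh u)\<^sup>2 + c\<^sup>2)"
  proof -
    have "c * (s * (cosh u - 1) / D) = s * (c * cosh u / D) - s * c / D"
      using D by (simp add: field_simps)
    with \<open>c * (s * (cosh u - 1) / D) \<le> c * (1 / cosh u)\<close> show ?thesis
      unfolding strip_poisson_1 unfolding strip_poisson_def D_def[symmetric] by linarith
  qed
qed

text \<open>Here \<open>e\<close> is the absolute height, \<open>d\<close> the distance to the edge,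
  \<open>c\<close> the cosine of the height, \<open>V\<close> the inward push and \<open>v\<close>
  the error from the horizontal displacement. The losses 350 and 1400 add up to
  \<open>1750 m sqrt c <= d / 2 + 1531250 m^2\<close>, where \<open>2 * 1531250 = 1750^2\<close>;
  with \<open>c / 4 <= d / 4\<close> the total is below \<open>d + 1600000 m^2 - m^2\<close>, which
  fixes the coefficient 1600000. The other sign of \<open>e - V\<close> needs only crude numerical
  bounds.\<close>

lemma strip_edge_estimate:
  fixes m c d e V v H :: real
  assumes m: "0 \<le> m" "m \<le> 1 / 10 ^ 8" and c: "0 < c" "c \<le> d" "c \<le> 1" and e: "0 \<le> e" "e = pi / 2 - d"
    and v: "0 \<le> v" "v \<le> 1 / 16" and V: "0 \<le> V" "V \<le> 1 / 8"
    and lo: "v + 1600000 * m\<^sup>2 - c / 4 - 1400 * m * sqrt c \<le> V"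
  shows "\<bar>e - V\<bar> + 350 * m * sqrt c + v \<le> pi / 2 - m\<^sup>2"
proof -
  have sc: "sqrt c \<le> sqrt d" "sqrt c \<le> 1" "0 \<le> sqrt c" "0 \<le> sqrt d" using c by auto
  have m2: "m\<^sup>2 \<le> 1 / 10 ^ 8"
    using mult_mono[OF m(2) m(2)] m by (simp add: power2_eq_square)
  have "m * sqrt c \<le> 1 / 10 ^ 8 * 1" using m sc by (intro mult_mono) auto
  then have small: "V - e + 350 * m * sqrt c + v \<le> pi / 2 - m\<^sup>2"
    using e v V m2 pi_gt3 by simp
  have "m * sqrt c \<le> m * sqrt d" using m sc by (intro mult_left_mono) auto
  moreover have "0 \<le> (sqrt d - 1750 * m)\<^sup>2" by simp
  then have "3500 * (m * sqrt d) \<le> d + 3062500 * m\<^sup>2"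
    using c by (simp add: power2_diff power_mult_distrib mult_ac)
  ultimately have "1750 * (m * sqrt c) \<le> d / 2 + 1531250 * m\<^sup>2" by linarith
  moreover have "0 \<le> m\<^sup>2" by simp
  ultimately have "e - V + 350 * m * sqrt c + v \<le> pi / 2 - m\<^sup>2"
    using lo e(2) c unfolding mult.assoc by linarith
  with small show ?thesis by (simp add: abs_if)
qed

text \<open>The square root in the modulus is what Cauchy-Schwarz yields from a local L^2 norm of
  the derivative. The exponential rate 1/4 is half the rate of the weight in that squared norm, and
  stays within the rate 1/2 that the kernel bounds tolerate. The number 512 exceeds
  \<open>256 (1 + 4) / pi\<close>, the displacement caused by the two conjugate integrals with
  moduli \<open>m\<close> and \<open>4 * m\<close>.\<close>

locale strip_data =
  fixes h m :: "real \<Rightarrow> real"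
  assumes mono: "mono h"
    and holder: "\<And>a b. \<bar>h a - h b\<bar> \<le> m a * (sqrt \<bar>a - b\<bar> * exp (\<bar>a - b\<bar> / 4))"
    and slow: "\<And>a b. m a \<le> m b * exp (\<bar>a - b\<bar> / 4)"
    and m_pos: "\<And>a. 0 < m a" and m_small: "\<And>a. m a \<le> 1 / 10 ^ 8"
    and int_m: "integrable lborel (\<lambda>a. (m a)\<^sup>2)"
    and int_h: "integrable lborel (\<lambda>a. h (a + 512 * m a) - h (a - 512 * m a))"
begin

text \<open>The real displacement of the boundary is at most \<open>512 * m\<close>. By monotonicity the first summand absorbs it; the second one absorbs the error of the Poisson integral inside the strip.\<close>

definition margin :: "real \<Rightarrow> real" where
  "margin a = h (a + 512 * m a) - h (a - 512 * m a) + 1600000 * (m a)\<^sup>2"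

text \<open>At distances up to 1 the slow variation is multiplied by the smallness of
  \<open>m\<close>; beyond 1 the smallness alone suffices. The tiny constant gives
  \<open>a + 512 * m a\<close> a Lipschitz constant of at most 2.\<close>

lemma m_lipschitz: "\<bar>m a - m b\<bar> \<le> \<bar>a - b\<bar> / 10 ^ 8"
proof -
  have A: "m a - m b \<le> \<bar>a - b\<bar> / 10 ^ 8" for a b
  proof (cases "\<bar>a - b\<bar> \<le> 1")
    case True
    define u where "u = \<bar>a - b\<bar>"
    have u: "0 \<le> u" "u \<le> 1" using True by (auto simp: u_def)
    have "exp (u / 4) \<le> 1 + u / 4 + (u / 4)\<^sup>2" using u by (intro exp_bound) auto
    also have "(u / 4)\<^sup>2 \<le> u / 4"
      using mult_left_mono[of "u / 4" 1 "u / 4"] u by (simp add: power2_eq_square)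
    finally have e: "exp (u / 4) - 1 \<le> u" using u by simp
    have "m a - m b \<le> m b * (exp (u / 4) - 1)"
      using slow[of a b] by (simp add: u_def algebra_simps)
    also have "\<dots> \<le> 1 / 10 ^ 8 * u"
      using e u m_pos[of b] m_small[of b] by (intro mult_mono) auto
    finally show ?thesis by (simp add: u_def)
  next
    case False
    have "m a - m b \<le> 1 / 10 ^ 8" using m_small[of a] m_pos[of b] by linarith
    also have "\<dots> \<le> \<bar>a - b\<bar> / 10 ^ 8" using False by simp
    finally show ?thesis .
  qed
  have "m b - m a \<le> \<bar>a - b\<bar> / 10 ^ 8" using A[of b a] by (simp only: abs_minus_commute[of b a])
  with A[of a b] show ?thesis by linarith
qed

lemma m_continuous: "continuous_on UNIV m"
  unfolding continuous_on_iff dist_real_def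
proof (intro ballI allI impI)
  fix x e :: real assume e: "e > 0"
  show "\<exists>d>0. \<forall>y\<in>UNIV. \<bar>y - x\<bar> < d \<longrightarrow> \<bar>m y - m x\<bar> < e"
  proof (intro exI[of _ e] conjI ballI impI e)
    fix y assume "\<bar>y - x\<bar> < e"
    moreover have "\<bar>y - x\<bar> / 10 ^ 8 \<le> \<bar>y - x\<bar>" by simp
    ultimately show "\<bar>m y - m x\<bar> < e" using m_lipschitz[of y x] by linarith
  qed
qed

lemma h_continuous: "continuous_on UNIV h"
  unfolding continuous_on_eq_continuous_at[OF open_UNIV] isCont_def
proof (intro ballI)
  fix x
  have "((\<lambda>y. m x * (sqrt \<bar>x - y\<bar> * exp (\<bar>x - y\<bar> / 4))) \<longlongrightarrow> m x * (sqrt \<bar>x - x\<bar> * exp (\<bar>x - x\<bar> / 4))) (at x)"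
    by (intro tendsto_intros) auto
  then have lim: "((\<lambda>y. m x * (sqrt \<bar>x - y\<bar> * exp (\<bar>x - y\<bar> / 4))) \<longlongrightarrow> 0) (at x)"
    by simp
  have "norm (h y - h x) \<le> m x * (sqrt \<bar>x - y\<bar> * exp (\<bar>x - y\<bar> / 4))" for y
    unfolding real_norm_def abs_minus_commute[of "h y"] by (rule holder)
  then have "((\<lambda>y. h y - h x) \<longlongrightarrow> 0) (at x)"
    by (intro Lim_null_comparison[OF _ lim] always_eventually allI)
  then show "(h \<longlongrightarrow> h x) (at x)" by (rule LIM_zero_cancel)
qed

lemma m_shift:
  assumes "\<bar>t\<bar> \<le> 512 * m a"
  shows "m (a + t) \<le> 4 / 3 * m a"
proof -
  have "\<bar>t\<bar> / 4 \<le> 1 / 8" using assms m_small[of a] by simp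
  moreover have "exp (1/8) \<le> (4/3 :: real)"
    using exp_bound[of "1/8"] by (simp add: power2_eq_square)
  ultimately have "exp (\<bar>t\<bar> / 4) \<le> 4 / 3" by (meson exp_le_cancel_iff order_trans)
  then have "m a * exp (\<bar>t\<bar> / 4) \<le> m a * (4 / 3)"
    using m_pos[of a] by (intro mult_left_mono) auto
  then show ?thesis using slow[of "a + t" a] by simp
qed

lemma osc_le: "h (a + 512 * m a) - h (a - 512 * m a) \<le> 1 / 16"
proof -
  have s: "sqrt (512 * m a) * exp (512 * m a / 4) \<le> 1 * 2"
  proof (intro mult_mono)
    show "sqrt (512 * m a) \<le> 1" using m_small[of a] by simp
    have "exp (512 * m a / 4) \<le> exp (1/2)" using m_small[of a] by simp
    also have "\<dots> \<le> 2" using exp_bound[of "1/2"] by (simp add: power2_eq_square)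
    finally show "exp (512 * m a / 4) \<le> 2" .
  qed auto
  have "\<bar>h a - h b\<bar> \<le> m a * 2" if "\<bar>a - b\<bar> = 512 * m a" for b
    using holder[of a b, unfolded that] mult_left_mono[OF s, of "m a"] m_pos[of a] by linarith
  from this[of "a + 512 * m a"] this[of "a - 512 * m a"] m_pos[of a]
  have "\<bar>h a - h (a + 512 * m a)\<bar> \<le> m a * 2" "\<bar>h a - h (a - 512 * m a)\<bar> \<le> m a * 2"
    by simp_all
  then show ?thesis using m_small[of a] by simp
qed

lemma osc_nonneg: "0 \<le> h (a + 512 * m a) - h (a - 512 * m a)"
  using monoD[OF mono, of "a - 512 * m a" "a + 512 * m a"] m_pos[of a] by simp

lemma margin_nonneg: "0 \<le> margin a"
  using osc_nonneg[of a] by (simp add: margin_def)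

lemma margin_le: "margin a \<le> 1 / 8"
proof -
  have "(m a)\<^sup>2 \<le> (1 / 10 ^ 8)\<^sup>2"
    using m_pos[of a] m_small[of a] by (intro power_mono) auto
  then show ?thesis using osc_le[of a] by (simp add: margin_def power2_eq_square)
qed

lemma margin_continuous: "continuous_on UNIV margin"
  unfolding margin_def[abs_def]
  by (intro continuous_intros continuous_on_compose2[OF h_continuous] m_continuous) auto

lemma margin_integrable: "integrable lborel margin"
  unfolding margin_def[abs_def]
  by (intro Bochner_Integration.integrable_add int_h integrable_mult_right int_m)

text \<open>Passing to the shifted arguments at most doubles distances, so the rate 1/4 becomes 1/2
  and each shifted term has the constant \<open>4/3 * sqrt 2 <= 19/10\<close>. Two such terms and
  \<open>1/5\<close> for the quadratic one make 4.\<close>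

lemma margin_holder: "\<bar>margin a - margin b\<bar> \<le> 4 * m a * (sqrt \<bar>a - b\<bar> * exp (\<bar>a - b\<bar> / 2))"
proof -
  define u where "u = \<bar>a - b\<bar>"
  have u: "u \<ge> 0" by (simp add: u_def)
  have ma: "m a > 0" by (rule m_pos)
  have part: "\<bar>h (a + s * m a) - h (b + s * m b)\<bar> \<le> 19 / 10 * (m a * (sqrt u * exp (u / 2)))" if s: "\<bar>s\<bar> = 512" for s
  proof -
    have "\<bar>(a + s * m a) - (b + s * m b)\<bar> \<le> u + \<bar>s\<bar> * \<bar>m a - m b\<bar>"
      unfolding u_def by (simp add: algebra_simps flip: abs_mult)
    also have "\<dots> \<le> 2 * u" using m_lipschitz[of a b] s u unfolding u_def by simp
    finally have d: "\<bar>(a + s * m a) - (b + s * m b)\<bar> \<le> 2 * u" .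
    have sm: "m (a + s * m a) \<le> 4 / 3 * m a"
      by (rule m_shift) (use s ma in \<open>simp add: abs_mult\<close>)
    have s2: "sqrt 2 \<le> (57 / 40 :: real)" by (rule real_le_lsqrt) (auto simp: power2_eq_square)
    have "\<bar>h (a + s * m a) - h (b + s * m b)\<bar>
        \<le> 4 / 3 * m a * (sqrt (2 * u) * exp (2 * u / 4))"
      using d u ma by (intro order_trans[OF holder] mult_mono sm) auto
    also have "\<dots> = 4 / 3 * sqrt 2 * (m a * (sqrt u * exp (u / 2)))"
      by (simp add: real_sqrt_mult)
    also have "\<dots> \<le> 19 / 10 * (m a * (sqrt u * exp (u / 2)))"
      using s2 ma u by (intro mult_right_mono) auto
    finally show ?thesis .
  qed
  have sq: "\<bar>1600000 * (m a)\<^sup>2 - 1600000 * (m b)\<^sup>2\<bar> \<le> m a * (sqrt u * exp (u / 2)) / 5"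
  proof -
    have d: "\<bar>m a - m b\<bar> \<le> sqrt u / 10 ^ 8"
    proof (cases "u \<le> 1")
      case True
      have "u * u \<le> u" using True u by (simp add: mult_left_le)
      then have "u \<le> sqrt u" by (intro real_le_rsqrt) (simp add: power2_eq_square)
      then show ?thesis using m_lipschitz[of a b] unfolding u_def by simp
    next
      case False
      have "\<bar>m a - m b\<bar> \<le> 1 / 10 ^ 8"
        using m_small[of a] m_small[of b] m_pos[of a] m_pos[of b] by linarith
      also have "\<dots> \<le> sqrt u / 10 ^ 8" using False by simp
      finally show ?thesis .
    qed
    have e: "exp (u / 4) \<le> exp (u / 2)" "1 \<le> exp (u / 2)" using u by auto
    have "m b \<le> m a * exp (u / 4)" using slow[of b a] by (simp add: u_def abs_minus_commute)
    also have "\<dots> \<le> m a * exp (u / 2)" using e ma by (intro mult_left_mono) auto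
    finally have mb: "m b \<le> m a * exp (u / 2)" .
    have "m a * 1 \<le> m a * exp (u / 2)" using e ma by (intro mult_left_mono) auto
    with mb have su: "m a + m b \<le> 2 * (m a * exp (u / 2))" by simp
    have "1600000 * (m a)\<^sup>2 - 1600000 * (m b)\<^sup>2 = 1600000 * ((m a + m b) * (m a - m b))"
      by (simp add: power2_eq_square algebra_simps)
    then have "\<bar>1600000 * (m a)\<^sup>2 - 1600000 * (m b)\<^sup>2\<bar> = 1600000 * ((m a + m b) * \<bar>m a - m b\<bar>)"
      using ma m_pos[of b] by (simp add: abs_mult)
    also have "\<dots> \<le> 1600000 * (2 * (m a * exp (u / 2)) * (sqrt u / 10 ^ 8))"
      using ma u by (intro mult_left_mono mult_mono su d) auto
    also have "\<dots> = 4 / 125 * (m a * (sqrt u * exp (u / 2)))" by simp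
    also have "\<dots> \<le> 1 / 5 * (m a * (sqrt u * exp (u / 2)))" using ma u by (intro mult_right_mono) auto
    finally show ?thesis by simp
  qed
  have "\<bar>margin a - margin b\<bar> \<le> \<bar>h (a + 512 * m a) - h (b + 512 * m b)\<bar>
     + \<bar>h (a + - 512 * m a) - h (b + - 512 * m b)\<bar> + \<bar>1600000 * (m a)\<^sup>2 - 1600000 * (m b)\<^sup>2\<bar>"
    unfolding margin_def by simp
  also have "\<dots> \<le> 4 * m a * (sqrt u * exp (u / 2))"
    using part[of 512, simplified] part[of "- 512", simplified] sq by (simp add: mult_ac)
  finally show ?thesis by (simp add: u_def)
qed

text \<open>\<open>Re f\<close> is \<open>A x\<close> plus two conjugate integrals, hence within
  \<open>512 * m (A x)\<close> of \<open>A x\<close>; by monotonicity \<open>h (Re f)\<close>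
  differs from \<open>h (A x)\<close> by at most the oscillation built into the margin.
  \<open>Im f\<close> is the height plus the Poisson integral of \<open>h\<close> along
  \<open>A\<close> minus the push of \<open>N\<close>, and \<open>strip_edge_estimate\<close>
  balances the errors.\<close>

theorem exists_strip_map:
  "\<exists>f B. f holomorphic_on strip \<and>
     (\<forall>z\<in>strip. \<bar>Re (f z) - Re z\<bar> \<le> B \<and> \<bar>Im (f z) - h (Re (f z))\<bar> \<le> pi / 2 - (m (Re (f z)))\<^sup>2 / 4)"
proof -
  obtain A B where A: "\<And>x. (A has_real_derivative 1 - 2 / pi * margin (A x)) (at x)"
    and B: "\<And>x. \<bar>A x - x\<bar> \<le> B"
    using exists_reparametrisation[OF margin_continuous margin_nonneg margin_le margin_integrable] by metis
  have A_lip: "\<bar>A x - A y\<bar> \<le> \<bar>x - y\<bar>" for x y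
  proof -
    have "norm (A x - A y) \<le> 1 * norm (x - y)"
    proof (rule field_differentiable_bound[where S = UNIV])
      show "norm (1 - 2 / pi * margin (A t)) \<le> 1" for t
      proof -
        have "2 / pi * margin (A t) \<le> 1 * 1"
          using pi_gt3 margin_le[of "A t"] margin_nonneg by (intro mult_mono) auto
        moreover have "0 \<le> 2 / pi * margin (A t)" using margin_nonneg by simp
        ultimately show ?thesis by simp
      qed
    qed (use A in auto)
    then show ?thesis by simp
  qed
  have A_cont: "continuous_on UNIV A"
    using A DERIV_isCont by (blast intro: continuous_at_imp_continuous_on)
  define k where "k = (\<lambda>x. h (A x))"
  define w where "w = (\<lambda>x. margin (A x))"
  have cont: "continuous_on UNIV k" "continuous_on UNIV w"
    unfolding k_def w_def
    by (rule continuous_on_compose2[OF h_continuous A_cont], simp)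
       (rule continuous_on_compose2[OF margin_continuous A_cont], simp)
  have meas: "k \<in> borel_measurable borel" "w \<in> borel_measurable borel"
    using cont by (auto intro: borel_measurable_continuous_onI)
  have w01: "0 \<le> w x" "w x \<le> 1 / 8" for x
    using margin_nonneg margin_le by (auto simp: w_def)
  have A': "(A has_real_derivative 1 - 2 / pi * w x) (at x)" for x using A by (simp add: w_def)
  have int_w: "integrable lborel w"
    by (rule integrable_reparametrisation_defect[OF cont(2) w01(1) A' B])
  \<comment> \<open>The drift caused by the limits of tanh at infinity is \<open>x - A x\<close> up
    to a constant, for which the last summand of \<open>f\<close> compensates.\<close>
  obtain \<kappa> where \<kappa>: "\<And>x. (LINT t|lborel. w t * sgn (x - t)) / pi = x - A x + \<kappa>"
    using sgn_integral_reparametrisation[OF cont(2) w01(1) A' B] by blast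
  have k_mod: "\<bar>k (x - u) - k x\<bar> \<le> m (A x) * (sqrt \<bar>u\<bar> * exp (\<bar>u\<bar> / 2))" for x u
  proof -
    have "\<bar>k (x - u) - k x\<bar> \<le> m (A x) * (sqrt \<bar>A x - A (x - u)\<bar> * exp (\<bar>A x - A (x - u)\<bar> / 4))"
      unfolding k_def abs_minus_commute[of "h (A (x - u))"] by (rule holder)
    also have "\<dots> \<le> m (A x) * (sqrt \<bar>u\<bar> * exp (\<bar>u\<bar> / 2))"
      using A_lip[of x "x - u"] m_pos[of "A x"] by (intro mult_left_mono mult_mono) auto
    finally show ?thesis .
  qed
  have w_mod: "\<bar>w (x - u) - w x\<bar> \<le> (4 * m (A x)) * (sqrt \<bar>u\<bar> * exp (\<bar>u\<bar> / 2))" for x u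
  proof -
    have "\<bar>w (x - u) - w x\<bar> \<le> 4 * m (A x) * (sqrt \<bar>A x - A (x - u)\<bar> * exp (\<bar>A x - A (x - u)\<bar> / 2))"
      unfolding w_def abs_minus_commute[of "margin (A (x - u))"] by (rule margin_holder)
    also have "\<dots> \<le> 4 * m (A x) * (sqrt \<bar>u\<bar> * exp (\<bar>u\<bar> / 2))"
      using A_lip[of x "x - u"] m_pos[of "A x"] by (intro mult_left_mono mult_mono) auto
    finally show ?thesis .
  qed
  define H where "H = (\<lambda>z. LINT t|lborel. of_real (k t) * (1 / cosh (z - of_real t)) :: complex)"
  define N where "N = (\<lambda>z. LINT t|lborel. of_real (w t) * (sinh (z - of_real t) / cosh (z - of_real t)) :: complex)"
  define f where "f = (\<lambda>z. z + \<i> / of_real pi * H z - N z / of_real pi + of_real \<kappa>)"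
  have H_hol: "H holomorphic_on strip"
    unfolding H_def
  proof (rule sech_transform_holomorphic[OF meas(1)])
    fix x
    have "integrable lborel (\<lambda>u. k (x - u) * strip_poisson 1 u)"
      by (rule poisson_kernel_bound(1)[OF meas(1) k_mod]) auto
    then have "integrable lborel (\<lambda>t. k (x - (x + - 1 * t)) * strip_poisson 1 (x + - 1 * t))"
      by (subst lborel_integrable_real_affine_iff) auto
    then show "integrable lborel (\<lambda>t. k t * strip_poisson 1 (x - t))" by simp
  qed
  have N_hol: "N holomorphic_on strip"
    unfolding N_def by (rule tanh_transform_holomorphic[OF int_w])
  have f_hol: "f holomorphic_on strip"
    unfolding f_def by (intro holomorphic_intros H_hol N_hol) auto
  have est: "\<bar>Re (f z) - A (Re z)\<bar> \<le> 512 * m (A (Re z)) \<and>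
      \<bar>Im (f z) - h (Re (f z))\<bar> \<le> pi / 2 - (m (A (Re z)))\<^sup>2" if z: "z \<in> strip" for z
  proof -
    define x where "x = Re z"
    define \<eta> where "\<eta> = Im z"
    define c where "c = cos \<eta>"
    define M where "M = m (A x)"
    have M: "0 < M" "M \<le> 1 / 10 ^ 8" using m_pos m_small by (auto simp: M_def)
    have c: "0 < c" "c \<le> 1" using strip_cos_pos[OF z] by (auto simp: c_def \<eta>_def)
    have \<eta>: "\<bar>\<eta>\<bar> < pi / 2" using z by (simp add: strip_def \<eta>_def)
    note k_mod' = k_mod[of x, folded M_def]
    note w_mod' = w_mod[of x, folded M_def]
    have sp_int: "integrable lborel (strip_poisson c)"
      using has_bochner_integral_strip_poisson[OF c(1)] by (simp add: has_bochner_integral_iff)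
    let ?D = "\<lambda>u::real. (sinh u)\<^sup>2 + c\<^sup>2"
    have nz: "?D u \<noteq> 0" for u by (rule less_imp_neq[OF kernel_denominator_pos[OF c(1)], symmetric])
    define \<kappa>1 where "\<kappa>1 = (\<lambda>u. sinh u * (- sin \<eta>) / ?D u)"
    define \<kappa>2 where "\<kappa>2 = (\<lambda>u. sinh u * cosh u / ?D u - sgn u)"
    define T where "T = (\<lambda>u. \<bar>sin \<eta>\<bar> * c / ?D u)"
    have \<kappa>1: "\<bar>\<kappa>1 u\<bar> * \<bar>sinh u\<bar> \<le> 1" "\<bar>\<kappa>1 u\<bar> \<le> strip_poisson c u / c" for u
      unfolding \<kappa>1_def using conjugate_sech_le[OF c, of "- sin \<eta>" u] by simp_all
    have \<kappa>2: "\<bar>\<kappa>2 u\<bar> * \<bar>sinh u\<bar> \<le> 1" "\<bar>\<kappa>2 u\<bar> \<le> 2 * strip_poisson c u / c" for u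
      unfolding \<kappa>2_def using conjugate_tanh_le[OF c, of 0 u] by simp_all
    have \<kappa>1_int: "integrable lborel \<kappa>1"
    proof (rule Bochner_Integration.integrable_bound[OF integrable_divide[OF sp_int]])
      show "\<kappa>1 \<in> borel_measurable lborel"
        unfolding \<kappa>1_def using nz by (simp, intro borel_measurable_continuous_onI continuous_intros) auto
      show "AE u in lborel. norm (\<kappa>1 u) \<le> norm (strip_poisson c u / c)"
        using order_trans[OF \<kappa>1(2) abs_ge_self] by (intro AE_I2) simp
    qed
    have \<kappa>2_int: "integrable lborel \<kappa>2"
    proof (rule Bochner_Integration.integrable_bound[OF integrable_divide[OF integrable_mult_right[OF sp_int]]])
      have "(\<lambda>u. sinh u * cosh u / ?D u) \<in> borel_measurable lborel"
        using nz by (simp, intro borel_measurable_continuous_onI continuous_intros) auto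
      then show "\<kappa>2 \<in> borel_measurable lborel"
        unfolding \<kappa>2_def by (intro borel_measurable_diff) auto
      show "AE u in lborel. norm (\<kappa>2 u) \<le> norm (2 * strip_poisson c u / c)"
        using order_trans[OF \<kappa>2(2) abs_ge_self] by (intro AE_I2) simp
    qed
    note E1 = conjugate_kernel_bound[OF meas(1) k_mod' \<kappa>1_int _ \<kappa>1(1)]
    note E2 = conjugate_kernel_bound[OF meas(2) w_mod' \<kappa>2_int _ \<kappa>2(1)]
    note P1 = poisson_kernel_bound[OF meas(1) k_mod' c]
    note P2 = poisson_kernel_bound[OF meas(2) w_mod' c]
    have odd: "\<kappa>1 (- u) = - \<kappa>1 u" "\<kappa>2 (- u) = - \<kappa>2 u" for u
      by (simp_all add: \<kappa>1_def \<kappa>2_def sgn_minus)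
    have ReH: "Re (H z) = (LINT u|lborel. k (x - u) * strip_poisson c u)"
      and ImH: "Im (H z) = (LINT u|lborel. k (x - u) * \<kappa>1 u)"
    proof -
      have "Re (1 / cosh (Complex u (Im z))) = strip_poisson c u" "Im (1 / cosh (Complex u (Im z))) = \<kappa>1 u" for u
        unfolding Re_sech Im_sech by (simp_all add: c_def \<eta>_def \<kappa>1_def)
      then show "Re (H z) = (LINT u|lborel. k (x - u) * strip_poisson c u)"
        "Im (H z) = (LINT u|lborel. k (x - u) * \<kappa>1 u)"
        unfolding H_def using Re_convolution[of k z "\<lambda>z. 1 / cosh z"] Im_convolution[of k z "\<lambda>z. 1 / cosh z"]
          P1(1) E1(1)[OF odd(1)] by (simp_all add: x_def)
    qed
    \<comment> \<open>The sign of the height: \<open>N\<close> pushes down in the upper half of the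
      strip and up in the lower half.\<close>
    define e where "e = (if \<eta> \<ge> 0 then 1 else - 1 :: real)"
    have e: "\<bar>e\<bar> = 1" "\<eta> = e * \<bar>\<eta>\<bar>" "sin \<eta> = e * \<bar>sin \<eta>\<bar>"
    proof -
      have "sin \<eta> \<ge> 0" if "\<eta> \<ge> 0" using \<eta> that by (intro sin_ge_zero) auto
      moreover have "sin \<eta> \<le> 0" if "\<eta> < 0"
        using \<eta> that sin_ge_zero[of "- \<eta>"] by auto
      ultimately show "\<bar>e\<bar> = 1" "\<eta> = e * \<bar>\<eta>\<bar>" "sin \<eta> = e * \<bar>sin \<eta>\<bar>" by (auto simp: e_def)
    qed
    have w_shift: "integrable lborel (\<lambda>u. w (x - u))"
      using lborel_integrable_real_affine_iff[of "-1" w x] int_w by simp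
    have ws_int: "integrable lborel (\<lambda>u. w (x - u) * sgn u)"
      by (rule Bochner_Integration.integrable_bound[OF w_shift])
         (use w01 in \<open>auto simp: abs_mult abs_sgn_eq intro!: borel_measurable_times
            borel_measurable_integrable[OF w_shift, simplified]\<close>)
    have ws: "(LINT u|lborel. w (x - u) * sgn u) = pi * (x - A x + \<kappa>)"
    proof -
      have "(LINT t|lborel. w t * sgn (x - t)) = (LINT u|lborel. w (x - u) * sgn u)"
        using lborel_integral_real_affine[of "-1" "\<lambda>t. w t * sgn (x - t)" x] by simp
      then show ?thesis using \<kappa>[of x] by (simp add: field_simps)
    qed
    have T: "0 \<le> T u" "T u \<le> strip_poisson c u" "\<bar>sin \<eta>\<bar> * strip_poisson c u - c * strip_poisson 1 u \<le> T u" for u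
      unfolding T_def using c tanh_kernel_le[OF c, of "\<bar>sin \<eta>\<bar>" u] tanh_kernel_ge[OF c, of "\<bar>sin \<eta>\<bar>" u] by auto
    have wT_int: "integrable lborel (\<lambda>u. w (x - u) * T u)"
    proof (rule Bochner_Integration.integrable_bound[OF P2(1)])
      have "T \<in> borel_measurable lborel"
        unfolding T_def using nz by (simp, intro borel_measurable_continuous_onI continuous_intros) auto
      then show "(\<lambda>u. w (x - u) * T u) \<in> borel_measurable lborel"
        by (intro borel_measurable_times borel_measurable_integrable[OF w_shift])
      show "AE u in lborel. norm (w (x - u) * T u) \<le> norm (w (x - u) * strip_poisson c u)"
        using w01 T(1) order_trans[OF T(2) abs_ge_self]
        by (intro AE_I2) (simp add: abs_mult mult_left_mono)
    qed
    define V where "V = (LINT u|lborel. w (x - u) * T u) / pi"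
    have ReN: "Re (N z) = pi * (x - A x + \<kappa>) + (LINT u|lborel. w (x - u) * \<kappa>2 u)"
      and ImN: "Im (N z) = e * (pi * V)"
    proof -
      have r: "Re (sinh (Complex u (Im z)) / cosh (Complex u (Im z))) = \<kappa>2 u + sgn u" for u
        unfolding Re_tanh by (simp add: c_def \<eta>_def \<kappa>2_def)
      have i: "Im (sinh (Complex u (Im z)) / cosh (Complex u (Im z))) = e * T u" for u
        unfolding Im_tanh T_def using e(3) by (simp add: c_def \<eta>_def)
      have ir: "integrable lborel (\<lambda>u. w (x - u) * (\<kappa>2 u + sgn u))"
        unfolding distrib_left by (intro Bochner_Integration.integrable_add E2(1)[OF odd(2)] ws_int)
      have ii: "integrable lborel (\<lambda>u. w (x - u) * (e * T u))"
        using integrable_mult_right[OF wT_int, of e] by (simp add: mult_ac)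
      have "Re (N z) = (LINT u|lborel. w (x - u) * (\<kappa>2 u + sgn u))"
        unfolding N_def using Re_convolution[of w z "\<lambda>z. sinh z / cosh z", unfolded r i x_def[symmetric], OF ir ii] .
      also have "\<dots> = (LINT u|lborel. w (x - u) * \<kappa>2 u) + (LINT u|lborel. w (x - u) * sgn u)"
        unfolding distrib_left by (rule Bochner_Integration.integral_add[OF E2(1)[OF odd(2)] ws_int])
      finally show "Re (N z) = pi * (x - A x + \<kappa>) + (LINT u|lborel. w (x - u) * \<kappa>2 u)"
        unfolding ws by simp
      have "Im (N z) = (LINT u|lborel. w (x - u) * (e * T u))"
        unfolding N_def using Im_convolution[of w z "\<lambda>z. sinh z / cosh z", unfolded r i x_def[symmetric], OF ir ii] .
      also have "\<dots> = e * (LINT u|lborel. w (x - u) * T u)"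
        by (subst integral_mult_right_zero[symmetric]) (simp add: mult_ac)
      finally show "Im (N z) = e * (pi * V)" by (simp add: V_def)
    qed
    have Ref: "Re (f z) = A x - Im (H z) / pi - (LINT u|lborel. w (x - u) * \<kappa>2 u) / pi"
    proof -
      have "Re (f z) = x - Im (H z) / pi - Re (N z) / pi + \<kappa>"
        by (simp add: f_def x_def)
      then show ?thesis unfolding ReN by (simp add: add_divide_distrib)
    qed
    have Imf: "Im (f z) = \<eta> + Re (H z) / pi - e * V"
    proof -
      have "Im (f z) = \<eta> + Re (H z) / pi - Im (N z) / pi"
        by (simp add: f_def \<eta>_def)
      then show ?thesis unfolding ImN by simp
    qed
    have disp: "\<bar>Re (f z) - A x\<bar> \<le> 512 * M"
    proof -
      have "\<bar>Im (H z)\<bar> \<le> 256 * M" unfolding ImH by (rule E1(2)[OF odd(1)])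
      moreover have "\<bar>LINT u|lborel. w (x - u) * \<kappa>2 u\<bar> \<le> 256 * (4 * M)" by (rule E2(2)[OF odd(2)])
      ultimately have "\<bar>- Im (H z) - (LINT u|lborel. w (x - u) * \<kappa>2 u)\<bar> \<le> 1280 * M" by linarith
      then have "\<bar>- Im (H z) - (LINT u|lborel. w (x - u) * \<kappa>2 u)\<bar> / pi \<le> 1280 * M / pi"
        by (intro divide_right_mono) auto
      also have "\<dots> \<le> 1280 * M / 3" using pi_gt3 M by (intro divide_left_mono) auto
      also have "\<dots> \<le> 512 * M" using M by simp
      finally have le: "\<bar>- Im (H z) - (LINT u|lborel. w (x - u) * \<kappa>2 u)\<bar> / pi \<le> 512 * M" .
      have "Re (f z) - A x = (- Im (H z) - (LINT u|lborel. w (x - u) * \<kappa>2 u)) / pi"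
        unfolding Ref by (simp add: diff_divide_distrib)
      then have "\<bar>Re (f z) - A x\<bar> = \<bar>- Im (H z) - (LINT u|lborel. w (x - u) * \<kappa>2 u)\<bar> / pi"
        by (simp only: abs_divide) simp
      with le show ?thesis by linarith
    qed
    define v where "v = h (A x + 512 * M) - h (A x - 512 * M)"
    have v: "0 \<le> v" "v \<le> 1 / 16" "w x = v + 1600000 * M\<^sup>2"
      using osc_nonneg[of "A x"] osc_le[of "A x"] by (simp_all add: v_def M_def w_def margin_def)
    have hd: "\<bar>k x - h (Re (f z))\<bar> \<le> v"
    proof -
      have "h (A x - 512 * M) \<le> h (Re (f z))" "h (Re (f z)) \<le> h (A x + 512 * M)"
        "h (A x - 512 * M) \<le> h (A x)" "h (A x) \<le> h (A x + 512 * M)"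
        using disp M by (auto intro!: monoD[OF mono])
      then show ?thesis unfolding v_def k_def by linarith
    qed
    have V_up: "0 \<le> V" "V \<le> 1 / 8"
    proof -
      show "0 \<le> V" unfolding V_def using w01 T(1) by (intro divide_nonneg_pos Bochner_Integration.integral_nonneg) auto
      have "(LINT u|lborel. w (x - u) * T u) \<le> (LINT u|lborel. 1 / 8 * strip_poisson c u)"
        by (intro integral_mono wT_int integrable_mult_right sp_int mult_mono T w01) auto
      also have "\<dots> = pi / 8"
        using has_bochner_integral_strip_poisson[OF c(1)] by (simp add: has_bochner_integral_iff)
      finally show "V \<le> 1 / 8" by (simp add: V_def divide_le_eq)
    qed
    have V_lo: "v + 1600000 * M\<^sup>2 - c / 4 - 1400 * M * sqrt c \<le> V"
    proof -
      define s where "s = \<bar>sin \<eta>\<bar>"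
      have s: "0 \<le> s" "s \<le> 1" by (auto simp: s_def)
      \<comment> \<open>From \<open>(s + c)^2 >= s^2 + c^2 = 1\<close>. The loss from replacing
        \<open>s\<close> by 1 and the sech correction are each \<open>c\<close> times the bound 1/8
        for \<open>w\<close>, and together they make \<open>c / 4\<close>.\<close>
      have "1 - c \<le> s"
      proof -
        have "s\<^sup>2 + c\<^sup>2 = 1" by (simp add: s_def c_def)
        moreover have "0 \<le> 2 * s * c" using s(1) c(1) by (intro mult_nonneg_nonneg) linarith+
        ultimately have "1\<^sup>2 \<le> (s + c)\<^sup>2" unfolding power2_sum one_power2 by linarith
        then have "1 \<le> s + c" by (rule power2_le_imp_le) (use s(1) c(1) in linarith)
        then show ?thesis by simp
      qed
      have sp1: "integrable lborel (\<lambda>u. w (x - u) * strip_poisson 1 u)"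
        by (rule poisson_kernel_bound(1)[OF meas(2) w_mod']) auto
      have sp1': "integrable lborel (strip_poisson 1)" "(LINT u|lborel. strip_poisson 1 u) = pi"
        using has_bochner_integral_strip_poisson[of 1] by (simp_all add: has_bochner_integral_iff)
      have "(LINT u|lborel. w (x - u) * strip_poisson 1 u) \<le> (LINT u|lborel. 1 / 8 * strip_poisson 1 u)"
        by (intro integral_mono sp1 integrable_mult_right sp1' mult_right_mono w01) (auto simp: strip_poisson_nonneg)
      also have "\<dots> = pi / 8" using sp1' by simp
      finally have i1: "(LINT u|lborel. w (x - u) * strip_poisson 1 u) \<le> pi / 8" .
      define P where "P = (LINT u|lborel. w (x - u) * strip_poisson c u) / pi"
      have "\<bar>P - w x\<bar> \<le> 350 * (4 * M) * sqrt c" unfolding P_def by (rule P2(2))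
      then have P: "w x - 1400 * M * sqrt c \<le> P" by linarith
      have "s * (pi * P) - c * (pi / 8) \<le> s * (pi * P) - c * (LINT u|lborel. w (x - u) * strip_poisson 1 u)"
        using i1 c by (intro diff_left_mono mult_left_mono) auto
      also have "\<dots> = (LINT u|lborel. s * (w (x - u) * strip_poisson c u) - c * (w (x - u) * strip_poisson 1 u))"
        by (subst Bochner_Integration.integral_diff) (auto simp: P_def intro!: integrable_mult_right P2(1) sp1)
      also have "\<dots> \<le> (LINT u|lborel. w (x - u) * T u)"
      proof (rule integral_mono)
        show "s * (w (x - u) * strip_poisson c u) - c * (w (x - u) * strip_poisson 1 u) \<le> w (x - u) * T u" for u
          using mult_left_mono[OF T(3)[of u, folded s_def] w01(1)[of "x - u"]]
          by (simp add: right_diff_distrib mult_ac)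
      qed (intro Bochner_Integration.integrable_diff integrable_mult_right P2(1) sp1 wT_int)+
      finally have "(s * (pi * P) - c * (pi / 8)) / pi \<le> V"
        unfolding V_def by (intro divide_right_mono) auto
      then have V1: "s * P - c / 8 \<le> V" by (simp add: diff_divide_distrib)
      have "s * (w x - 1400 * M * sqrt c) \<le> s * P" using P s by (intro mult_left_mono) auto
      then have V2: "s * w x - s * (1400 * M * sqrt c) - c / 8 \<le> V"
        using V1 by (simp add: right_diff_distrib)
      have "s * (1400 * M * sqrt c) \<le> 1 * (1400 * M * sqrt c)"
        using s M c by (intro mult_right_mono) auto
      moreover have "(1 - c) * w x \<le> s * w x" using \<open>1 - c \<le> s\<close> w01 by (intro mult_right_mono) auto
      moreover have "c * w x \<le> c * (1 / 8)" using c w01 by (intro mult_left_mono) auto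
      ultimately have "w x - c / 4 - 1400 * M * sqrt c \<le> V"
        using V2 unfolding left_diff_distrib by linarith
      then show ?thesis by (simp add: v(3))
    qed
    have cd: "c \<le> pi / 2 - \<bar>\<eta>\<bar>"
    proof -
      have "c = sin (pi / 2 - \<bar>\<eta>\<bar>)" by (simp add: c_def sin_diff)
      also have "\<dots> \<le> pi / 2 - \<bar>\<eta>\<bar>" using \<eta> by (intro sin_x_le_x) auto
      finally show ?thesis .
    qed
    have "\<bar>Im (f z) - h (Re (f z))\<bar> \<le> \<bar>\<eta> - e * V\<bar> + \<bar>Re (H z) / pi - k x\<bar> + \<bar>k x - h (Re (f z))\<bar>"
      unfolding Imf by linarith
    also have "\<eta> - e * V = e * (\<bar>\<eta>\<bar> - V)" by (subst e(2)) (simp add: right_diff_distrib)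
    also have "\<bar>e * (\<bar>\<eta>\<bar> - V)\<bar> = \<bar>\<bar>\<eta>\<bar> - V\<bar>" by (simp add: abs_mult e(1))
    also have "\<bar>\<bar>\<eta>\<bar> - V\<bar> + \<bar>Re (H z) / pi - k x\<bar> + \<bar>k x - h (Re (f z))\<bar> \<le> \<bar>\<bar>\<eta>\<bar> - V\<bar> + 350 * M * sqrt c + v"
      unfolding ReH using P1(2) hd by (intro add_mono) auto
    also have "\<dots> \<le> pi / 2 - M\<^sup>2"
      using M c cd v(1,2) V_up V_lo by (intro strip_edge_estimate[where d = "pi / 2 - \<bar>\<eta>\<bar>"]) auto
    finally show ?thesis using disp by (simp add: x_def M_def)
  qed
  show ?thesis
  proof (intro exI[of _ f] exI[of _ "B + 1"] conjI ballI f_hol)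
    fix z assume z: "z \<in> strip"
    note e = est[OF z]
    define a where "a = A (Re z)"
    have small: "512 * m a \<le> 1" using m_small[of a] by simp
    show "\<bar>Re (f z) - Re z\<bar> \<le> B + 1"
      using conjunct1[OF e] B[of "Re z"] small unfolding a_def by linarith
    \<comment> \<open>The estimate above has \<open>m\<close> at \<open>A (Re z)\<close>. Moving it
      to \<open>Re f\<close> costs the factor \<open>(4/3)^2 < 4\<close>, for which the divisor 4 in
      the claim leaves room.\<close>
    have "m (a + (Re (f z) - a)) \<le> 4 / 3 * m a"
      by (rule m_shift) (use e in \<open>simp add: a_def\<close>)
    then have "(m (Re (f z)))\<^sup>2 \<le> (4 / 3 * m a)\<^sup>2"
      using m_pos by (intro power_mono) (auto intro: less_imp_le)
    also have "(4 / 3 * m a)\<^sup>2 = 16 / 9 * (m a)\<^sup>2" by (simp add: power2_eq_square)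
    finally have "(m (Re (f z)))\<^sup>2 / 4 \<le> (m a)\<^sup>2"
      using zero_le_power2[of "m a"] by linarith
    then show "\<bar>Im (f z) - h (Re (f z))\<bar> \<le> pi / 2 - (m (Re (f z)))\<^sup>2 / 4"
      using conjunct2[OF e] unfolding a_def by linarith
  qed
qed

end

section \<open>The local norm of the derivative\<close>

text \<open>Comparison with \<open>sech (u / 2)\<close>, which is the Poisson kernel at height 0
  after scaling.\<close>

lemma integrable_exp_neg_abs: "integrable lborel (\<lambda>u::real. exp (- (\<bar>u\<bar> / 2)))"
proof (rule Bochner_Integration.integrable_bound)
  have "integrable lborel (strip_poisson 1)"
    using has_bochner_integral_strip_poisson[of 1] by (simp add: has_bochner_integral_iff)
  then show "integrable lborel (\<lambda>u. 1 * strip_poisson 1 (0 + 1 / 2 * u))"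
    using lborel_integrable_real_affine_iff[of "1/2" "strip_poisson 1" 0] by simp
  show "(\<lambda>u::real. exp (- (\<bar>u\<bar> / 2))) \<in> borel_measurable lborel" by simp
  show "AE u in lborel. norm (exp (- (\<bar>u\<bar> / 2))) \<le> norm (1 * strip_poisson 1 (0 + 1 / 2 * u))"
  proof (rule AE_I2)
    fix u :: real
    have "cosh (u / 2) \<le> exp (\<bar>u\<bar> / 2)"
    proof -
      have "exp (u / 2) \<le> exp (\<bar>u\<bar> / 2)" "exp (- (u / 2)) \<le> exp (\<bar>u\<bar> / 2)" by auto
      then show ?thesis unfolding cosh_field_def add_divide_distrib by linarith
    qed
    then have "1 / exp (\<bar>u\<bar> / 2) \<le> 1 / cosh (u / 2)" by (intro divide_left_mono) auto
    then show "norm (exp (- (\<bar>u\<bar> / 2))) \<le> norm (1 * strip_poisson 1 (0 + 1 / 2 * u))"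
      by (simp add: strip_poisson_1 exp_minus inverse_eq_divide)
  qed
qed

lemma integrable_two_sided_convolution:
  fixes q :: "real \<Rightarrow> real"
  assumes q: "integrable lborel q" and q0: "\<And>t. 0 \<le> q t"
  shows "integrable lborel (\<lambda>a. LINT t|lborel. q t * exp (- (\<bar>t - a\<bar> / 2)))"
proof -
  have m: "q \<in> borel_measurable borel" using q by (auto dest: borel_measurable_integrable)
  have e: "integrable lborel (\<lambda>a. exp (- (\<bar>t - a\<bar> / 2)))"
    and e': "(LINT a|lborel. exp (- (\<bar>t - a\<bar> / 2))) = (LINT u|lborel. exp (- (\<bar>u\<bar> / 2)))" for t :: real
    using lborel_integrable_real_affine_iff[of "-1" "\<lambda>u::real. exp (- (\<bar>u\<bar> / 2))" t]
      lborel_integral_real_affine[of "-1" "\<lambda>u::real. exp (- (\<bar>u\<bar> / 2))" t] integrable_exp_neg_abs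
    by simp_all
  have "integrable (lborel \<Otimes>\<^sub>M lborel) (\<lambda>(t, a). q t * exp (- (\<bar>t - a\<bar> / 2)))"
  proof (rule lborel_pair.Fubini_integrable)
    show "(\<lambda>(t, a). q t * exp (- (\<bar>t - a\<bar> / 2))) \<in> borel_measurable (lborel \<Otimes>\<^sub>M lborel)"
      using m by measurable
    have "(LINT a|lborel. norm (case (t, a) of (t, a) \<Rightarrow> q t * exp (- (\<bar>t - a\<bar> / 2))))
        = q t * (LINT u|lborel. exp (- (\<bar>u\<bar> / 2)))" for t
      using q0[of t] e'[of t] by (simp add: abs_mult)
    then show "integrable lborel (\<lambda>t. LINT a|lborel. norm (case (t, a) of (t, a) \<Rightarrow> q t * exp (- (\<bar>t - a\<bar> / 2))))"
      using q by simp
    show "AE t in lborel. integrable lborel (\<lambda>a. case (t, a) of (t, a) \<Rightarrow> q t * exp (- (\<bar>t - a\<bar> / 2)))"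
      using e by simp
  qed
  then show ?thesis by (rule lborel_pair.integrable_snd)
qed

text \<open>The half-width of the window depends on \<open>t\<close> and not on \<open>a\<close>:
  for fixed \<open>t\<close> the admissible \<open>a\<close> form an interval of length
  \<open>2 * p t\<close>, so Fubini reduces the claim to the integrability of
  \<open>v * p\<close>.\<close>

lemma integrable_window:
  fixes v p :: "real \<Rightarrow> real"
  assumes v: "v \<in> borel_measurable borel" "\<And>t. 0 \<le> v t" and p: "p \<in> borel_measurable borel" "\<And>t. 0 \<le> p t"
    and int: "integrable lborel (\<lambda>t. v t * p t)"
  shows "integrable lborel (\<lambda>a. LINT t|lborel. v t * (if \<bar>t - a\<bar> \<le> p t then 1 else 0))"
proof -
  have i: "has_bochner_integral lborel (\<lambda>a. if \<bar>t - a\<bar> \<le> p t then 1 else 0) (2 * p t)" for t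
  proof -
    have "(\<lambda>a. if \<bar>t - a\<bar> \<le> p t then 1 else 0) = indicat_real {t - p t .. t + p t}"
      by (auto simp: fun_eq_iff indicator_def abs_le_iff)
    moreover have "has_bochner_integral lborel (indicat_real {t - p t .. t + p t}) (2 * p t)"
      using p(2)[of t] by (auto simp: has_bochner_integral_iff)
    ultimately show ?thesis by simp
  qed
  have "integrable (lborel \<Otimes>\<^sub>M lborel) (\<lambda>(t, a). v t * (if \<bar>t - a\<bar> \<le> p t then 1 else 0))"
  proof (rule lborel_pair.Fubini_integrable)
    show "(\<lambda>(t, a). v t * (if \<bar>t - a\<bar> \<le> p t then 1 else 0)) \<in> borel_measurable (lborel \<Otimes>\<^sub>M lborel)"
      using v(1) p(1) by measurable
    have "(LINT a|lborel. norm (case (t, a) of (t, a) \<Rightarrow> v t * (if \<bar>t - a\<bar> \<le> p t then 1 else 0)))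
        = 2 * (v t * p t)" for t
    proof -
      have "(LINT a|lborel. norm (v t * (if \<bar>t - a\<bar> \<le> p t then 1 else 0))) = (LINT a|lborel. v t * (if \<bar>t - a\<bar> \<le> p t then 1 else 0))"
        using v(2)[of t] by (intro Bochner_Integration.integral_cong) auto
      also have "\<dots> = v t * (2 * p t)"
        using i[of t] unfolding integral_mult_right_zero by (simp add: has_bochner_integral_iff)
      finally show ?thesis by simp
    qed
    then show "integrable lborel (\<lambda>t. LINT a|lborel. norm (case (t, a) of (t, a) \<Rightarrow> v t * (if \<bar>t - a\<bar> \<le> p t then 1 else 0)))"
      using int by simp
    have "integrable lborel (\<lambda>a. v t * (if \<bar>t - a\<bar> \<le> p t then 1 else 0))" for t
      using i[of t] by (intro integrable_mult_right) (simp add: has_bochner_integral_iff)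
    then show "AE t in lborel. integrable lborel (\<lambda>a. case (t, a) of (t, a) \<Rightarrow> v t * (if \<bar>t - a\<bar> \<le> p t then 1 else 0))"
      by simp
  qed
  then show ?thesis by (rule lborel_pair.integrable_snd)
qed

text \<open>Cauchy-Schwarz, obtained by expanding the integral of the square of
  \<open>g - r\<close>, where \<open>r\<close> is the mean slope.\<close>

lemma increment_square_le:
  fixes G g :: "real \<Rightarrow> real"
  assumes G: "\<And>x. (G has_real_derivative g x) (at x)" and g: "continuous_on UNIV g" and xy: "x \<le> y"
  shows "(G y - G x)\<^sup>2 \<le> (y - x) * (LINT t|lborel. indicator {x..y} t * (g t)\<^sup>2)"
proof (cases "x = y")
  case False
  then have xy': "x < y" using xy by simp
  define D where "D = G y - G x"
  define r where "r = D / (y - x)"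
  define Q where "Q = (LINT t|lborel. indicator {x..y} t * (g t)\<^sup>2)"
  have int: "integrable lborel (\<lambda>t. indicator {x..y} t * k t)" if "continuous_on UNIV k" for k :: "real \<Rightarrow> real"
    using borel_integrable_atLeastAtMost'[OF continuous_on_subset[OF that], of x y] by (simp add: set_integrable_def)
  note i = int[OF continuous_on_power[OF g, of 2]] int[OF g] int[of "\<lambda>t. 1"]
  have "0 \<le> (LINT t|lborel. indicator {x..y} t * (g t - r)\<^sup>2)"
    by (intro Bochner_Integration.integral_nonneg) auto
  also have "(\<lambda>t. indicator {x..y} t * (g t - r)\<^sup>2)
      = (\<lambda>t. indicator {x..y} t * (g t)\<^sup>2 - 2 * r * (indicator {x..y} t * g t) + r\<^sup>2 * (indicator {x..y} t * 1))"
    by (simp add: fun_eq_iff power2_diff algebra_simps)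
  also have "(LINT t|lborel. indicator {x..y} t * (g t)\<^sup>2 - 2 * r * (indicator {x..y} t * g t) + r\<^sup>2 * (indicator {x..y} t * 1))
     = Q - 2 * r * (LINT t|lborel. indicator {x..y} t * g t) + r\<^sup>2 * (LINT t|lborel. indicator {x..y} t * 1)"
    unfolding Q_def using i by simp
  also have "(LINT t|lborel. indicator {x..y} t * g t) = D"
    unfolding D_def by (rule integral_indicator_deriv[OF G g xy])
  also have "(LINT t|lborel. indicator {x..y} t * 1) = y - x" using xy by simp
  finally have "0 \<le> Q - 2 * r * D + r\<^sup>2 * (y - x)" .
  also have "\<dots> = Q - D\<^sup>2 / (y - x)"
    using xy' by (simp add: r_def power2_eq_square)
  finally have "D\<^sup>2 \<le> (y - x) * Q" using xy' by (simp add: divide_le_eq mult.commute)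
  then show ?thesis by (simp add: D_def Q_def)
qed simp

lemma small_tail:
  fixes q :: "real \<Rightarrow> real"
  assumes q: "set_integrable lborel {0..} q" and \<epsilon>: "0 < \<epsilon>"
  obtains X where "0 \<le> X" "integrable lborel (\<lambda>t. indicator {X..} t * q t)" "(LINT t|lborel. indicator {X..} t * q t) < \<epsilon>"
proof -
  have q': "integrable lborel (\<lambda>t. indicator {0..} t * q t)" using q by (simp add: set_integrable_def)
  have int: "integrable lborel (\<lambda>t. indicator {real n..} t * q t)" for n
  proof -
    have "integrable lborel (\<lambda>t. (indicator {0..} t * q t) * indicator {real n..} t)"
      by (rule integrable_real_mult_indicator[OF _ q']) simp
    also have "(\<lambda>t. (indicator {0..} t * q t) * indicator {real n..} t) = (\<lambda>t. indicator {real n..} t * q t)"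
      by (auto simp: fun_eq_iff indicator_def)
    finally show ?thesis .
  qed
  have "(\<lambda>n. LINT t|lborel. indicator {real n..} t * q t) \<longlonglongrightarrow> (LINT t|(lborel :: real measure). 0)"
  proof (rule integral_dominated_convergence[where w = "\<lambda>t. norm (indicator {0..} t * q t)"])
    show "AE t in lborel. (\<lambda>n. indicator {real n..} t * q t) \<longlonglongrightarrow> 0"
    proof (rule AE_I2)
      fix t
      have "eventually (\<lambda>n. indicator {real n..} t * q t = 0) sequentially"
        using eventually_gt_at_top[of "nat \<lceil>\<bar>t\<bar>\<rceil>"]
      proof eventually_elim
        case (elim n)
        then have "t < real n" by linarith
        then show ?case by simp
      qed
      then show "(\<lambda>n. indicator {real n..} t * q t) \<longlonglongrightarrow> 0" by (rule tendsto_eventually)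
    qed
    show "(\<lambda>t. indicator {real n..} t * q t) \<in> borel_measurable lborel" for n
      by (rule borel_measurable_integrable[OF int])
    show "integrable lborel (\<lambda>t. norm (indicator {0..} t * q t))"
      by (rule integrable_norm[OF q'])
    show "AE t in lborel. norm (indicator {real n..} t * q t) \<le> norm (indicator {0..} t * q t)" for n
      by (intro AE_I2) (auto simp: indicator_def)
  qed simp
  then have "eventually (\<lambda>n. (LINT t|lborel. indicator {real n..} t * q t) < \<epsilon>) sequentially"
    using \<epsilon> by (intro order_tendstoD) auto
  from eventually_happens'[OF sequentially_bot this]
  obtain n where n: "(LINT t|lborel. indicator {real n..} t * q t) < \<epsilon>" by (rule exE)
  show thesis by (rule that[OF _ int n]) simp
qed

text \<open>\<open>h\<close> is frozen to the left of a point beyond which the square integral is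
  tiny. The weight \<open>exp (- |t - a| / 2)\<close> makes \<open>m^2\<close> vary at rate 1/2 and
  \<open>m\<close> at rate 1/4. The extra summand \<open>\<theta> * exp (- |a| / 2)\<close> respects
  the same rate, makes \<open>m\<close> positive and is the lower bound used for the separation.
  Both summands are at most \<open>10^-17\<close>, and \<open>2 * 10^-17 <= 10^-16\<close>.\<close>

lemma strip_data_of_square_integrable:
  fixes h h' :: "real \<Rightarrow> real"
  assumes mono: "mono h" and deriv: "\<And>x. (h has_real_derivative h' x) (at x)"
    and cont: "continuous_on UNIV h'" and nn: "\<And>x. 0 \<le> h' x"
    and int: "set_integrable lborel {0..} (\<lambda>x. (h' x)\<^sup>2)"
  obtains X0 \<theta> m where "0 \<le> X0" "0 < \<theta>" "\<theta> \<le> 1" "strip_data (\<lambda>x. h (max x X0)) m"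
    "\<And>x. \<theta> * exp (- (\<bar>x\<bar> / 2)) \<le> (m x)\<^sup>2"
proof -
  obtain X0 where X0: "0 \<le> X0" and q_int: "integrable lborel (\<lambda>t. indicator {X0..} t * (h' t)\<^sup>2)"
    and q_small: "(LINT t|lborel. indicator {X0..} t * (h' t)\<^sup>2) < 1 / 10 ^ 17"
    by (rule small_tail[OF int, of "1 / 10 ^ 17"]) simp
  define q where "q = (\<lambda>t. indicator {X0..} t * (h' t)\<^sup>2)"
  define v where "v = (\<lambda>t. indicator {X0..} t * h' t)"
  define \<theta> :: real where "\<theta> = 1 / 10 ^ 17"
  define J where "J = (\<lambda>a. LINT t|lborel. q t * exp (- (\<bar>t - a\<bar> / 2)))"
  define m where "m = (\<lambda>a. sqrt (J a + \<theta> * exp (- (\<bar>a\<bar> / 2))))"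
  define k where "k = (\<lambda>x. h (max x X0))"
  have \<theta>: "0 < \<theta>" "\<theta> \<le> 1" by (simp_all add: \<theta>_def)
  have q: "integrable lborel q" "0 \<le> q t" "(v t)\<^sup>2 = q t" "0 \<le> v t" for t
    using q_int nn by (auto simp: q_def v_def power_mult_distrib indicator_def)
  have h'_meas: "h' \<in> borel_measurable borel" using cont by (rule borel_measurable_continuous_onI)
  have v_meas: "v \<in> borel_measurable borel" unfolding v_def using h'_meas by measurable
  have qe_int: "integrable lborel (\<lambda>t. q t * exp (- (\<bar>t - a\<bar> / 2)))" for a
  proof (rule Bochner_Integration.integrable_bound[OF q(1)])
    show "(\<lambda>t. q t * exp (- (\<bar>t - a\<bar> / 2))) \<in> borel_measurable lborel"
      using borel_measurable_integrable[OF q(1)] by measurable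
    show "AE t in lborel. norm (q t * exp (- (\<bar>t - a\<bar> / 2))) \<le> norm (q t)"
      using q(2) by (intro AE_I2) (simp add: abs_mult mult_left_le)
  qed
  have J0: "0 \<le> J a" for a
    unfolding J_def using q(2) by (intro Bochner_Integration.integral_nonneg) auto
  have J_small: "J a \<le> 1 / 10 ^ 17" for a
  proof -
    have "J a \<le> (LINT t|lborel. q t)"
      unfolding J_def using q(2) by (intro integral_mono qe_int q(1)) (simp add: mult_left_le)
    then show ?thesis using q_small by (simp add: q_def)
  qed
  have J_slow: "J a \<le> J b * exp (\<bar>a - b\<bar> / 2)" for a b
  proof -
    have "J a \<le> (LINT t|lborel. q t * exp (- (\<bar>t - b\<bar> / 2)) * exp (\<bar>a - b\<bar> / 2))"
      unfolding J_def
    proof (intro integral_mono qe_int integrable_mult_left)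
      fix t
      have "exp (- (\<bar>t - a\<bar> / 2)) \<le> exp (- (\<bar>t - b\<bar> / 2) + \<bar>a - b\<bar> / 2)"
        using abs_triangle_ineq[of "t - a" "a - b"] unfolding exp_le_cancel_iff by simp
      then show "q t * exp (- (\<bar>t - a\<bar> / 2)) \<le> q t * exp (- (\<bar>t - b\<bar> / 2)) * exp (\<bar>a - b\<bar> / 2)"
        unfolding exp_add mult.assoc using q(2) by (intro mult_left_mono)
    qed
    also have "\<dots> = J b * exp (\<bar>a - b\<bar> / 2)" unfolding J_def by (rule integral_mult_left_zero)
    finally show ?thesis .
  qed
  have m2: "(m a)\<^sup>2 = J a + \<theta> * exp (- (\<bar>a\<bar> / 2))" for a
    unfolding m_def using J0[of a] \<theta> by (intro real_sqrt_pow2) (simp add: add_nonneg_nonneg)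
  have m_pos: "0 < m a" for a
    unfolding m_def using J0[of a] \<theta> by (simp add: add_nonneg_pos)
  have m_slow: "m a \<le> m b * exp (\<bar>a - b\<bar> / 4)" for a b
  proof (rule power2_le_imp_le)
    have "exp (- (\<bar>a\<bar> / 2)) \<le> exp (- (\<bar>b\<bar> / 2) + \<bar>a - b\<bar> / 2)"
        using abs_triangle_ineq[of a "b - a"] unfolding exp_le_cancel_iff by (simp add: abs_minus_commute)
    then have "\<theta> * exp (- (\<bar>a\<bar> / 2)) \<le> \<theta> * exp (- (\<bar>b\<bar> / 2)) * exp (\<bar>a - b\<bar> / 2)"
      unfolding exp_add mult.assoc using \<theta> by (intro mult_left_mono) auto
    then have "(m a)\<^sup>2 \<le> (m b)\<^sup>2 * exp (\<bar>a - b\<bar> / 2)"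
      unfolding m2 distrib_right using J_slow[of a b] by (intro add_mono)
    also have "\<dots> = (m b * exp (\<bar>a - b\<bar> / 4))\<^sup>2"
      by (simp add: power_mult_distrib flip: exp_double)
    finally show "(m a)\<^sup>2 \<le> (m b * exp (\<bar>a - b\<bar> / 4))\<^sup>2" .
    show "0 \<le> m b * exp (\<bar>a - b\<bar> / 4)" using m_pos[of b] by simp
  qed
  have m_small: "m a \<le> 1 / 10 ^ 8" for a
  proof (rule power2_le_imp_le)
    have "\<theta> * exp (- (\<bar>a\<bar> / 2)) \<le> \<theta> * 1" using \<theta> by (intro mult_left_mono) auto
    then have "(m a)\<^sup>2 \<le> 1 / 10 ^ 17 + \<theta> * 1" unfolding m2 by (intro add_mono J_small)
    also have "\<dots> \<le> (1 / 10 ^ 8)\<^sup>2" by (simp add: \<theta>_def power_divide)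
    finally show "(m a)\<^sup>2 \<le> (1 / 10 ^ 8)\<^sup>2" .
  qed simp
  have m2_int: "integrable lborel (\<lambda>a. (m a)\<^sup>2)"
    unfolding m2 J_def
    by (intro Bochner_Integration.integrable_add integrable_two_sided_convolution q integrable_mult_right integrable_exp_neg_abs)
  have m_meas: "m \<in> borel_measurable borel"
  proof -
    have "(\<lambda>a. sqrt ((m a)\<^sup>2)) \<in> borel_measurable borel"
      using borel_measurable_integrable[OF m2_int] by (intro measurable_compose[OF _ borel_measurable_sqrt]) simp
    moreover have "(\<lambda>a. sqrt ((m a)\<^sup>2)) = m" using m_pos by (auto simp: fun_eq_iff less_imp_le)
    ultimately show ?thesis by simp
  qed
  have k_mono: "mono k" unfolding k_def by (intro monoI monoD[OF mono]) auto
  have inc: "(k b - k a)\<^sup>2 \<le> (b - a) * (exp ((b - a) / 2) * J c)" if ab: "a \<le> b" and c: "c \<in> {a, b}" for a b c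
  proof (cases "b \<le> X0")
    case True
    then have "k a = k b" using ab by (simp add: k_def)
    then show ?thesis using ab J0 by (simp add: mult_nonneg_nonneg)
  next
    case False
    define a' where "a' = max a X0"
    have a': "a \<le> a'" "X0 \<le> a'" "a' \<le> b" using False ab by (auto simp: a'_def)
    have kk: "k b = h b" "k a = h a'" using False by (simp_all add: k_def a'_def)
    have "(h b - h a')\<^sup>2 \<le> (b - a') * (LINT t|lborel. indicator {a'..b} t * (h' t)\<^sup>2)"
      by (rule increment_square_le[OF deriv cont a'(3)])
    also have "\<dots> \<le> (b - a') * (LINT t|lborel. exp ((b - a) / 2) * (q t * exp (- (\<bar>t - c\<bar> / 2))))"
    proof (intro mult_left_mono integral_mono integrable_mult_right qe_int)
      show "integrable lborel (\<lambda>t. indicator {a'..b} t * (h' t)\<^sup>2)"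
        using borel_integrable_atLeastAtMost'[OF continuous_on_subset[OF continuous_on_power[OF cont]], of a' b 2]
        by (simp add: set_integrable_def)
      show "indicator {a'..b} t * (h' t)\<^sup>2 \<le> exp ((b - a) / 2) * (q t * exp (- (\<bar>t - c\<bar> / 2)))" for t
      proof (cases "t \<in> {a'..b}")
        case True
        then have "\<bar>t - c\<bar> \<le> b - a" using a' c by auto
        then have "1 \<le> exp ((b - a) / 2 + - (\<bar>t - c\<bar> / 2))" by simp
        then have "1 * q t \<le> exp ((b - a) / 2) * exp (- (\<bar>t - c\<bar> / 2)) * q t"
          unfolding exp_add using q(2) by (intro mult_right_mono)
        then show ?thesis using True a' by (simp add: q_def mult_ac)
      qed (use q(2) in auto)
    qed (use a' in auto)
    also have "\<dots> = (b - a') * (exp ((b - a) / 2) * J c)" unfolding J_def by simp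
    also have "\<dots> \<le> (b - a) * (exp ((b - a) / 2) * J c)"
      using a' J0 by (intro mult_right_mono) auto
    finally show ?thesis by (simp add: kk)
  qed
  have holder: "\<bar>k a - k b\<bar> \<le> m a * (sqrt \<bar>a - b\<bar> * exp (\<bar>a - b\<bar> / 4))" for a b
  proof (rule power2_le_imp_le)
    have "(k a - k b)\<^sup>2 \<le> \<bar>a - b\<bar> * (exp (\<bar>a - b\<bar> / 2) * J a)"
      using inc[of a b a] inc[of b a a] by (cases "a \<le> b") (auto simp: power2_commute)
    also have "\<dots> \<le> \<bar>a - b\<bar> * (exp (\<bar>a - b\<bar> / 2) * (m a)\<^sup>2)"
      unfolding m2 using \<theta> by (intro mult_left_mono) auto
    also have "\<dots> = (m a * (sqrt \<bar>a - b\<bar> * exp (\<bar>a - b\<bar> / 4)))\<^sup>2"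
      by (simp add: power_mult_distrib flip: exp_double)
    finally show "\<bar>k a - k b\<bar>\<^sup>2 \<le> (m a * (sqrt \<bar>a - b\<bar> * exp (\<bar>a - b\<bar> / 4)))\<^sup>2" by simp
    show "0 \<le> m a * (sqrt \<bar>a - b\<bar> * exp (\<bar>a - b\<bar> / 4))" using m_pos[of a] by simp
  qed
  have vi: "integrable lborel (\<lambda>t. indicator {a..b} t * v t)" for a b
  proof -
    have "integrable lborel (\<lambda>t. (indicator {a..b} t *\<^sub>R h' t) * indicator {X0..} t)"
      using borel_integrable_atLeastAtMost'[OF continuous_on_subset[OF cont], of a b]
      by (intro integrable_real_mult_indicator) (auto simp: set_integrable_def)
    then show ?thesis by (simp add: v_def mult_ac)
  qed
  have k_int: "(LINT t|lborel. indicator {a..b} t * v t) = k b - k a" if ab: "a \<le> b" for a b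
  proof (cases "b < X0")
    case True
    then have "(\<lambda>t. indicator {a..b} t * v t) = (\<lambda>t. 0)" by (auto simp: fun_eq_iff v_def indicator_def)
    then have "(LINT t|lborel. indicator {a..b} t * v t) = 0" by (simp only:) simp
    then show ?thesis using True ab by (simp add: k_def)
  next
    case False
    have "(\<lambda>t. indicator {a..b} t * v t) = (\<lambda>t. indicator {max a X0..b} t * h' t)"
      by (auto simp: fun_eq_iff v_def indicator_def)
    then have "(LINT t|lborel. indicator {a..b} t * v t) = (LINT t|lborel. indicator {max a X0..b} t * h' t)"
      by (simp only:)
    also have "\<dots> = h b - h (max a X0)"
      by (rule integral_indicator_deriv[OF deriv cont]) (use ab False in auto)
    finally show ?thesis using False by (simp add: k_def)
  qed
  \<comment> \<open>\<open>1024 = 2 * 512\<close>: for \<open>|t - a| <= 512 * m a\<close> slow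
    variation gives \<open>m a <= 2 * m t\<close>, so the window around \<open>a\<close> lies in the
    set \<open>|t - a| <= p t\<close>, to which Fubini applies.\<close>
  define p where "p = (\<lambda>t. 1024 * m t)"
  have p: "p \<in> borel_measurable borel" "0 \<le> p t" "p t \<le> 1" for t
    using m_meas m_pos[of t] m_small[of t] by (auto simp: p_def less_imp_le)
  have vp: "integrable lborel (\<lambda>t. v t * p t)"
  proof (rule Bochner_Integration.integrable_bound)
    show "integrable lborel (\<lambda>t. 1024 * (q t + (m t)\<^sup>2))"
      by (intro integrable_mult_right Bochner_Integration.integrable_add q(1) m2_int)
    show "(\<lambda>t. v t * p t) \<in> borel_measurable lborel" using v_meas p(1) by measurable
    show "AE t in lborel. norm (v t * p t) \<le> norm (1024 * (q t + (m t)\<^sup>2))"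
    proof (rule AE_I2)
      fix t
      have vm: "0 \<le> v t * m t" using q(4) m_pos[of t] by simp
      have "0 \<le> (v t - m t)\<^sup>2" by simp
      then have "2 * (v t * m t) \<le> q t + (m t)\<^sup>2" unfolding power2_diff q(3) by simp
      then have "v t * m t \<le> q t + (m t)\<^sup>2" using vm by linarith
      then show "norm (v t * p t) \<le> norm (1024 * (q t + (m t)\<^sup>2))"
        using q(2)[of t] q(4)[of t] m_pos[of t] by (simp add: p_def abs_mult mult_ac)
    qed
  qed
  have osc_int: "integrable lborel (\<lambda>a. k (a + 512 * m a) - k (a - 512 * m a))"
  proof (rule Bochner_Integration.integrable_bound)
    show "integrable lborel (\<lambda>a. LINT t|lborel. v t * (if \<bar>t - a\<bar> \<le> p t then 1 else 0))"
      by (rule integrable_window[OF v_meas q(4) p(1,2) vp])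
    have "k \<in> borel_measurable borel" by (rule borel_measurable_mono[OF k_mono])
    then show "(\<lambda>a. k (a + 512 * m a) - k (a - 512 * m a)) \<in> borel_measurable lborel"
      using m_meas by measurable
    show "AE a in lborel. norm (k (a + 512 * m a) - k (a - 512 * m a))
        \<le> norm (LINT t|lborel. v t * (if \<bar>t - a\<bar> \<le> p t then 1 else 0))"
    proof (rule AE_I2)
      fix a
      let ?d = "512 * m a"
      have d: "0 \<le> ?d" "?d \<le> 1" using m_pos[of a] m_small[of a] by auto
      have "k (a - ?d) \<le> k (a + ?d)" using d by (intro monoD[OF k_mono]) auto
      then have "norm (k (a + ?d) - k (a - ?d)) = (LINT t|lborel. indicator {a - ?d..a + ?d} t * v t)"
        using k_int[of "a - ?d" "a + ?d"] d by simp
      also have "\<dots> \<le> (LINT t|lborel. v t * (if \<bar>t - a\<bar> \<le> p t then 1 else 0))"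
      proof (intro integral_mono vi)
        show "integrable lborel (\<lambda>t. v t * (if \<bar>t - a\<bar> \<le> p t then 1 else 0))"
        proof (rule Bochner_Integration.integrable_bound[OF vi[of "a - 1" "a + 1"]])
          show "(\<lambda>t. v t * (if \<bar>t - a\<bar> \<le> p t then 1 else 0)) \<in> borel_measurable lborel"
            using v_meas p(1) by measurable
          show "AE t in lborel. norm (v t * (if \<bar>t - a\<bar> \<le> p t then 1 else 0)) \<le> norm (indicator {a - 1..a + 1} t * v t)"
          proof (rule AE_I2)
            fix t show "norm (v t * (if \<bar>t - a\<bar> \<le> p t then 1 else 0)) \<le> norm (indicator {a - 1..a + 1} t * v t)"
              using p(3)[of t] by (auto simp: indicator_def)
          qed
        qed
        show "indicator {a - ?d..a + ?d} t * v t \<le> v t * (if \<bar>t - a\<bar> \<le> p t then 1 else 0)" for t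
        proof (cases "t \<in> {a - ?d..a + ?d}")
          case True
          then have ta: "\<bar>t - a\<bar> \<le> ?d" by auto
          have "exp (\<bar>a - t\<bar> / 4) \<le> exp (1 / 4)" using ta d by auto
          also have "\<dots> \<le> 2" using exp_bound[of "1/4"] by (simp add: power2_eq_square)
          finally have "m t * exp (\<bar>a - t\<bar> / 4) \<le> m t * 2" using m_pos[of t] by (intro mult_left_mono) auto
          then have "m a \<le> m t * 2" using m_slow[of a t] by linarith
          then have "\<bar>t - a\<bar> \<le> p t" using ta unfolding p_def by linarith
          then show ?thesis using True by simp
        qed (use q(4) in auto)
      qed
      finally show "norm (k (a + ?d) - k (a - ?d)) \<le> norm (LINT t|lborel. v t * (if \<bar>t - a\<bar> \<le> p t then 1 else 0))"
        by simp
    qed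
  qed
  have "strip_data k m"
    by unfold_locales (fact k_mono holder m_slow m_pos m_small m2_int osc_int)+
  then show ?thesis
    using that[OF X0 \<theta>] J0 unfolding k_def by (simp add: m2)
qed

section \<open>The rotating half-plane\<close>

lemma half_le_sin:
  fixes t :: real
  assumes "0 \<le> t" "t \<le> 1"
  shows "t / 2 \<le> sin t"
proof (cases "t = 0")
  case False
  then have "0 < t" using assms by simp
  then obtain z where z: "0 < z" "z < t" "sin t - sin 0 = (t - 0) * cos z"
    using MVT2[of 0 t sin cos] by (auto intro: DERIV_sin)
  have "cos (pi / 3) \<le> cos z"
    using z assms pi_gt3 by (intro cos_monotone_0_pi_le) auto
  then have "t * (1 / 2) \<le> t * cos z" using assms by (intro mult_left_mono) (auto simp: cos_60)
  then show ?thesis using z by simp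
qed simp

lemma exp_diff_lower:
  fixes x y :: real
  shows "\<bar>x - y\<bar> * exp (min x y) \<le> \<bar>exp x - exp y\<bar>"
proof -
  have *: "(b - a) * exp a \<le> exp b - exp a" if "a \<le> b" for a b :: real
  proof -
    have "exp a * (1 + (b - a)) \<le> exp a * exp (b - a)"
      by (intro mult_left_mono exp_ge_add_one_self) auto
    also have "\<dots> = exp b" by (simp flip: exp_add)
    finally show ?thesis by (simp add: algebra_simps)
  qed
  show ?thesis
  proof (cases "x \<le> y")
    case True
    then show ?thesis using *[OF True] by (simp add: min_def abs_if)
  next
    case False
    then show ?thesis using *[of y x] by (simp add: min_def abs_if)
  qed
qed

text \<open>If the distance were below \<open>\<theta> / 500\<close>, the radii would nearly agree
  and \<open>|X - x|\<close> would be of order \<open>\<theta> * exp (- x)\<close>, which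
  \<open>low\<close> bounds by a small multiple of \<open>(m X)^2\<close>. The square-root modulus
  turns this into \<open>|h X - h x| <= (m X)^2 / 8\<close>, half of the available gap. So
  \<open>Y\<close> remains inside the strip around \<open>h x\<close> by the other half, and the
  component of the difference normal to the boundary line at radius \<open>exp x\<close> is at least
  \<open>exp x * (m X)^2 / 32 >= \<theta> / 64\<close>.\<close>

lemma (in strip_data) strip_separation:
  assumes \<theta>: "0 < \<theta>" "\<theta> \<le> 1" and low: "\<And>t. \<theta> * exp (- (\<bar>t\<bar> / 2)) \<le> (m t)\<^sup>2"
    and Y: "\<bar>Y - h X\<bar> \<le> pi / 2 - (m X)\<^sup>2 / 4"
    and x: "0 \<le> x" and \<alpha>: "h x < \<alpha>" "\<alpha> < h x + pi"
  shows "\<theta> / 500 \<le> norm (- \<i> * exp (Complex X Y) - of_real (exp x) * cis \<alpha>)"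
proof (rule ccontr)
  let ?d = "norm (- \<i> * exp (Complex X Y) - of_real (exp x) * cis \<alpha>)"
  assume "\<not> \<theta> / 500 \<le> ?d"
  then have d: "?d < \<theta> / 500" by simp
  have dd: "?d < 1 / 500" using d \<theta> by simp
  have ex: "1 \<le> exp x" using x by simp
  have "\<bar>exp X - exp x\<bar> = \<bar>norm (- \<i> * exp (Complex X Y)) - norm (of_real (exp x) * cis \<alpha>)\<bar>"
    by (simp add: norm_mult)
  also have "\<dots> \<le> ?d" by (rule norm_triangle_ineq3)
  finally have eX: "\<bar>exp X - exp x\<bar> \<le> ?d" .
  then have half: "exp x / 2 \<le> exp X" using dd ex by linarith
  define D where "D = \<bar>X - x\<bar>"
  have D0: "0 \<le> D" by (simp add: D_def)
  have "exp x / 2 \<le> exp (min X x)" using half ex by (simp add: min_def)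
  then have "D * (exp x / 2) \<le> D * exp (min X x)" using D0 by (rule mult_left_mono)
  also have "\<dots> \<le> ?d" using exp_diff_lower[of X x] eX unfolding D_def by linarith
  finally have De: "D * exp x \<le> 2 * (\<theta> / 500)" using d by simp
  have D1: "D \<le> 1 / 250"
  proof -
    have "D * 1 \<le> D * exp x" using ex D0 by (rule mult_left_mono)
    then show ?thesis using De \<theta> by simp
  qed
  define M where "M = m X"
  have M: "0 < M" "M \<le> 1 / 10 ^ 8" using m_pos m_small by (auto simp: M_def)
  have low': "\<theta> * exp (- x) \<le> 2 * M\<^sup>2"
  proof -
    have X: "\<bar>X\<bar> \<le> x + 1 / 250" using D1 x unfolding D_def by linarith
    have e: "exp (1 / 500) \<le> (2 :: real)" using exp_bound[of "1/500"] by (simp add: power2_eq_square)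
    have "exp (- (x / 2)) \<le> exp (1 / 500) * exp (- (\<bar>X\<bar> / 2))"
      unfolding exp_add[symmetric] exp_le_cancel_iff using X by linarith
    also have "\<dots> \<le> 2 * exp (- (\<bar>X\<bar> / 2))" using e by (intro mult_right_mono) auto
    finally have "\<theta> * exp (- (x / 2)) \<le> \<theta> * (2 * exp (- (\<bar>X\<bar> / 2)))" using \<theta> by (intro mult_left_mono) auto
    also have "\<dots> = 2 * (\<theta> * exp (- (\<bar>X\<bar> / 2)))" by simp
    also have "\<dots> \<le> 2 * M\<^sup>2" unfolding M_def by (intro mult_left_mono low) auto
    finally have l2: "\<theta> * exp (- (x / 2)) \<le> 2 * M\<^sup>2" .
    have "\<theta> * exp (- x) \<le> \<theta> * exp (- (x / 2))" using x \<theta> by (intro mult_left_mono) auto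
    with l2 show "\<theta> * exp (- x) \<le> 2 * M\<^sup>2" by linarith
  qed
  have "D = D * exp x * exp (- x)" by (simp add: mult.assoc flip: exp_add)
  also have "\<dots> \<le> 2 * (\<theta> / 500) * exp (- x)" using De by (intro mult_right_mono) auto
  also have "\<dots> = (\<theta> * exp (- x)) / 250" by simp
  also have "\<dots> \<le> 2 * M\<^sup>2 / 250" using low' by (intro divide_right_mono) auto
  also have "\<dots> \<le> (M / 10)\<^sup>2" by (simp add: power2_eq_square)
  finally have "sqrt D \<le> sqrt ((M / 10)\<^sup>2)" by (rule real_sqrt_le_mono)
  then have sD: "sqrt D \<le> M / 10" using M by simp
  have "exp (D / 4) \<le> 5 / 4"
  proof -
    have "exp (D / 4) \<le> exp (1 / 10)" using D1 by simp
    also have "\<dots> \<le> (5 / 4 :: real)" using exp_bound[of "1/10"] by (simp add: power2_eq_square)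
    finally show ?thesis .
  qed
  then have "M * (sqrt D * exp (D / 4)) \<le> M * (M / 10 * (5 / 4))"
    using sD M D0 by (intro mult_left_mono mult_mono) auto
  then have hX: "\<bar>h X - h x\<bar> \<le> M\<^sup>2 / 8"
    using holder[of X x] unfolding M_def[symmetric] D_def[symmetric] by (simp add: power2_eq_square)
  define \<epsilon> where "\<epsilon> = M\<^sup>2 / 8"
  have M2: "M\<^sup>2 \<le> 1" using M by (intro power_le_one) auto
  have \<epsilon>: "0 < \<epsilon>" "\<epsilon> \<le> 1" using M M2 by (auto simp: \<epsilon>_def)
  have "\<bar>Y - h x\<bar> \<le> pi / 2 - \<epsilon>"
    using Y hX unfolding M_def[symmetric] \<epsilon>_def by linarith
  then have "cos (pi / 2 - \<epsilon>) \<le> cos \<bar>Y - h x\<bar>"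
    using \<epsilon> pi_gt3 by (intro cos_monotone_0_pi_le) auto
  then have "sin \<epsilon> \<le> cos (Y - h x)" by (simp add: cos_diff)
  then have c1: "\<epsilon> / 2 \<le> cos (Y - h x)" using half_le_sin[of \<epsilon>] \<epsilon> by linarith
  have s: "0 \<le> sin (\<alpha> - h x)" using \<alpha> by (intro sin_ge_zero) auto
  \<comment> \<open>This rotation takes the line in direction \<open>h x\<close> to the imaginary
    axis, with the angles between \<open>h x\<close> and \<open>h x + pi\<close> on its
    left.\<close>
  define \<rho> where "\<rho> = \<i> * cis (- h x)"
  have \<rho>: "norm \<rho> = 1" by (simp add: \<rho>_def norm_mult)
  have e1: "exp (Complex X Y) = of_real (exp X) * cis Y"
    by (simp add: exp_eq_polar)
  have "Re (\<rho> * (- \<i> * exp (Complex X Y) - of_real (exp x) * cis \<alpha>))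
      = exp X * cos (Y - h x) + exp x * sin (\<alpha> - h x)"
    unfolding \<rho>_def e1 by (simp add: cos_diff sin_diff algebra_simps)
  moreover have "Re (\<rho> * (- \<i> * exp (Complex X Y) - of_real (exp x) * cis \<alpha>)) \<le> ?d"
    using complex_Re_le_cmod[of "\<rho> * (- \<i> * exp (Complex X Y) - of_real (exp x) * cis \<alpha>)"]
    by (simp only: norm_mult \<rho> mult_1)
  moreover have "0 \<le> exp x * sin (\<alpha> - h x)" using s by simp
  ultimately have "exp X * cos (Y - h x) \<le> ?d" by linarith
  moreover have "exp x / 2 * (\<epsilon> / 2) \<le> exp X * cos (Y - h x)"
    using half c1 \<epsilon> by (intro mult_mono) auto
  ultimately have "exp x * M\<^sup>2 / 32 < \<theta> / 500" using d by (simp add: \<epsilon>_def)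
  moreover have "\<theta> / 2 \<le> exp x * M\<^sup>2"
  proof -
    have "exp x * (\<theta> * exp (- x)) \<le> exp x * (2 * M\<^sup>2)" using low' by (intro mult_left_mono) auto
    moreover have "exp x * (\<theta> * exp (- x)) = \<theta>" by (simp add: mult.left_commute flip: exp_add)
    ultimately show ?thesis by simp
  qed
  ultimately show False using \<theta> by simp
qed

text \<open>The logarithm has real part \<open>ln |p|\<close>, so bounded \<open>Re f - Re z\<close>
  means comparable moduli. The factor \<open>- \<i>\<close> turns the angles within
  \<open>pi / 2\<close> of \<open>h\<close> into those between \<open>h - pi\<close> and
  \<open>h\<close>, the complement of the half-plane.\<close>

lemma (in strip_data) exists_half_plane_map:
  assumes \<theta>: "0 < \<theta>" "\<theta> \<le> 1" and low: "\<And>t. \<theta> * exp (- (\<bar>t\<bar> / 2)) \<le> (m t)\<^sup>2"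
  obtains \<Phi> B where "\<Phi> holomorphic_on {p. Re p > 0}"
    "\<And>p. Re p > 0 \<Longrightarrow> exp (- B) * norm p \<le> norm (\<Phi> p)"
    "\<And>p. Re p > 0 \<Longrightarrow> norm (\<Phi> p) \<le> exp B * norm p"
    "\<And>p x \<alpha>. Re p > 0 \<Longrightarrow> 0 \<le> x \<Longrightarrow> h x < \<alpha> \<Longrightarrow> \<alpha> < h x + pi \<Longrightarrow>
       \<theta> / 500 \<le> norm (\<Phi> p - of_real (exp x) * cis \<alpha>)"
proof -
  obtain f B where f: "f holomorphic_on strip"
    and fR: "\<And>z. z \<in> strip \<Longrightarrow> \<bar>Re (f z) - Re z\<bar> \<le> B"
    and fI: "\<And>z. z \<in> strip \<Longrightarrow> \<bar>Im (f z) - h (Re (f z))\<bar> \<le> pi / 2 - (m (Re (f z)))\<^sup>2 / 4"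
    using exists_strip_map by blast
  define \<Phi> where "\<Phi> = (\<lambda>p. - \<i> * exp (f (Ln p)))"
  have Ln_strip: "Ln p \<in> strip" if "Re p > 0" for p
    using Re_Ln_pos_lt_imp[OF that] by (simp add: strip_def)
  have nz: "p \<noteq> 0" if "Re p > 0" for p :: complex using that by auto
  have "(f \<circ> Ln) holomorphic_on {p. Re p > 0}"
  proof (rule holomorphic_on_compose_gen[OF _ f])
    show "Ln holomorphic_on {p. Re p > 0}"
      by (intro holomorphic_intros) (auto simp: complex_nonpos_Reals_iff)
    show "Ln ` {p. Re p > 0} \<subseteq> strip" using Ln_strip by auto
  qed
  then have hol: "\<Phi> holomorphic_on {p. Re p > 0}"
    unfolding \<Phi>_def o_def by (intro holomorphic_intros)
  have norm_\<Phi>: "norm (\<Phi> p) = exp (Re (f (Ln p)))" for p by (simp add: \<Phi>_def norm_mult)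
  have np: "norm p = exp (Re (Ln p))" if "Re p > 0" for p
    using nz[OF that] by simp
  show thesis
  proof (rule that[OF hol])
    fix p :: complex assume p: "Re p > 0"
    note R = fR[OF Ln_strip[OF p]]
    show "exp (- B) * norm p \<le> norm (\<Phi> p)"
      unfolding norm_\<Phi> np[OF p] exp_add[symmetric] exp_le_cancel_iff using R by linarith
    show "norm (\<Phi> p) \<le> exp B * norm p"
      unfolding norm_\<Phi> np[OF p] exp_add[symmetric] exp_le_cancel_iff using R by linarith
    fix x \<alpha> :: real assume x: "0 \<le> x" "h x < \<alpha>" "\<alpha> < h x + pi"
    show "\<theta> / 500 \<le> norm (\<Phi> p - of_real (exp x) * cis \<alpha>)"
      using strip_separation[OF \<theta> low fI[OF Ln_strip[OF p]] x] by (simp add: \<Phi>_def)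
  qed
qed

theorem theorem1p3:
  fixes s h :: "real \<Rightarrow> real"
  assumes "mono_on {0<..} s"
    and "s C2_differentiable_on {0<..}"
    and "h = (\<lambda>x. s (exp x))"
    and "(deriv h \<longlongrightarrow> 0) at_top"
    and "set_integrable lborel {0..} (\<lambda>x. (deriv h x)\<^sup>2)"
  shows "\<exists>F. F holomorphic_on UNIV \<and> \<not> F constant_on UNIV \<and>
    finite_exponential_type F \<and> bounded (F ` rotating_half_plane s)"
proof -
  obtain D where D: "\<And>r. 0 < r \<Longrightarrow> (s has_real_derivative D r) (at r)" and D_cont: "continuous_on {0<..} D"
    using assms(2) unfolding C2_differentiable_on_def C1_differentiable_on_def
    by (auto simp: has_real_derivative_iff_has_vector_derivative)
  have h_deriv: "(h has_real_derivative D (exp x) * exp x) (at x)" for x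
    unfolding assms(3) by (rule DERIV_chain2[OF D]) (auto intro!: derivative_eq_intros)
  then have deriv_h: "deriv h = (\<lambda>x. D (exp x) * exp x)"
    by (intro ext DERIV_imp_deriv)
  have h'_cont: "continuous_on UNIV (deriv h)"
    unfolding deriv_h by (intro continuous_intros continuous_on_compose2[OF D_cont]) auto
  have h_mono: "mono h"
    unfolding assms(3) by (intro monoI mono_onD[OF assms(1)]) auto
  have h_deriv': "(h has_real_derivative deriv h x) (at x)" for x
    using h_deriv[of x] by (simp add: deriv_h)
  have h'_nonneg: "0 \<le> deriv h x" for x
    by (rule mono_on_imp_deriv_nonneg[OF _ h_deriv', where A = UNIV]) (use h_mono in auto)
  obtain X0 \<theta> m where X0: "0 \<le> X0" and \<theta>: "0 < \<theta>" "\<theta> \<le> 1" and sd: "strip_data (\<lambda>x. h (max x X0)) m"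
    and low: "\<And>x. \<theta> * exp (- (\<bar>x\<bar> / 2)) \<le> (m x)\<^sup>2"
    using strip_data_of_square_integrable[OF h_mono h_deriv' h'_cont h'_nonneg assms(5)] by metis
  obtain \<Phi> B where \<Phi>: "\<Phi> holomorphic_on {p. Re p > 0}"
    "\<And>p. Re p > 0 \<Longrightarrow> exp (- B) * norm p \<le> norm (\<Phi> p)"
    "\<And>p. Re p > 0 \<Longrightarrow> norm (\<Phi> p) \<le> exp B * norm p"
    and sep: "\<And>p x \<alpha>. Re p > 0 \<Longrightarrow> 0 \<le> x \<Longrightarrow> h (max x X0) < \<alpha> \<Longrightarrow> \<alpha> < h (max x X0) + pi \<Longrightarrow>
       \<theta> / 500 \<le> norm (\<Phi> p - of_real (exp x) * cis \<alpha>)"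
    using strip_data.exists_half_plane_map[OF sd \<theta> low] by metis
  \<comment> \<open>At radii above \<open>exp X0\<close> the freezing of \<open>h\<close> is
    invisible. The rest of the rotating half-plane lies in a closed disc, where continuity bounds
    \<open>F\<close>.\<close>
  define S where "S = rotating_half_plane s - cball 0 (exp X0)"
  have "\<theta> / 500 \<le> norm (\<Phi> p - z)" if p: "Re p > 0" and z: "z \<in> S" for p z
  proof -
    obtain r \<alpha> where r: "z = of_real r * cis \<alpha>" "0 < r" "s r < \<alpha>" "\<alpha> < s r + pi"
      using z by (auto simp: S_def rotating_half_plane_def)
    have "exp X0 < r" using z r by (simp add: S_def norm_mult)
    then have "X0 < ln r" using r ln_less_cancel_iff[of "exp X0" r] by simp
    then have x: "0 \<le> ln r" "max (ln r) X0 = ln r" using X0 by auto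
    show ?thesis
      using sep[OF p x(1), of \<alpha>, unfolded x(2)] r by (simp add: assms(3))
  qed
  then obtain F A C where F: "F holomorphic_on UNIV" "\<not> F constant_on UNIV" "A > 0" "C > 0"
    "\<forall>z. norm (F z) \<le> A * exp (C * norm z)" "bounded (F ` S)"
    using exists_bounded_entire_of_half_plane_map[OF \<Phi>(1) exp_gt_zero \<Phi>(2,3), of "\<theta> / 500" S] \<theta> by auto
  have "bounded (F ` cball 0 (exp X0))"
    using F(1) by (intro compact_imp_bounded compact_continuous_image)
      (auto intro: holomorphic_on_imp_continuous_on holomorphic_on_subset)
  then have "bounded (F ` S \<union> F ` cball 0 (exp X0))" using F(6) by simp
  then have "bounded (F ` rotating_half_plane s)"
    by (rule bounded_subset) (auto simp: S_def)
  then show ?thesis using F unfolding finite_exponential_type_def by blast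
qed

end
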